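(* Let $p\in(0,1/2)$ be fixed, let $\Theta$ be a compact subset of $(0,p)$, and for $\theta=a\in\Theta$ let $\nu_\theta=p\,\delta_a+(1-p)\,\delta_{1-a}$ (Temkin model). Let $\theta^\star=a^\star$, an interior point of $\Theta$, be the true parameter. Then the following hold. (a) For any $\alpha>0$, $$\frac1n\sum_{x=0}^{n-1}\ \sup_{\theta\in\mathcal{V}_\alpha^{c}}\Big[\phi_\theta(L_{x+1}^n,L_x^n)-\phi_{\theta^\star}(L_{x+1}^n,L_x^n)\Big]\xrightarrow[n\to\infty]{}-\infty\quad\text{in }\mathbf{P}^\star\text{-probability},$$ where $\mathcal{V}_\alpha^{c}=\Theta\setminus\mathcal{V}_\alpha$, $\mathcal{V}_\alpha=\{a\in\Theta:\ d_{\mathrm{KL}}(a^\star|a)\le\alpha\}$. Therefore the maximum likelihood estimator of $a$ is consistent: for any measurable choice $\widehat\theta_n\in\mathrm{Argmax}_{\theta\in\Theta}\,\ell_n^{\mathrm{sb}}(\theta)$, $\widehat\theta_n\to\theta^\star$ in $\mathbf{P}^\star$-probability. (b) The Fisher information is infinite: for any $\theta\in\Theta$, $$\Sigma_\theta=\tilde\pi_\theta\big((\phi_\theta')^2\big)=\sum_{u,v\in\mathbb{Z}_+}\tilde\pi_\theta(u,v)\,[\phi_\theta'(u,v)]^2=+\infty.$$ (c) For any $\theta\in\Theta$ with $\theta\neq\theta^\star$, $$\tilde\pi_{\theta^\star}\big(|\phi_\theta'|\big)=\sum_{u,v\in\mathbb{Z}_+}\tilde\pi_{\theta^\star}(u,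v)\,|\phi_\theta'(u,v)|=+\infty.$$
   Context: Notation: $\mathbb{Z}_+=\{0,1,2,\dots\}$; $\delta_a$ is the Dirac mass at $a$. For $\theta\in\Theta$, let $\omega=(\omega_x)_{x\in\mathbb{Z}}$ be the environment, with law $\mathbb{P}^\theta=\nu_\theta^{\otimes\mathbb{Z}}$ on $(0,1)^{\mathbb{Z}}$ and expectation $\mathbb{E}^\theta$, and let $\rho_x=(1-\omega_x)/\omega_x$. For fixed $\omega$, let $X=(X_t)_{t\in\mathbb{Z}_+}$ be the Markov chain on $\mathbb{Z}$ with $X_0=0$ which jumps from $x$ to $x+1$ with probability $\omega_x$ and to $x-1$ with probability $1-\omega_x$; its law is $P_\omega$. The annealed law is $\mathbf{P}^\theta(\cdot)=\int P_\omega(\cdot)\,d\mathbb{P}^\theta(\omega)$. The process $X$ is generated under the true parameter $\theta^\star$, and $\mathbf{P}^\star=\mathbf{P}^{\theta^\star}$. Hitting times: $T_n=\inf\{t: X_t=n\}$. Numbers of left steps: $L_x^n=\sum_{t=0}^{T_n-1}\mathbf{1}\{X_t=x,\,X_{t+1}=x-1\}$ for $x\in\{0,\dots,n\}$. For $u,v\in\mathbb{Z}_+$: $\phi_\theta(u,v)=\log\int_0^1 s^{u+1}(1-s)^v\,d\nu_\theta(s)$, i.e. here $\phi_\theta(u,v)=\log\big[p\,a^{u+1}(1-a)^v+(1-p)(1-a)^{u+1}a^v\big]$ with $\theta=a$; $\phi_\theta'$ is its derivative with respect to $\theta=a$. Let $Q_\theta(u,v)=\binom{u+v}{v}e^{\phi_\theta(u,v)}$,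 $S=(1+\rho_1+\rho_1\rho_2+\cdots+\rho_1\cdots\rho_k+\cdots)^{-1}$, $\pi_\theta(u)=\mathbb{E}^\theta[S(1-S)^u]$, and $\tilde\pi_\theta(u,v)=\pi_\theta(u)Q_\theta(u,v)$. Fix an arbitrary $\theta_0\in\Theta$ and define the criterion $\ell_n^{\mathrm{sb}}(\theta)=\sum_{x=0}^{n-1}\big[\phi_\theta(L_{x+1}^n,L_x^n)-\phi_{\theta_0}(L_{x+1}^n,L_x^n)\big]$. The Kullback–Leibler distance on $(0,1)\times(0,1)$ is $d_{\mathrm{KL}}(q|q')=q\log\frac{q}{q'}+(1-q)\log\frac{1-q}{1-q'}\ge0$. *)

theory Defs
  imports "HOL-Probability.Probability"
begin

text \<open>
  \<open>p \<delta>\<^sub>a + (1 - p) \<delta>\<^bsub>1-a\<^esub>\<close>, as a Borel measure on the whole real line; for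
  \<open>0 < a < 1\<close> it is carried by \<open>{0<..<1}\<close>, so environments are elements of \<open>int \<Rightarrow> real\<close>
  that almost surely take values in \<open>{0<..<1}\<close>.
\<close>

definition temkin :: "real \<Rightarrow> real \<Rightarrow> real measure" where
  "temkin p a = distr (measure_pmf (bernoulli_pmf p)) borel (\<lambda>b. if b then a else 1 - a)"

lemma emeasure_temkin:
  assumes "0 \<le> p" "p \<le> 1" "A \<in> sets borel"
  shows "emeasure (temkin p a) A =
    ennreal p * emeasure (return borel a) A + ennreal (1 - p) * emeasure (return borel (1 - a)) A"
proof -
  have "emeasure (temkin p a) A = (\<integral>\<^sup>+x. indicator A x \<partial>temkin p a)"
    using assms by (simp add: temkin_def)
  also have "\<dots> = (\<integral>\<^sup>+b. indicator A (if b then a else 1 - a) \<partial>bernoulli_pmf p)"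
    unfolding temkin_def using assms by (subst nn_integral_distr) auto
  finally show ?thesis using assms by (simp add: mult.commute)
qed

definition env_law :: "real \<Rightarrow> real \<Rightarrow> (int \<Rightarrow> real) measure" where
  "env_law p a = PiM UNIV (\<lambda>_. temkin p a)"

definition rho :: "(int \<Rightarrow> real) \<Rightarrow> int \<Rightarrow> real" where
  "rho \<omega> x = (1 - \<omega> x) / \<omega> x"

abbreviation path_space :: "(nat \<Rightarrow> int) measure" where
  "path_space \<equiv> PiM UNIV (\<lambda>_. count_space UNIV)"

text \<open>
  Conditional law of \<open>X\<^sub>t\<close> given the history \<open>h = (X\<^sub>0, \<dots>, X\<^bsub>t-1\<^esub>)\<close>.
  (\<open>bernoulli_pmf\<close> truncates its argument to the unit interval.)
\<close>

fun walk_kernel :: "(int \<Rightarrow> real) \<Rightarrow> nat \<Rightarrow> (nat \<Rightarrow> int) \<Rightarrow> int measure" where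
  "walk_kernel \<omega> 0 h = measure_pmf (return_pmf 0)"
| "walk_kernel \<omega> (Suc t) h =
     measure_pmf (map_pmf (\<lambda>b. if b then h t + 1 else h t - 1) (bernoulli_pmf (\<omega> (h t))))"

text \<open>The Ionescu-Tulcea measure on path space determined by these kernels.\<close>

definition quenched :: "(int \<Rightarrow> real) \<Rightarrow> (nat \<Rightarrow> int) measure" where
  "quenched \<omega> = projective_family.lim UNIV
     (Ionescu_Tulcea.CI (walk_kernel \<omega>) (\<lambda>_. count_space UNIV)) (\<lambda>_. count_space UNIV)"

definition annealed :: "real \<Rightarrow> real \<Rightarrow> (nat \<Rightarrow> int) measure" where
  "annealed p a = env_law p a \<bind> quenched"

definition hit_time :: "nat \<Rightarrow> (nat \<Rightarrow> int) \<Rightarrow> enat" where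
  "hit_time n X = (INF t\<in>{t. X t = int n}. enat t)"

text \<open>
  On the event \<open>hit_time n X = \<infinity>\<close>, which is null under the laws considered here, the index set
  is infinite and the sum is \<open>0\<close> by convention.
\<close>

definition left_steps :: "nat \<Rightarrow> nat \<Rightarrow> (nat \<Rightarrow> int) \<Rightarrow> nat" where
  "left_steps x n X =
     (\<Sum>t | enat t < hit_time n X. of_bool (X t = int x \<and> X (Suc t) = int x - 1))"

definition phi :: "real \<Rightarrow> real \<Rightarrow> nat \<Rightarrow> nat \<Rightarrow> real" where
  "phi p a u v = ln (\<integral>s. s ^ (u + 1) * (1 - s) ^ v \<partial>temkin p a)"

lemma phi_eq:
  assumes "0 \<le> p" "p \<le> 1"
  shows "phi p a u v = ln (p * a ^ (u + 1) * (1 - a) ^ v + (1 - p) * (1 - a) ^ (u + 1) * a ^ v)"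
  unfolding phi_def temkin_def using assms
  by (subst integral_distr) (auto simp: integral_measure_pmf[of UNIV] UNIV_bool algebra_simps)

definition phi' :: "real \<Rightarrow> real \<Rightarrow> nat \<Rightarrow> nat \<Rightarrow> real" where
  "phi' p a u v = deriv (\<lambda>b. phi p b u v) a"

definition Q_kernel :: "real \<Rightarrow> real \<Rightarrow> nat \<Rightarrow> nat \<Rightarrow> real" where
  "Q_kernel p a u v = real ((u + v) choose v) * exp (phi p a u v)"

text \<open>The series is taken in \<open>[0, \<infinity>]\<close>, so \<open>S_var \<omega> = 0\<close> when it diverges.\<close>

definition S_var :: "(int \<Rightarrow> real) \<Rightarrow> real" where
  "S_var \<omega> = enn2real (inverse (\<Sum>k. ennreal (\<Prod>j\<in>{1..k}. rho \<omega> (int j))))"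

definition pi_law :: "real \<Rightarrow> real \<Rightarrow> nat \<Rightarrow> real" where
  "pi_law p a u = (\<integral>\<omega>. S_var \<omega> * (1 - S_var \<omega>) ^ u \<partial>env_law p a)"

definition pi_tilde :: "real \<Rightarrow> real \<Rightarrow> nat \<Rightarrow> nat \<Rightarrow> real" where
  "pi_tilde p a u v = pi_law p a u * Q_kernel p a u v"

definition crit :: "real \<Rightarrow> real \<Rightarrow> nat \<Rightarrow> (nat \<Rightarrow> int) \<Rightarrow> real \<Rightarrow> real" where
  "crit p a0 n X a = (\<Sum>x<n.
     phi p a (left_steps (x + 1) n X) (left_steps x n X)
     - phi p a0 (left_steps (x + 1) n X) (left_steps x n X))"

definition d_KL :: "real \<Rightarrow> real \<Rightarrow> real" where
  "d_KL q q' = q * ln (q / q') + (1 - q) * ln ((1 - q) / (1 - q'))"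

definition KL_nbhd :: "real set \<Rightarrow> real \<Rightarrow> real \<Rightarrow> real set" where
  "KL_nbhd \<Theta> as \<alpha> = {a \<in> \<Theta>. d_KL as a \<le> \<alpha>}"

definition tendsto_in_prob :: "'a measure \<Rightarrow> (nat \<Rightarrow> 'a \<Rightarrow> real) \<Rightarrow> real \<Rightarrow> bool" where
  "tendsto_in_prob M Y c \<longleftrightarrow>
     (\<forall>\<epsilon>>0. (\<lambda>n. measure M {x \<in> space M. \<bar>Y n x - c\<bar> > \<epsilon>}) \<longlonglongrightarrow> 0)"

definition tendsto_minfty_in_prob :: "'a measure \<Rightarrow> (nat \<Rightarrow> 'a \<Rightarrow> ereal) \<Rightarrow> bool" where
  "tendsto_minfty_in_prob M Y \<longleftrightarrow>
     (\<forall>K::real. (\<lambda>n. measure M {x \<in> space M. Y n x < ereal K}) \<longlonglongrightarrow> 1)"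

end

theory Submission
  imports Defs
begin

text \<open>
  Stop the walk when it hits \<open>n\<close>. Read from right to left, the numbers of left steps
  \<open>L\<^sub>n = 0\<close>, \<open>L\<^bsub>n-1\<^esub>\<close>, \<open>\<dots>\<close>, \<open>L\<^sub>0\<close> form a branching process with one immigrant per
  generation: given the environment and \<open>L\<^bsub>x+1\<^esub> = u\<close>, the walk leaves \<open>x\<close> exactly \<open>u + 1\<close> times
  to the right, the last time for good, so \<open>L\<^sub>x\<close> counts the failures before the success number
  \<open>u + 1\<close> in trials with success probability \<open>\<omega>\<^sub>x\<close>. Averaging over the independent \<open>\<omega>\<^sub>x\<close> gives
  a Markov chain with transition kernel \<open>Q\<close>. As only certain
  events have to be shown to be unlikely, it is enough that the law of the profile is dominated by
  the law of the chain (\<open>emeasure_annealed_left_profile_le\<close>); the walk hits \<open>n\<close> almost surely,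
  because products of consecutive \<open>\<rho>\<close> tend to \<open>0\<close> (\<open>AE_annealed_hits\<close>).

  Consistency. Write \<open>N = u + 1 + v\<close> and \<open>m = min (u + 1) v\<close>. Since \<open>e\<^sup>\<phi>\<close> is a mixture
  of two monomials one of which dominates for every parameter below \<open>1/2\<close>, the log-likelihood ratio
  \<open>\<phi>\<^sub>a - \<phi>\<^bsub>a*\<^esub>\<close> is at most
  \<open>ln (1/p) - N d\<^bsub>KL\<^esub>(a* | a) + C \<bar>m - a* N\<bar>\<close>, with one constant \<open>C\<close> for all \<open>a \<in> \<Theta>\<close>
  (\<open>phi_diff_le\<close>). Away from \<open>a*\<close> the middle term is below \<open>- \<alpha> N\<close>, whereas \<open>\<bar>m - a* N\<bar>\<close> exceeds a
  small multiple of \<open>N\<close> only by an amount whose conditional mean given \<open>u\<close> is bounded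
  (\<open>dev_excess_visit_pmf_le\<close>, from exponential moments of the negative binomial law). So the claim
  reduces to \<open>(L\<^sub>0 + \<dots> + L\<^bsub>n-1\<^esub>) / n \<rightarrow> \<infinity>\<close> in probability (\<open>chain_sum_superlinear\<close>), which
  expresses that the walk is too slow to be ballistic: \<open>a < p\<close> makes the mean \<open>\<E> \<rho>\<close> of the offspring
  at least \<open>1\<close>, so the total population of \<open>B\<close> generations has mean at least \<open>B (B + 1) / 2\<close>, and
  cutting the chain into independent blocks of length \<open>B\<close> can only decrease it.

  Infinite information. As soon as \<open>v \<ge> u + 1\<close>, the derivative \<open>\<phi>'\<close> differs by a bounded amount from
  the score \<open>(u + 1) / a - v / (1 - a)\<close> of the negative binomial law (\<open>phi'_near_score\<close>). Under the
  parameter \<open>a\<close> this score has variance of order \<open>u + 1\<close>, and under another parameter its mean is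
  of order \<open>u + 1\<close>. Hence the inner sums over \<open>v\<close> grow linearly in \<open>u\<close>, while
  \<open>\<Sum>\<^sub>u \<pi>(u) (u + 1) = \<E> (1 / S) = \<Sum>\<^sub>k (\<E> \<rho>)\<^sup>k = \<infinity>\<close> (\<open>sum_pi_law_linear\<close>).
\<close>

section \<open>Finite segments of the quenched walk\<close>

definition step_pmf :: "(int \<Rightarrow> real) \<Rightarrow> int \<Rightarrow> int pmf" where
  "step_pmf \<omega> y = map_pmf (\<lambda>b. if b then y + 1 else y - 1) (bernoulli_pmf (\<omega> y))"

text \<open>
  The starting point is a parameter, so that \<open>walk_pmf\<close> obeys a first-step recursion.
  The Ionescu-Tulcea measure, which only knows the walk started at \<open>0\<close>, enters the
  arguments through these finite segments.
\<close>

primrec walk_pmf :: "(int \<Rightarrow> real) \<Rightarrow> nat \<Rightarrow> int \<Rightarrow> int list pmf" where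
  "walk_pmf \<omega> 0 y = return_pmf [y]"
| "walk_pmf \<omega> (Suc t) y = bind_pmf (step_pmf \<omega> y) (\<lambda>z. map_pmf ((#) y) (walk_pmf \<omega> t z))"

lemma pmf_walk_pmf:
  "pmf (walk_pmf \<omega> t y) (map x [0..<Suc t]) =
     (if x 0 = y then \<Prod>i<t. pmf (step_pmf \<omega> (x i)) (x (Suc i)) else 0)"
proof (induction t arbitrary: x y)
  case 0
  then show ?case by (auto simp: pmf_return)
next
  case (Suc t)
  have upt: "map x [0..<Suc (Suc t)] = x 0 # map (\<lambda>i. x (Suc i)) [0..<Suc t]"
    by (simp only: upt_conv_Cons[of 0 "Suc (Suc t)"] map_Suc_upt[symmetric] map_map o_def) auto
  have inner: "pmf (map_pmf ((#) y) (walk_pmf \<omega> t z)) (x 0 # map (\<lambda>i. x (Suc i)) [0..<Suc t]) =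
     (if x 0 = y \<and> x 1 = z then \<Prod>i<t. pmf (step_pmf \<omega> (x (Suc i))) (x (Suc (Suc i))) else 0)" for z
  proof (cases "x 0 = y")
    case True
    then show ?thesis
      using pmf_map_inj'[of "(#) y" "walk_pmf \<omega> t z" "map (\<lambda>i. x (Suc i)) [0..<Suc t]"] Suc.IH[where x="\<lambda>i. x (Suc i)" and y=z]
      by auto
  next
    case False
    then have "x 0 # map (\<lambda>i. x (Suc i)) [0..<Suc t] \<notin> (#) y ` set_pmf (walk_pmf \<omega> t z)"
      by auto
    then show ?thesis using False by (simp add: pmf_eq_0_set_pmf)
  qed
  have "pmf (walk_pmf \<omega> (Suc t) y) (map x [0..<Suc (Suc t)]) =
    (\<integral>z. (if x 0 = y then (\<Prod>i<t. pmf (step_pmf \<omega> (x (Suc i))) (x (Suc (Suc i)))) else 0) * indicator {x 1} z \<partial>step_pmf \<omega> y)"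
    unfolding upt walk_pmf.simps pmf_bind inner
    by (intro Bochner_Integration.integral_cong) (auto simp: indicator_def)
  also have "\<dots> = (if x 0 = y then (\<Prod>i<t. pmf (step_pmf \<omega> (x (Suc i))) (x (Suc (Suc i)))) else 0) * pmf (step_pmf \<omega> y) (x 1)"
    by (simp add: measure_pmf_single)
  also have "\<dots> = (if x 0 = y then \<Prod>i<Suc t. pmf (step_pmf \<omega> (x i)) (x (Suc i)) else 0)"
    by (auto simp: prod.lessThan_Suc_shift simp del: prod.lessThan_Suc)
  finally show ?case .
qed

lemma walk_kernel_Suc: "walk_kernel \<omega> (Suc t) h = measure_pmf (step_pmf \<omega> (h t))"
  by (simp add: step_pmf_def)

lemma measurable_walk_kernel:
  "walk_kernel \<omega> i \<in> measurable (PiM {0..<i} (\<lambda>_. count_space UNIV)) (subprob_algebra (count_space UNIV))"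
proof (cases i)
  case 0
  then have "walk_kernel \<omega> i = (\<lambda>_. measure_pmf (return_pmf 0))" by (simp add: fun_eq_iff)
  then show ?thesis by (simp add: measure_pmf_in_subprob_algebra)
next
  case (Suc t)
  have "(\<lambda>y. measure_pmf (step_pmf \<omega> y)) \<circ> (\<lambda>h. h t) \<in> measurable (PiM {0..<i} (\<lambda>_. count_space UNIV)) (subprob_algebra (count_space UNIV))"
    using Suc by (intro measurable_comp[where N="count_space UNIV"] measurable_component_singleton) (auto simp: measure_pmf_in_subprob_algebra)
  then show ?thesis using Suc by (simp add: o_def walk_kernel_Suc[abs_def] del: walk_kernel.simps)
qed

lemma prob_space_walk_kernel: "prob_space (walk_kernel \<omega> i h)"
  by (cases i) (simp_all add: prob_space_measure_pmf)

lemma Ionescu_Tulcea_walk_kernel: "Ionescu_Tulcea (walk_kernel \<omega>) (\<lambda>_. count_space UNIV)"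
  by (rule Ionescu_Tulcea.intro) (rule measurable_walk_kernel, rule prob_space_walk_kernel)

lemma sets_quenched: "sets (quenched \<omega>) = sets path_space"
proof -
  interpret Ionescu_Tulcea "walk_kernel \<omega>" "\<lambda>_. count_space UNIV" by (rule Ionescu_Tulcea_walk_kernel)
  show ?thesis unfolding quenched_def by (rule PF.sets_lim)
qed

lemma space_quenched: "space (quenched \<omega>) = UNIV"
  using sets_eq_imp_space_eq[OF sets_quenched[of \<omega>]] by (simp add: space_PiM)

text \<open>
  Under the kernels of the Ionescu-Tulcea construction a cylinder with fixed coordinates is a
  single point of the finite product, whose weight is multiplied by one transition probability
  with each new coordinate.
\<close>

lemma emeasure_quenched_cylinder:
  "emeasure (quenched \<omega>) {X. \<forall>i\<le>t. X i = x i} = pmf (walk_pmf \<omega> t 0) (map x [0..<Suc t])"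
proof -
  interpret I: Ionescu_Tulcea "walk_kernel \<omega>" "\<lambda>_. count_space UNIV" by (rule Ionescu_Tulcea_walk_kernel)
  let ?M = "\<lambda>_::nat. count_space (UNIV::int set)"
  let ?r = "\<lambda>n. restrict x {0..<n}"
  define w where "w n = (case n of 0 \<Rightarrow> 1 | Suc t \<Rightarrow> (if x 0 = 0 then \<Prod>i<t. pmf (step_pmf \<omega> (x i)) (x (Suc i)) else 0))" for n
  have sets_single: "{?r n} \<in> sets (PiM {0..<n} ?M)" for n
  proof -
    have "{?r n} = (\<Pi>\<^sub>E i\<in>{0..<n}. {x i})"
      by (auto simp: PiE_iff extensional_def fun_eq_iff)
    also have "\<dots> \<in> sets (PiM {0..<n} ?M)" by (intro sets_PiM_I_finite) auto
    finally show ?thesis .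
  qed
  have kern: "emeasure (walk_kernel \<omega> n (?r n)) {x n} * ennreal (w n) = ennreal (w (Suc n))" for n
  proof (cases n)
    case 0 then show ?thesis by (auto simp: w_def emeasure_pmf_single)
  next
    case (Suc t)
    then have "emeasure (walk_kernel \<omega> n (?r n)) {x n} = pmf (step_pmf \<omega> (x t)) (x (Suc t))"
      by (simp add: walk_kernel_Suc emeasure_pmf_single del: walk_kernel.simps)
    moreover have "w n \<ge> 0" by (auto simp: w_def Suc intro!: prod_nonneg)
    ultimately show ?thesis by (auto simp: Suc w_def ennreal_mult'[symmetric] mult.commute)
  qed
  have C: "emeasure (I.C 0 n (\<lambda>_. undefined)) {?r n} = ennreal (w n)" for n
  proof (induction n)
    case 0
    have "?r 0 = (\<lambda>_. undefined)" by auto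
    then show ?case by (simp add: w_def space_PiM PiM_empty)
  next
    case (Suc n)
    have sp: "(\<lambda>_. undefined) \<in> space (PiM {0..<0::nat} ?M)" by (simp add: space_PiM)
    have "emeasure (I.C 0 (Suc n) (\<lambda>_. undefined)) {?r (Suc n)} =
      (\<integral>\<^sup>+h. emeasure (I.eP n h) {?r (Suc n)} \<partial>I.C 0 n (\<lambda>_. undefined))"
    proof -
      have 1: "space (I.C 0 n (\<lambda>_. undefined)) \<noteq> {}"
        using I.prob_space_C[OF sp, of n] by (simp add: prob_space.not_empty)
      have 2: "I.eP n \<in> measurable (I.C 0 n (\<lambda>_. undefined)) (subprob_algebra (PiM {0..<Suc n} ?M))"
        using I.measurable_eP[of n] I.sets_C[OF sp, of n] by (simp cong: measurable_cong_sets)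
      show ?thesis unfolding I.C.simps add_0
        by (rule emeasure_bind[OF 1 2 sets_single])
    qed
    also have "\<dots> = (\<integral>\<^sup>+h. emeasure (walk_kernel \<omega> n (?r n)) {x n} * indicator {?r n} h \<partial>I.C 0 n (\<lambda>_. undefined))"
    proof (intro nn_integral_cong)
      fix h assume "h \<in> space (I.C 0 n (\<lambda>_. undefined))"
      then have h: "h \<in> space (PiM {0..<n} ?M)" using I.space_C[OF sp, of n] by simp
      then have ext: "h \<in> extensional {0..<n}" by (simp add: space_PiM PiE_iff)
      have *: "fun_upd h n z = ?r (Suc n) \<longleftrightarrow> h = ?r n \<and> z = x n" for z
      proof
        assume eq: "fun_upd h n z = ?r (Suc n)"
        have "h i = ?r n i" for i
          using fun_cong[OF eq, of i] ext by (cases "i < n"; cases "i = n") (auto simp: extensional_def)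
        then show "h = ?r n \<and> z = x n" using fun_cong[OF eq, of n] by auto
      next
        assume "h = ?r n \<and> z = x n"
        then show "fun_upd h n z = ?r (Suc n)" by (auto simp: fun_eq_iff)
      qed
      have "emeasure (I.eP n h) {?r (Suc n)} = emeasure (walk_kernel \<omega> n h) ((\<lambda>z. fun_upd h n z) -` {?r (Suc n)} \<inter> space (?M n))"
        by (rule I.emeasure_eP[OF h sets_single])
      also have "(\<lambda>z. fun_upd h n z) -` {?r (Suc n)} \<inter> space (?M n) = (if h = ?r n then {x n} else {})"
        using * by auto
      finally have eq: "emeasure (I.eP n h) {?r (Suc n)} = emeasure (walk_kernel \<omega> n h) (if h = ?r n then {x n} else {})" .
      show "emeasure (I.eP n h) {?r (Suc n)} = emeasure (walk_kernel \<omega> n (?r n)) {x n} * indicator {?r n} h"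
        unfolding eq by (cases "h = ?r n") simp_all
    qed
    also have "\<dots> = emeasure (walk_kernel \<omega> n (?r n)) {x n} * ennreal (w n)"
      using sets_single[of n] I.sets_C[OF sp, of n] by (subst nn_integral_cmult_indicator) (auto simp: Suc.IH)
    finally show ?case by (simp only: kern)
  qed
  have "emeasure (quenched \<omega>) (I.PF.emb UNIV {0..<Suc t} {?r (Suc t)}) = emeasure (I.CI {0..<Suc t}) {?r (Suc t)}"
    unfolding quenched_def by (rule I.lim) (auto simp: sets_single)
  also have "\<dots> = emeasure (I.C 0 (Suc t) (\<lambda>_. undefined)) (I.PF.emb {0..<Suc t} {0..<Suc t} {?r (Suc t)})"
    by (rule I.emeasure_CI) (auto simp: sets_single)
  also have "I.PF.emb {0..<Suc t} {0..<Suc t} {?r (Suc t)} = {?r (Suc t)}"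
    by (rule prod_emb_id) (auto simp: PiE_def extensional_def)
  also have "I.PF.emb UNIV {0..<Suc t} {?r (Suc t)} = {X. \<forall>i\<le>t. X i = x i}"
    by (auto simp: prod_emb_def space_PiM restrict_def fun_eq_iff less_Suc_eq_le, metis)
  finally have "emeasure (quenched \<omega>) {X. \<forall>i\<le>t. X i = x i} = ennreal (w (Suc t))"
    by (simp only: C)
  then show ?thesis by (simp add: w_def pmf_walk_pmf del: upt_Suc)
qed

lemma prob_space_quenched: "prob_space (quenched \<omega>)"
proof -
  interpret I: Ionescu_Tulcea "walk_kernel \<omega>" "\<lambda>_. count_space UNIV" by (rule Ionescu_Tulcea_walk_kernel)
  have J: "finite ({}::nat set)" "{} \<subseteq> (UNIV::nat set)" by auto
  interpret E: prob_space "I.CI {}" by (rule I.PF.prob_space_P[OF J])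
  have "emeasure (quenched \<omega>) (I.PF.emb UNIV {} (space (PiM {} (\<lambda>_. count_space UNIV)))) = emeasure (I.CI {}) (space (PiM {} (\<lambda>_. count_space UNIV)))"
    unfolding quenched_def by (rule I.lim) auto
  also have "\<dots> = 1" using E.emeasure_space_1 I.PF.space_P[OF J] by simp
  also have "I.PF.emb UNIV {} (space (PiM {} (\<lambda>_. count_space UNIV))) = space (quenched \<omega>)"
    by (auto simp: prod_emb_def space_PiM space_quenched)
  finally show ?thesis by (rule prob_spaceI)
qed

lemma sets_cylinder: "{X. \<forall>i\<le>t. X i = x i} \<in> sets path_space"
proof -
  have "{X. \<forall>i\<le>t. X i = x i} = {X \<in> space path_space. \<forall>i\<in>{..t}. X i = x i}" by (auto simp: space_PiM)
  also have "\<dots> \<in> sets path_space" by measurable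
  finally show ?thesis .
qed

lemma measurable_path_prefix:
  "(\<lambda>X. map X [0..<Suc t]) \<in> measurable path_space (count_space (UNIV :: int list set))"
proof (subst measurable_count_space_eq2_countable, intro conjI ballI)
  fix xs :: "int list"
  show "(\<lambda>X. map X [0..<Suc t]) -` {xs} \<inter> space path_space \<in> sets path_space"
  proof (cases "length xs = Suc t")
    case True
    then have "(\<lambda>X. map X [0..<Suc t]) -` {xs} \<inter> space path_space = {X. \<forall>i\<le>t. X i = xs ! i}"
      by (auto simp: space_PiM list_eq_iff_nth_eq less_Suc_eq_le simp del: upt_Suc)
    then show ?thesis by (simp only: sets_cylinder)
  next
    case False
    then have "(\<lambda>X. map X [0..<Suc t]) -` {xs} \<inter> space path_space = {}" by (auto simp del: upt_Suc)
    then show ?thesis by (simp only: sets.empty_sets)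
  qed
qed auto

lemma length_walk_pmf: "xs \<in> set_pmf (walk_pmf \<omega> t y) \<Longrightarrow> length xs = Suc t"
  by (induction t arbitrary: y xs) auto

lemma distr_quenched_prefix:
  "distr (quenched \<omega>) (count_space UNIV) (\<lambda>X. map X [0..<Suc t]) = measure_pmf (walk_pmf \<omega> t 0)"
proof (rule measure_eqI_countable[where A="UNIV :: int list set"])
  fix xs :: "int list"
  have m: "(\<lambda>X. map X [0..<Suc t]) \<in> measurable (quenched \<omega>) (count_space UNIV)"
    using measurable_path_prefix by (simp add: measurable_cong_sets[OF sets_quenched refl])
  have "emeasure (distr (quenched \<omega>) (count_space UNIV) (\<lambda>X. map X [0..<Suc t])) {xs} =
    emeasure (quenched \<omega>) {X. map X [0..<Suc t] = xs}"
    by (subst emeasure_distr[OF m]) (auto simp: space_quenched vimage_def simp del: upt_Suc)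
  also have "\<dots> = emeasure (measure_pmf (walk_pmf \<omega> t 0)) {xs}"
  proof (cases "length xs = Suc t")
    case True
    then have xs: "map ((!) xs) [0..<Suc t] = xs" by (metis map_nth)
    from True have "{X. map X [0..<Suc t] = xs} = {X. \<forall>i\<le>t. X i = xs ! i}"
      by (auto simp: list_eq_iff_nth_eq less_Suc_eq_le simp del: upt_Suc)
    then show ?thesis by (simp only: emeasure_quenched_cylinder xs emeasure_pmf_single)
  next
    case False
    then have "{X. map X [0..<Suc t] = xs} = {}" by (auto simp del: upt_Suc)
    moreover have "pmf (walk_pmf \<omega> t 0) xs = 0"
      using False length_walk_pmf by (fastforce simp: pmf_eq_0_set_pmf)
    ultimately show ?thesis by (simp only: emeasure_empty emeasure_pmf_single) simp
  qed
  finally show "emeasure (distr (quenched \<omega>) (count_space UNIV) (\<lambda>X. map X [0..<Suc t])) {xs} = emeasure (measure_pmf (walk_pmf \<omega> t 0)) {xs}" .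
qed auto

lemma emeasure_quenched_prefix:
  "emeasure (quenched \<omega>) {X. P (map X [0..<Suc t])} = emeasure (walk_pmf \<omega> t 0) {xs. P xs}"
proof -
  have m: "(\<lambda>X. map X [0..<Suc t]) \<in> measurable (quenched \<omega>) (count_space UNIV)"
    using measurable_path_prefix by (simp add: measurable_cong_sets[OF sets_quenched refl])
  show ?thesis unfolding distr_quenched_prefix[symmetric]
    by (subst emeasure_distr[OF m]) (auto simp: space_quenched vimage_def simp del: upt_Suc)
qed

section \<open>The annealed measure\<close>

lemma pmf_bernoulli_min_max: "pmf (bernoulli_pmf q) b = (if b then min 1 (max 0 q) else 1 - min 1 (max 0 q))"
  by (cases b) (simp_all add: bernoulli_pmf.rep_eq)

lemma pmf_step_pmf:
  "pmf (step_pmf \<omega> y) z =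
     (if z = y + 1 then min 1 (max 0 (\<omega> y)) else if z = y - 1 then 1 - min 1 (max 0 (\<omega> y)) else 0)"
proof -
  let ?f = "\<lambda>b. if b then y + 1 else y - 1"
  have inj: "inj ?f" by (auto simp: inj_def split: if_splits)
  have "z = ?f True \<or> z = ?f False \<or> z \<notin> ?f ` set_pmf (bernoulli_pmf (\<omega> y))" by auto
  then show ?thesis
    using pmf_map_inj'[OF inj, of "bernoulli_pmf (\<omega> y)" True] pmf_map_inj'[OF inj, of "bernoulli_pmf (\<omega> y)" False]
    unfolding step_pmf_def
    by (auto simp: pmf_bernoulli_min_max pmf_eq_0_set_pmf)
qed

lemma measurable_pmf_walk_pmf:
  "(\<lambda>\<omega>. pmf (walk_pmf \<omega> t 0) xs) \<in> borel_measurable (PiM UNIV (\<lambda>_. borel))"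
proof (cases "length xs = Suc t")
  case True
  then have xs: "map ((!) xs) [0..<Suc t] = xs" by (metis map_nth)
  have "(\<lambda>\<omega>. pmf (walk_pmf \<omega> t 0) xs) = (\<lambda>\<omega>. if xs ! 0 = 0 then \<Prod>i<t. pmf (step_pmf \<omega> (xs ! i)) (xs ! Suc i) else 0)"
    using pmf_walk_pmf[of _ t 0 "(!) xs"] unfolding xs by auto
  moreover have "(\<lambda>\<omega>. pmf (step_pmf \<omega> y) z) \<in> borel_measurable (PiM UNIV (\<lambda>_. borel))" for y z
    unfolding pmf_step_pmf by measurable
  ultimately show ?thesis by (cases "xs ! 0 = 0") simp_all
next
  case False
  then have "pmf (walk_pmf \<omega> t 0) xs = 0" for \<omega>
    using length_walk_pmf by (fastforce simp: pmf_eq_0_set_pmf)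
  then show ?thesis by simp
qed

text \<open>
  Fixing a whole initial segment, rather than arbitrary coordinates, gives a generator that is
  stable under intersection and on which the quenched law is a finite product.
\<close>

definition prefix_cylinders :: "(nat \<Rightarrow> int) set set" where
  "prefix_cylinders = {{X. map X [0..<Suc t] = xs} | t xs. True}"

lemma Int_stable_prefix_cylinders: "Int_stable prefix_cylinders"
proof -
  have *: "{X. map X [0..<Suc s] = xs} \<inter> {X. map X [0..<Suc t] = ys} \<in> prefix_cylinders" if "s \<le> t" for s t xs ys
  proof -
    have tk: "take (Suc s) (map X [0..<Suc t]) = map X [0..<Suc s]" for X :: "nat \<Rightarrow> int"
      using that by (simp add: take_map del: upt_Suc)
    show ?thesis
    proof (cases "take (Suc s) ys = xs")
      case True
      then have "{X. map X [0..<Suc s] = xs} \<inter> {X. map X [0..<Suc t] = ys} = {X. map X [0..<Suc t] = ys}"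
        using tk by auto
      then show ?thesis unfolding prefix_cylinders_def by blast
    next
      case False
      then have "{X. map X [0..<Suc s] = xs} \<inter> {X. map X [0..<Suc t] = ys} = {}"
        using tk by auto
      moreover have "{} = {X :: nat \<Rightarrow> int. map X [0..<Suc 0] = []}" by auto
      ultimately show ?thesis unfolding prefix_cylinders_def by blast
    qed
  qed
  show ?thesis
  proof (rule Int_stableI)
    fix A B assume "A \<in> prefix_cylinders" "B \<in> prefix_cylinders"
    then obtain s t xs ys where A: "A = {X. map X [0..<Suc s] = xs}" and B: "B = {X. map X [0..<Suc t] = ys}"
      unfolding prefix_cylinders_def by blast
    show "A \<inter> B \<in> prefix_cylinders"
      using *[of s t xs ys] *[of t s ys xs] unfolding A B by (cases "s \<le> t") (auto simp: Int_commute simp del: upt_Suc)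
  qed
qed

lemma sets_path_space_prefix_cylinders: "sets path_space = sigma_sets UNIV prefix_cylinders"
proof
  have "prefix_cylinders \<subseteq> sets path_space"
  proof
    fix A assume "A \<in> prefix_cylinders"
    then obtain t xs where A: "A = {X. map X [0..<Suc t] = xs}" unfolding prefix_cylinders_def by blast
    have "(\<lambda>X. map X [0..<Suc t]) -` {xs} \<inter> space path_space \<in> sets path_space"
      by (rule measurable_sets[OF measurable_path_prefix]) auto
    then show "A \<in> sets path_space" unfolding A by (simp add: vimage_def space_PiM del: upt_Suc)
  qed
  then show "sigma_sets UNIV prefix_cylinders \<subseteq> sets path_space"
    using sets.sigma_sets_subset[of prefix_cylinders path_space] by (simp add: space_PiM)
next
  interpret S: sigma_algebra UNIV "sigma_sets UNIV prefix_cylinders"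
    by (rule sigma_algebra_sigma_sets) auto
  have "{f. f i \<in> A} \<in> sigma_sets UNIV prefix_cylinders" for i and A :: "int set"
  proof -
    have "{f. f i \<in> A} = (\<Union>xs\<in>{xs. xs ! i \<in> A}. {X. map X [0..<Suc i] = xs})"
      by (auto simp del: upt_Suc)
    also have "\<dots> \<in> sigma_sets UNIV prefix_cylinders"
    proof (rule S.countable_UN'')
      show "countable {xs. xs ! i \<in> A}" by simp
      fix xs show "{X. map X [0..<Suc i] = xs} \<in> sigma_sets UNIV prefix_cylinders"
        unfolding prefix_cylinders_def by (rule sigma_sets.Basic) blast
    qed
    finally show ?thesis .
  qed
  then show "sets path_space \<subseteq> sigma_sets UNIV prefix_cylinders"
    unfolding sets_PiM_single by (simp add: PiE_UNIV_domain, intro sigma_sets_mono) auto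
qed

text \<open>
  Needed to evaluate the monadic bind in the annealed measure. On the generator the quenched law is
  a finite product of transition probabilities, each of which is measurable in the environment.
\<close>

lemma measurable_quenched: "quenched \<in> measurable (PiM UNIV (\<lambda>_. borel)) (prob_algebra path_space)"
proof (rule measurable_prob_algebra_generated[OF sets_path_space_prefix_cylinders Int_stable_prefix_cylinders])
  fix A assume "A \<in> prefix_cylinders"
  then obtain t xs where A: "A = {X. map X [0..<Suc t] = xs}" unfolding prefix_cylinders_def by blast
  have "emeasure (quenched \<omega>) A = pmf (walk_pmf \<omega> t 0) xs" for \<omega>
    unfolding A using emeasure_quenched_prefix[of \<omega> "\<lambda>ys. ys = xs" t]
    by (simp add: emeasure_pmf_single del: upt_Suc)
  then show "(\<lambda>\<omega>. emeasure (quenched \<omega>) A) \<in> borel_measurable (PiM UNIV (\<lambda>_. borel))"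
    using measurable_pmf_walk_pmf by simp
qed (auto simp: prob_space_quenched sets_quenched)

lemma sets_temkin [simp, measurable_cong]: "sets (temkin p a) = sets borel"
  by (simp add: temkin_def)

lemma prob_space_temkin: "prob_space (temkin p a)"
  unfolding temkin_def by (rule prob_space.prob_space_distr) (auto intro: prob_space_measure_pmf)

lemma sets_env_law [measurable_cong]: "sets (env_law p a) = sets (PiM UNIV (\<lambda>_. borel))"
  unfolding env_law_def by (rule sets_PiM_cong) auto

lemma prob_space_env_law: "prob_space (env_law p a)"
  unfolding env_law_def by (rule prob_space_PiM) (rule prob_space_temkin)

lemma env_law_in_prob_algebra: "env_law p a \<in> space (prob_algebra (PiM UNIV (\<lambda>_. borel)))"
  by (simp add: space_prob_algebra prob_space_env_law sets_env_law)

lemma sets_annealed [measurable_cong]: "sets (annealed p a) = sets path_space"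
  unfolding annealed_def by (rule sets_bind'[OF env_law_in_prob_algebra measurable_quenched])

lemma space_annealed: "space (annealed p a) = UNIV"
  using sets_eq_imp_space_eq[OF sets_annealed[of p a]] by (simp add: space_PiM)

lemma prob_space_annealed: "prob_space (annealed p a)"
  unfolding annealed_def by (rule prob_space_bind'[OF env_law_in_prob_algebra measurable_quenched])

lemma emeasure_annealed:
  "A \<in> sets path_space \<Longrightarrow> emeasure (annealed p a) A = (\<integral>\<^sup>+\<omega>. emeasure (quenched \<omega>) A \<partial>env_law p a)"
  unfolding annealed_def by (rule emeasure_bind_prob_algebra[OF env_law_in_prob_algebra measurable_quenched])

lemma nn_integral_temkin:
  assumes "0 \<le> p" "p \<le> 1" "f \<in> borel_measurable borel"
  shows "(\<integral>\<^sup>+s. f s \<partial>temkin p a) = ennreal p * f a + ennreal (1 - p) * f (1 - a)"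
  unfolding temkin_def using assms by (subst nn_integral_distr) (auto simp: mult.commute)

lemma AE_env_law: "AE \<omega> in env_law p a. \<forall>x. \<omega> x = a \<or> \<omega> x = 1 - a"
proof -
  have "AE s in temkin p a. s = a \<or> s = 1 - a"
    unfolding temkin_def by (subst AE_distr_iff) auto
  then have "AE \<omega> in env_law p a. \<omega> x = a \<or> \<omega> x = 1 - a" for x
    unfolding env_law_def by (intro AE_PiM_component) (auto intro: prob_space_temkin)
  then show ?thesis by (simp add: AE_all_countable)
qed

text \<open>
  This is the independence of the environment at distinct sites.
\<close>

lemma nn_integral_env_law_prod:
  assumes "finite J" "\<And>x. x \<in> J \<Longrightarrow> f x \<in> borel_measurable borel"
  shows "(\<integral>\<^sup>+\<omega>. (\<Prod>x\<in>J. f x (\<omega> x)) \<partial>env_law p a) = (\<Prod>x\<in>J. \<integral>\<^sup>+s. f x s \<partial>temkin p a)"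
proof -
  interpret P: product_prob_space "\<lambda>_. temkin p a" "UNIV :: int set"
    by (rule product_prob_spaceI) (rule prob_space_temkin)
  have m: "(\<lambda>\<omega>. restrict \<omega> J) \<in> measurable (env_law p a) (PiM J (\<lambda>_. temkin p a))"
    unfolding env_law_def by (rule measurable_restrict_subset) simp
  have f: "(\<lambda>\<omega>. \<Prod>x\<in>J. f x (\<omega> x)) \<in> borel_measurable (PiM J (\<lambda>_. temkin p a))"
  proof (rule borel_measurable_prod_ennreal)
    fix x assume "x \<in> J"
    have "f x \<in> measurable (temkin p a) borel"
      using assms(2)[OF \<open>x \<in> J\<close>] by (simp cong: measurable_cong_sets)
    then show "(\<lambda>\<omega>. f x (\<omega> x)) \<in> borel_measurable (PiM J (\<lambda>_. temkin p a))"
      using \<open>x \<in> J\<close> by (rule measurable_PiM_component_rev[rotated])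
  qed
  have "(\<integral>\<^sup>+\<omega>. (\<Prod>x\<in>J. f x (\<omega> x)) \<partial>env_law p a) = (\<integral>\<^sup>+\<omega>. (\<Prod>x\<in>J. f x (restrict \<omega> J x)) \<partial>env_law p a)"
    by (intro nn_integral_cong prod.cong) auto
  also have "\<dots> = (\<integral>\<^sup>+\<omega>. (\<Prod>x\<in>J. f x (\<omega> x)) \<partial>distr (env_law p a) (PiM J (\<lambda>_. temkin p a)) (\<lambda>\<omega>. restrict \<omega> J))"
    by (rule nn_integral_distr[OF m, symmetric]) (simp add: f)
  also have "distr (env_law p a) (PiM J (\<lambda>_. temkin p a)) (\<lambda>\<omega>. restrict \<omega> J) = PiM J (\<lambda>_. temkin p a)"
    unfolding env_law_def by (rule P.distr_PiM_restrict_finite[OF assms(1)]) simp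
  also have "(\<integral>\<^sup>+\<omega>. (\<Prod>x\<in>J. f x (\<omega> x)) \<partial>PiM J (\<lambda>_. temkin p a)) = (\<Prod>x\<in>J. \<integral>\<^sup>+s. f x s \<partial>temkin p a)"
    using assms by (intro P.product_nn_integral_prod) (auto cong: measurable_cong_sets)
  finally show ?thesis .
qed

section \<open>Almost sure hitting of every site to the right\<close>

lemma emeasure_walk_pmf_Suc:
  assumes "0 \<le> \<omega> y" "\<omega> y \<le> 1"
  shows "emeasure (walk_pmf \<omega> (Suc t) y) A =
    ennreal (\<omega> y) * emeasure (walk_pmf \<omega> t (y + 1)) {xs. y # xs \<in> A}
    + ennreal (1 - \<omega> y) * emeasure (walk_pmf \<omega> t (y - 1)) {xs. y # xs \<in> A}"
  using assms by (simp add: step_pmf_def vimage_def mult.commute)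

definition hit_prob :: "(int \<Rightarrow> real) \<Rightarrow> int \<Rightarrow> nat \<Rightarrow> int \<Rightarrow> real" where
  "hit_prob \<omega> b t y = measure_pmf.prob (walk_pmf \<omega> t y) {xs. b \<in> set xs}"

lemma hit_prob_bounds: "0 \<le> hit_prob \<omega> b t y" "hit_prob \<omega> b t y \<le> 1"
  by (simp_all add: hit_prob_def)

lemma start_in_walk_pmf: "xs \<in> set_pmf (walk_pmf \<omega> t y) \<Longrightarrow> y \<in> set xs"
  by (cases t) auto

lemma hit_prob_target: "hit_prob \<omega> b t b = 1"
  unfolding hit_prob_def by (subst measure_pmf.prob_eq_1) (auto intro!: AE_pmfI start_in_walk_pmf)

lemma hit_prob_0: "y \<noteq> b \<Longrightarrow> hit_prob \<omega> b 0 y = 0"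
  by (simp add: hit_prob_def)

lemma hit_prob_Suc:
  assumes "0 \<le> \<omega> y" "\<omega> y \<le> 1" "y \<noteq> b"
  shows "hit_prob \<omega> b (Suc t) y = \<omega> y * hit_prob \<omega> b t (y + 1) + (1 - \<omega> y) * hit_prob \<omega> b t (y - 1)"
proof -
  have "{xs. y # xs \<in> {xs. b \<in> set xs}} = {xs. b \<in> set xs}" using assms by auto
  then have "ennreal (hit_prob \<omega> b (Suc t) y) =
    ennreal (\<omega> y) * ennreal (hit_prob \<omega> b t (y + 1)) + ennreal (1 - \<omega> y) * ennreal (hit_prob \<omega> b t (y - 1))"
    unfolding hit_prob_def using emeasure_walk_pmf_Suc[of \<omega> y t, OF assms(1,2), of "{xs. b \<in> set xs}"]
    by (simp only: measure_pmf.emeasure_eq_measure)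
  also have "\<dots> = ennreal (\<omega> y * hit_prob \<omega> b t (y + 1) + (1 - \<omega> y) * hit_prob \<omega> b t (y - 1))"
    using assms by (simp add: ennreal_mult' ennreal_plus hit_prob_bounds)
  finally show ?thesis
    using assms by (subst (asm) ennreal_inj) (auto intro!: add_nonneg_nonneg mult_nonneg_nonneg simp: hit_prob_bounds)
qed

lemma incseq_hit_prob:
  assumes "\<And>y. 0 \<le> \<omega> y" "\<And>y. \<omega> y \<le> 1"
  shows "incseq (\<lambda>t. hit_prob \<omega> b t y)"
proof (rule incseq_SucI)
  fix t show "hit_prob \<omega> b t y \<le> hit_prob \<omega> b (Suc t) y"
  proof (induction t arbitrary: y)
    case 0
    then show ?case
      by (cases "y = b") (simp_all add: hit_prob_target hit_prob_0 hit_prob_bounds del: walk_pmf.simps)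
  next
    case (Suc t)
    show ?case
    proof (cases "y = b")
      case False
      have "hit_prob \<omega> b (Suc t) y = \<omega> y * hit_prob \<omega> b t (y + 1) + (1 - \<omega> y) * hit_prob \<omega> b t (y - 1)"
        using False assms by (rule_tac hit_prob_Suc) auto
      also have "\<dots> \<le> \<omega> y * hit_prob \<omega> b (Suc t) (y + 1) + (1 - \<omega> y) * hit_prob \<omega> b (Suc t) (y - 1)"
        using assms[of y] by (intro add_mono mult_left_mono Suc.IH) auto
      also have "\<dots> = hit_prob \<omega> b (Suc (Suc t)) y"
        using False assms by (rule_tac hit_prob_Suc[symmetric]) auto
      finally show ?thesis .
    qed (simp add: hit_prob_target)
  qed
qed

text \<open>
  To the left of the target, harmonicity says that consecutive increments of \<open>h\<close> differ by the
  factor \<open>\<rho>\<close>. All increments are therefore multiples of the one next to the target, and have its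
  sign. As \<open>h\<close> takes values in the unit interval, no increment exceeds \<open>1\<close>, so the first one is
  at most any product of consecutive \<open>\<rho>\<close>; these products can be made small.
\<close>

lemma harmonic_left_of_target:
  fixes h :: "int \<Rightarrow> real" and b :: nat
  assumes h01: "\<And>y. 0 \<le> h y" "\<And>y. h y \<le> 1" and hb: "h (int b) = 1"
    and harm: "\<And>y. y < int b \<Longrightarrow> h y = \<omega> y * h (y + 1) + (1 - \<omega> y) * h (y - 1)"
    and \<omega>: "\<And>y. 0 < \<omega> y" "\<And>y. \<omega> y < 1"
    and R: "\<And>y. inverse (rho \<omega> y) \<le> R" "1 \<le> R"
  shows "1 - h 0 \<le> real b * R ^ b * (\<Prod>i<k. rho \<omega> (int b - 1 - int i))"
proof -
  define d where "d i = h (int b - int i) - h (int b - 1 - int i)" for i :: nat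
  have \<rho>: "rho \<omega> y > 0" for y using \<omega>[of y] by (simp add: rho_def)
  have rec: "d (Suc i) = d i / rho \<omega> (int b - 1 - int i)" for i
  proof -
    let ?y = "int b - 1 - int i"
    have eq: "?y + 1 = int b - int i" "?y - 1 = int b - 1 - int (Suc i)" "?y = int b - int (Suc i)" by auto
    have "h ?y = \<omega> ?y * h (?y + 1) + (1 - \<omega> ?y) * h (?y - 1)" by (rule harm) auto
    then have "\<omega> ?y * (h (?y + 1) - h ?y) = (1 - \<omega> ?y) * (h ?y - h (?y - 1))" by (simp add: algebra_simps)
    then have "\<omega> ?y * d i = (1 - \<omega> ?y) * d (Suc i)" unfolding d_def eq(1,2) eq(3)[symmetric] by simp
    then show ?thesis using \<omega>[of ?y] unfolding rho_def by (simp add: field_simps)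
  qed
  have d0: "0 \<le> d 0" using hb h01(2)[of "int b - 1"] by (simp add: d_def)
  have prod: "d 0 = d i * (\<Prod>j<i. rho \<omega> (int b - 1 - int j))" for i
  proof (induction i)
    case (Suc i)
    have "d i = d (Suc i) * rho \<omega> (int b - 1 - int i)" using \<rho>[of "int b - 1 - int i"] by (simp add: rec)
    then show ?case using Suc by (simp add: mult_ac)
  qed simp
  have pos: "0 \<le> (\<Prod>j<i. rho \<omega> (int b - 1 - int j))" for i by (intro prod_nonneg) (simp add: \<rho> less_imp_le)
  have dk: "d 0 \<le> (\<Prod>j<k. rho \<omega> (int b - 1 - int j))"
  proof -
    have "d k \<le> 1" using h01(2)[of "int b - int k"] h01(1)[of "int b - 1 - int k"] by (simp add: d_def)
    then show ?thesis using prod[of k] mult_right_mono[of "d k" 1, OF _ pos[of k]] by simp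
  qed
  have di: "d i \<le> d 0 * R ^ i \<and> 0 \<le> d i" for i
  proof (induction i)
    case (Suc i)
    have "d (Suc i) = d i * inverse (rho \<omega> (int b - 1 - int i))" by (simp add: rec field_simps)
    also have "\<dots> \<le> (d 0 * R ^ i) * R" using Suc R d0 \<rho> by (intro mult_mono) (auto simp: less_imp_le)
    finally show ?case using Suc \<rho>[of "int b - 1 - int i"] by (simp add: rec mult_ac)
  qed (simp add: d0)
  have tele: "1 - h (int b - int m) = (\<Sum>i<m. d i)" for m
    by (induction m) (simp_all add: hb d_def algebra_simps)
  have "1 - h 0 = (\<Sum>i<b. d i)" using tele[of b] by simp
  also have "\<dots> \<le> (\<Sum>i<b. d 0 * R ^ b)"
    using di R d0 by (intro sum_mono order_trans[OF conjunct1[OF di]] mult_left_mono power_increasing) auto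
  also have "\<dots> = real b * R ^ b * d 0" by simp
  also have "\<dots> \<le> real b * R ^ b * (\<Prod>i<k. rho \<omega> (int b - 1 - int i))"
    using dk R by (intro mult_left_mono) auto
  finally show ?thesis .
qed

lemma sets_hits_event: "{X. \<exists>t. X t = b} \<in> sets path_space"
proof -
  have "{X. \<exists>t. X t = b} = {X \<in> space path_space. \<exists>t. X t = b}" by (auto simp: space_PiM)
  also have "\<dots> \<in> sets path_space" by measurable
  finally show ?thesis .
qed

lemma hit_prob_tendsto:
  "(\<lambda>t. hit_prob \<omega> b t 0) \<longlonglongrightarrow> measure (quenched \<omega>) {X. \<exists>t. X t = b}"
proof -
  interpret prob_space "quenched \<omega>" by (rule prob_space_quenched)
  have set: "b \<in> set (map X [0..<Suc t]) \<longleftrightarrow> (\<exists>i\<le>t. X i = b)" for t and X :: "nat \<Rightarrow> int"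
    by (auto simp: image_iff less_Suc_eq_le simp del: upt_Suc)
  have eq: "hit_prob \<omega> b t 0 = measure (quenched \<omega>) {X. \<exists>i\<le>t. X i = b}" for t
    using emeasure_quenched_prefix[of \<omega> "\<lambda>xs. b \<in> set xs" t]
    unfolding hit_prob_def set measure_def by (simp add: measure_def)
  have sets: "{X. \<exists>i\<le>t. X i = b} \<in> sets (quenched \<omega>)" for t
  proof -
    have "{X. \<exists>i\<le>t. X i = b} = {X \<in> space path_space. \<exists>i\<in>{..t}. X i = b}" by (auto simp: space_PiM)
    also have "\<dots> \<in> sets path_space" by measurable
    finally show ?thesis by (simp add: sets_quenched)
  qed
  have "(\<lambda>t. measure (quenched \<omega>) {X. \<exists>i\<le>t. X i = b}) \<longlonglongrightarrow> measure (quenched \<omega>) (\<Union>t. {X. \<exists>i\<le>t. X i = b})"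
    using sets by (intro finite_Lim_measure_incseq) (auto simp: incseq_def intro: order_trans)
  moreover have "(\<Union>t::nat. {X. \<exists>i\<le>t. X i = b}) = {X. \<exists>t. X t = b}" by auto
  ultimately show ?thesis by (simp add: eq)
qed

text \<open>
  The limits of the hitting probabilities are harmonic, because \<open>hit_prob\<close> satisfies the
  first-step recursion.
\<close>

lemma quenched_miss_prob_le:
  fixes b :: nat
  assumes \<omega>: "\<And>y. 0 < \<omega> y" "\<And>y. \<omega> y < 1" and R: "\<And>y. inverse (rho \<omega> y) \<le> R" "1 \<le> R"
  shows "1 - measure (quenched \<omega>) {X. \<exists>t. X t = int b} \<le> real b * R ^ b * (\<Prod>i<k. rho \<omega> (int b - 1 - int i))"
proof -
  let ?u = "\<lambda>t y. hit_prob \<omega> (int b) t y"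
  define h where "h y = lim (\<lambda>t. ?u t y)" for y
  have \<omega>01: "\<And>y. 0 \<le> \<omega> y" "\<And>y. \<omega> y \<le> 1" using \<omega> by (auto simp: less_imp_le)
  have lim: "(\<lambda>t. ?u t y) \<longlonglongrightarrow> h y" for y
  proof -
    have "convergent (\<lambda>t. ?u t y)"
      using incseq_hit_prob[OF \<omega>01] hit_prob_bounds
      by (intro Bseq_mono_convergent BseqI'[of _ 1]) (auto simp: incseq_def)
    then show ?thesis unfolding h_def by (simp add: convergent_LIMSEQ_iff)
  qed
  have "1 - h 0 \<le> real b * R ^ b * (\<Prod>i<k. rho \<omega> (int b - 1 - int i))"
  proof (rule harmonic_left_of_target[where h=h and \<omega>=\<omega>, OF _ _ _ _ \<omega> R])
    show "0 \<le> h y" for y by (rule LIMSEQ_le_const[OF lim]) (auto simp: hit_prob_bounds)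
    show "h y \<le> 1" for y by (rule LIMSEQ_le_const2[OF lim]) (auto simp: hit_prob_bounds)
    show "h (int b) = 1" using lim[of "int b"] by (simp add: hit_prob_target LIMSEQ_const_iff)
    fix y assume y: "y < int b"
    have "(\<lambda>t. \<omega> y * ?u t (y + 1) + (1 - \<omega> y) * ?u t (y - 1)) \<longlonglongrightarrow> \<omega> y * h (y + 1) + (1 - \<omega> y) * h (y - 1)"
      by (intro tendsto_intros lim)
    also have "(\<lambda>t. \<omega> y * ?u t (y + 1) + (1 - \<omega> y) * ?u t (y - 1)) = (\<lambda>t. ?u (Suc t) y)"
      using y by (intro ext hit_prob_Suc[symmetric] \<omega>01) auto
    finally show "h y = \<omega> y * h (y + 1) + (1 - \<omega> y) * h (y - 1)"
      using LIMSEQ_Suc[OF lim[of y]] LIMSEQ_unique by blast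
  qed
  moreover have "h 0 = measure (quenched \<omega>) {X. \<exists>t. X t = int b}"
    using lim[of 0] hit_prob_tendsto LIMSEQ_unique by blast
  ultimately show ?thesis by simp
qed

text \<open>
  Put \<open>r = (1 - a) / a\<close> and \<open>z = r\<^sup>s\<close>. Then \<open>\<E> \<rho>\<^sup>s = p z + (1 - p) / z\<close>, which is below \<open>1\<close>
  for \<open>z\<close> between \<open>1\<close> and \<open>(1 - p) / p\<close> and is minimal at the square root of the latter. The
  condition \<open>a < p\<close> gives \<open>(1 - p) / p < r\<close>, hence \<open>s < 1\<close>. So small powers of products of \<open>\<rho>\<close> decay
  although \<open>\<E> \<rho> \<ge> 1\<close>.
\<close>

lemma rho_moment_less_1:
  assumes p: "0 < p" "p < 1 / 2" and a: "0 < a" "a < p"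
  obtains s \<kappa> where "0 < s" "s < 1" "0 \<le> \<kappa>" "\<kappa> < 1"
    "\<And>J. finite J \<Longrightarrow> (\<integral>\<^sup>+\<omega>. (\<Prod>x\<in>J. ennreal (rho \<omega> x powr s)) \<partial>env_law p a) = ennreal (\<kappa> ^ card J)"
proof -
  define r where "r = (1 - a) / a"
  define z where "z = sqrt ((1 - p) / p)"
  define s where "s = ln z / ln r"
  define \<kappa> where "\<kappa> = p * z + (1 - p) / z"
  have q: "1 < (1 - p) / p" using p by (simp add: field_simps)
  have z1: "1 < z" using q by (simp add: z_def)
  have zz: "z * z = (1 - p) / p" using q p by (simp add: z_def)
  have "z < (1 - p) / p" using z1 zz mult_strict_left_mono[of 1 z z] by simp
  also have "(1 - p) / p < r" using p a by (simp add: r_def field_simps)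
  finally have zr: "z < r" .
  have s: "0 < s" "s < 1" using z1 zr by (simp_all add: s_def)
  have rs: "r powr s = z" using z1 zr by (simp add: s_def powr_def)
  have \<kappa>1: "\<kappa> < 1"
  proof -
    have "\<kappa> = 2 * (p * z)" using zz p z1 by (simp add: \<kappa>_def field_simps)
    moreover have "(p * z) ^ 2 < (1 / 2) ^ 2"
    proof -
      have "(p * z) ^ 2 = p * p * (z * z)" by (simp add: power2_eq_square)
      also have "\<dots> = p * (1 - p)" unfolding zz using p by simp
      also have "\<dots> = 1/4 - (1/2 - p) ^ 2" by (simp add: power2_eq_square algebra_simps)
      also have "\<dots> < 1/4" using p by simp
      finally show ?thesis by (simp add: power2_eq_square)
    qed
    then have "p * z < 1 / 2" by (rule power2_less_imp_less) simp
    ultimately show ?thesis by simp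
  qed
  have \<kappa>0: "0 \<le> \<kappa>" using p z1 by (simp add: \<kappa>_def)
  have "(\<integral>\<^sup>+\<omega>. (\<Prod>x\<in>J. ennreal (rho \<omega> x powr s)) \<partial>env_law p a) = ennreal (\<kappa> ^ card J)" if "finite J" for J
  proof -
    have "(\<integral>\<^sup>+\<omega>. (\<Prod>x\<in>J. ennreal (rho \<omega> x powr s)) \<partial>env_law p a) = (\<Prod>x\<in>J. \<integral>\<^sup>+w. ennreal (((1 - w) / w) powr s) \<partial>temkin p a)"
      unfolding rho_def by (rule nn_integral_env_law_prod[OF that]) measurable
    also have "(\<integral>\<^sup>+w. ennreal (((1 - w) / w) powr s) \<partial>temkin p a) = ennreal \<kappa>"
    proof -
      have "(a / (1 - a)) powr s = inverse (r powr s)"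
        using a p by (simp add: r_def powr_divide)
      then have "(a / (1 - a)) powr s = 1 / z" by (simp add: rs inverse_eq_divide)
      moreover have "((1 - a) / a) powr s = z" using rs by (simp add: r_def)
      moreover have "(\<integral>\<^sup>+w. ennreal (((1 - w) / w) powr s) \<partial>temkin p a) =
          ennreal p * ennreal (((1 - a) / a) powr s) + ennreal (1 - p) * ennreal ((a / (1 - a)) powr s)"
        using p by (subst nn_integral_temkin) auto
      moreover have "ennreal \<kappa> = ennreal p * ennreal z + ennreal (1 - p) * ennreal (1 / z)"
        using p z1 by (simp add: \<kappa>_def ennreal_mult'[symmetric])
      ultimately show ?thesis by simp
    qed
    finally show ?thesis using \<kappa>0 by (simp add: ennreal_power)
  qed
  then show ?thesis using that s \<kappa>0 \<kappa>1 by blast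
qed

lemma le_powr_of_le_1:
  fixes x y s :: real
  assumes "0 \<le> x" "x \<le> y" "x \<le> 1" "0 < s" "s < 1"
  shows "x \<le> y powr s"
proof (cases "x = 0")
  case False
  have "x = x powr 1" using assms by simp
  also have "\<dots> \<le> x powr s" using assms False by (intro powr_mono') auto
  also have "\<dots> \<le> y powr s" using assms by (intro powr_mono2) auto
  finally show ?thesis .
qed simp

text \<open>
  By \<open>quenched_miss_prob_le\<close> and \<open>x \<le> x\<^sup>s\<close> on the unit interval, the probability of never
  hitting \<open>b\<close> is at most a constant times the moment of order \<open>s\<close> of a product of \<open>k\<close> factors
  \<open>\<rho>\<close>, for every \<open>k\<close>.
\<close>

lemma AE_annealed_hits:
  fixes b :: nat
  assumes p: "0 < p" "p < 1 / 2" and a: "0 < a" "a < p"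
  shows "AE X in annealed p a. \<exists>t. X t = int b"
proof -
  let ?R = "\<lambda>\<omega> k. \<Prod>i<k. rho \<omega> (int b - 1 - int i)"
  obtain s \<kappa> where s: "0 < s" "s < 1" and \<kappa>: "0 \<le> \<kappa>" "\<kappa> < 1"
    and mom: "\<And>J. finite J \<Longrightarrow> (\<integral>\<^sup>+\<omega>. (\<Prod>x\<in>J. ennreal (rho \<omega> x powr s)) \<partial>env_law p a) = ennreal (\<kappa> ^ card J)"
    using rho_moment_less_1[OF p a] by blast
  define R where "R = (1 - a) / a"
  define c where "c = (real b * R ^ b) powr s"
  let ?N = "{X. \<not> (\<exists>t. X t = int b)}"
  have N: "?N = UNIV - {X. \<exists>t. X t = int b}" by auto
  also have "UNIV = space path_space" by (simp add: space_PiM)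
  finally have sets: "?N \<in> sets path_space"
    by (simp only: sets.compl_sets[OF sets_hits_event])
  have bound: "emeasure (annealed p a) ?N \<le> ennreal (c * \<kappa> ^ k)" for k
  proof -
    let ?J = "(\<lambda>i. int b - 1 - int i) ` {..<k}"
    have inj: "inj_on (\<lambda>i. int b - 1 - int i) {..<k}" by (auto simp: inj_on_def)
    have "emeasure (annealed p a) ?N = (\<integral>\<^sup>+\<omega>. emeasure (quenched \<omega>) ?N \<partial>env_law p a)"
      by (rule emeasure_annealed[OF sets])
    also have "\<dots> \<le> (\<integral>\<^sup>+\<omega>. ennreal c * (\<Prod>x\<in>?J. ennreal (rho \<omega> x powr s)) \<partial>env_law p a)"
    proof (rule nn_integral_mono_AE, rule eventually_mono[OF AE_env_law])
      fix \<omega> :: "int \<Rightarrow> real" assume \<omega>: "\<forall>x. \<omega> x = a \<or> \<omega> x = 1 - a"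
      interpret Q: prob_space "quenched \<omega>" by (rule prob_space_quenched)
      have pos: "0 < \<omega> y" "\<omega> y < 1" for y using spec[OF \<omega>, of y] a p by auto
      have R1: "1 \<le> R" using a p by (simp add: R_def field_simps)
      have invR: "inverse (rho \<omega> y) \<le> R" for y
      proof -
        have "a / (1 - a) \<le> R" using a p by (simp add: R_def field_simps power2_eq_square)
        then show ?thesis using spec[OF \<omega>, of y] a p by (auto simp: rho_def R_def)
      qed
      have \<rho>: "rho \<omega> y > 0" for y using pos[of y] by (simp add: rho_def)
      have "Q.prob ?N = 1 - Q.prob {X. \<exists>t. X t = int b}"
        unfolding N using Q.prob_compl[of "{X. \<exists>t. X t = int b}"] sets_hits_event[of "int b"]
        by (simp add: sets_quenched space_quenched)
      also have "\<dots> \<le> real b * R ^ b * ?R \<omega> k"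
        by (rule quenched_miss_prob_le[OF pos invR R1])
      finally have "Q.prob ?N \<le> (real b * R ^ b * ?R \<omega> k) powr s"
        using s by (intro le_powr_of_le_1) auto
      also have "\<dots> = c * ?R \<omega> k powr s"
        unfolding c_def by (rule powr_mult)
      also have "?R \<omega> k powr s = (\<Prod>i<k. rho \<omega> (int b - 1 - int i) powr s)"
        by (rule prod_powr_distrib)
      also have "\<dots> = (\<Prod>x\<in>?J. rho \<omega> x powr s)" by (simp add: prod.reindex[OF inj] o_def)
      finally show "emeasure (quenched \<omega>) ?N \<le> ennreal c * (\<Prod>x\<in>?J. ennreal (rho \<omega> x powr s))"
        unfolding Q.emeasure_eq_measure by (subst prod_ennreal) (auto simp: ennreal_mult'[symmetric] c_def intro!: ennreal_leI)
    qed
    also have "\<dots> = ennreal c * (\<integral>\<^sup>+\<omega>. (\<Prod>x\<in>?J. ennreal (rho \<omega> x powr s)) \<partial>env_law p a)"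
      unfolding rho_def by (intro nn_integral_cmult) measurable
    also have "\<dots> = ennreal (c * \<kappa> ^ k)"
      using \<kappa> by (simp add: mom card_image[OF inj] ennreal_mult' c_def)
    finally show ?thesis .
  qed
  have "(\<lambda>k. ennreal (c * \<kappa> ^ k)) \<longlonglongrightarrow> ennreal (c * 0)"
    using \<kappa> by (intro tendsto_ennrealI tendsto_mult tendsto_const LIMSEQ_realpow_zero) auto
  then have "emeasure (annealed p a) ?N \<le> ennreal (c * 0)"
    using bound by (intro LIMSEQ_le_const) auto
  then have "emeasure (annealed p a) ?N = 0" by simp
  then have "?N \<in> null_sets (annealed p a)" using sets by (simp add: null_sets_def sets_annealed)
  then show ?thesis by (rule AE_I') (auto simp: space_annealed)
qed

section \<open>Paths with a prescribed profile of left steps\<close>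

definition down_steps :: "(nat \<Rightarrow> int) \<Rightarrow> nat \<Rightarrow> nat \<Rightarrow> nat" where
  "down_steps X s x = (\<Sum>r<s. of_bool (X r = int x \<and> X (Suc r) = int x - 1))"

lemma down_steps_Suc_shift:
  "down_steps X (Suc s) x = of_bool (X 0 = int x \<and> X 1 = int x - 1) + down_steps (\<lambda>r. X (Suc r)) s x"
  unfolding down_steps_def by (subst sum.lessThan_Suc_shift) simp

definition has_profile :: "nat \<Rightarrow> (nat \<Rightarrow> nat) \<Rightarrow> int list \<Rightarrow> bool" where
  "has_profile n l xs \<longleftrightarrow> (\<exists>s<length xs. xs ! s = int n \<and> (\<forall>r<s. xs ! r \<noteq> int n) \<and> (\<forall>x<n. down_steps ((!) xs) s x = l x))"

text \<open>
  The probability that \<open>v\<close> failures precede the success number \<open>u + 1\<close>.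
\<close>

definition right_weight :: "real \<Rightarrow> nat \<Rightarrow> nat \<Rightarrow> real" where
  "right_weight w u v = real ((u + v) choose v) * w ^ (u + 1) * (1 - w) ^ v"

text \<open>
  For a site to the left of the starting point, the right steps from \<open>x\<close> are matched by the \<open>u\<close>
  left steps from \<open>x + 1\<close>, and if there are any, the last step from \<open>x\<close> goes to the right; so
  \<open>v\<close> failures have to precede the success number \<open>u\<close>. Truncated subtraction makes the binomial
  coefficient \<open>1\<close> for \<open>u = v = 0\<close> and \<open>0\<close> for \<open>u = 0 < v\<close>, as it should be.
\<close>

definition left_weight :: "real \<Rightarrow> nat \<Rightarrow> nat \<Rightarrow> real" where
  "left_weight w u v = real ((u + v - 1) choose v) * w ^ u * (1 - w) ^ v"

text \<open>
  Counting independently at each site the possible orders of its exits, this is the total weight of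
  the paths from \<open>y\<close> to \<open>n\<close> with profile \<open>l\<close>, where the return to \<open>0\<close> from any site to the left of it
  is treated as certain; so for \<open>y < 0\<close> the value is the same as for \<open>y = 0\<close>.
\<close>

definition profile_weight :: "(int \<Rightarrow> real) \<Rightarrow> nat \<Rightarrow> (nat \<Rightarrow> nat) \<Rightarrow> int \<Rightarrow> real" where
  "profile_weight \<omega> n l y = (\<Prod>x<n. if int x < y then left_weight (\<omega> (int x)) (l (Suc x)) (l x)
     else right_weight (\<omega> (int x)) (l (Suc x)) (l x))"

lemma left_weight_Suc: "left_weight w (Suc u) v = right_weight w u v"
  by (simp add: left_weight_def right_weight_def)

lemma right_weight_0: "right_weight w u 0 = w * left_weight w u 0"
  by (simp add: left_weight_def right_weight_def)

lemma right_weight_Suc: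
  "right_weight w u (Suc v) = w * left_weight w u (Suc v) + (1 - w) * right_weight w u v"
  by (simp add: left_weight_def right_weight_def algebra_simps)

lemma profile_weight_nonneg:
  assumes "\<And>y. 0 \<le> \<omega> y" "\<And>y. \<omega> y \<le> 1"
  shows "0 \<le> profile_weight \<omega> n l y"
  unfolding profile_weight_def left_weight_def right_weight_def using assms by (intro prod_nonneg) auto

lemma profile_weight_neg: "y \<le> 0 \<Longrightarrow> profile_weight \<omega> n l y = profile_weight \<omega> n l 0"
  unfolding profile_weight_def by (intro prod.cong) auto

text \<open>
  The first-step equation. Only the factor at the starting site \<open>k\<close> depends on the direction of the
  step, and there it is the Pascal rule. At the site \<open>k - 1\<close> the change of the profile and the change
  from left to right weight cancel.
\<close>

lemma profile_weight_step:
  assumes k: "k < n"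
  shows "profile_weight \<omega> n l (int k) = \<omega> (int k) * profile_weight \<omega> n l (int k + 1)
     + (1 - \<omega> (int k)) * (if l k = 0 then 0 else profile_weight \<omega> n (l(k := l k - 1)) (int k - 1))"
proof -
  define P where "P = (\<Prod>x\<in>{..<n} - {k}. if int x < int k then left_weight (\<omega> (int x)) (l (Suc x)) (l x)
     else right_weight (\<omega> (int x)) (l (Suc x)) (l x))"
  have 1: "profile_weight \<omega> n l (int k) = right_weight (\<omega> (int k)) (l (Suc k)) (l k) * P"
    unfolding profile_weight_def P_def using k by (subst prod.remove[of _ k]) auto
  have 2: "profile_weight \<omega> n l (int k + 1) = left_weight (\<omega> (int k)) (l (Suc k)) (l k) * P"
    unfolding profile_weight_def P_def using k
    by (subst prod.remove[of _ k]) (auto intro!: arg_cong2[where f="(*)"] prod.cong split: if_splits)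
  have 3: "profile_weight \<omega> n (l(k := v)) (int k - 1) = right_weight (\<omega> (int k)) (l (Suc k)) v * P"
    if v: "l k = Suc v" for v
  proof -
    have "(if int x < int k - 1 then left_weight (\<omega> (int x)) ((l(k := v)) (Suc x)) ((l(k := v)) x)
        else right_weight (\<omega> (int x)) ((l(k := v)) (Suc x)) ((l(k := v)) x)) =
      (if int x < int k then left_weight (\<omega> (int x)) (l (Suc x)) (l x) else right_weight (\<omega> (int x)) (l (Suc x)) (l x))"
      if "x \<noteq> k" for x
      using that v by (cases "Suc x = k") (auto simp: left_weight_Suc)
    then show ?thesis
      unfolding profile_weight_def P_def using k
      by (subst prod.remove[of _ k]) (auto intro!: arg_cong2[where f="(*)"] prod.cong)
  qed
  show ?thesis
  proof (cases "l k")
    case 0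
    then show ?thesis using 1 2 by (simp add: right_weight_0)
  next
    case (Suc v)
    then show ?thesis using 1 2 3[OF Suc] by (simp add: right_weight_Suc algebra_simps)
  qed
qed

lemma has_profile_Cons:
  assumes "has_profile n l (y # xs)" "y \<noteq> int n"
  shows "has_profile n (\<lambda>x. l x - of_bool (y = int x \<and> xs ! 0 = int x - 1)) xs"
    and "\<And>x. x < n \<Longrightarrow> y = int x \<Longrightarrow> xs ! 0 = int x - 1 \<Longrightarrow> l x \<noteq> 0"
proof -
  obtain s where s: "s < length (y # xs)" "(y # xs) ! s = int n" "\<forall>r<s. (y # xs) ! r \<noteq> int n"
    and l: "\<And>x. x < n \<Longrightarrow> down_steps ((!) (y # xs)) s x = l x"
    using assms unfolding has_profile_def by blast
  obtain s' where s': "s = Suc s'" using s(2) assms(2) by (cases s) auto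
  have ds: "down_steps ((!) (y # xs)) s x = of_bool (y = int x \<and> xs ! 0 = int x - 1) + down_steps ((!) xs) s' x" for x
    unfolding s' down_steps_Suc_shift by simp
  have lt: "s' < length xs" "xs ! s' = int n" "\<forall>r<s'. xs ! r \<noteq> int n"
    using s unfolding s' by auto
  show "has_profile n (\<lambda>x. l x - of_bool (y = int x \<and> xs ! 0 = int x - 1)) xs"
    unfolding has_profile_def
  proof (intro exI[of _ s'] conjI allI impI lt)
    fix x assume "x < n"
    then show "down_steps ((!) xs) s' x = l x - of_bool (y = int x \<and> xs ! 0 = int x - 1)"
      using l[of x] ds[of x] by simp
  qed (use lt in auto)
  show "l x \<noteq> 0" if "x < n" "y = int x" "xs ! 0 = int x - 1" for x
    using l[of x] ds[of x] that by simp
qed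

lemma nth_0_walk_pmf: "xs \<in> set_pmf (walk_pmf \<omega> t y) \<Longrightarrow> xs ! 0 = y"
  by (cases t) auto

lemma emeasure_walk_profile_at_target_le:
  assumes "l n = 0"
  shows "emeasure (walk_pmf \<omega> t (int n)) {xs. has_profile n l xs} \<le> ennreal (profile_weight \<omega> n l (int n))"
proof (cases "\<forall>x<n. l x = 0")
  case True
  have "profile_weight \<omega> n l (int n) = (\<Prod>x<n. 1)"
    unfolding profile_weight_def
  proof (intro prod.cong refl)
    fix x assume "x \<in> {..<n}"
    then have "x < n" "l x = 0" "l (Suc x) = 0" using True assms by (auto, cases "Suc x = n") auto
    then show "(if int x < int n then left_weight (\<omega> (int x)) (l (Suc x)) (l x) else right_weight (\<omega> (int x)) (l (Suc x)) (l x)) = 1"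
      by (simp add: left_weight_def)
  qed
  then show ?thesis by (simp add: measure_pmf.emeasure_le_1)
next
  case False
  have "\<not> has_profile n l xs" if "xs ! 0 = int n" for xs
  proof
    assume "has_profile n l xs"
    then obtain s where "\<forall>r<s. xs ! r \<noteq> int n" "\<And>x. x < n \<Longrightarrow> down_steps ((!) xs) s x = l x"
      unfolding has_profile_def by blast
    moreover from this have "s = 0" using that by (cases s) auto
    ultimately show False using False by (auto simp: down_steps_def)
  qed
  then have "emeasure (walk_pmf \<omega> t (int n)) {xs. has_profile n l xs} = emeasure (walk_pmf \<omega> t (int n)) {}"
    using nth_0_walk_pmf[of _ \<omega> t "int n"] by (intro emeasure_eq_AE) (auto simp: AE_measure_pmf_iff)
  then show ?thesis by simp
qed

lemma emeasure_walk_pmf_mono: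
  assumes "\<And>xs. xs \<in> set_pmf (walk_pmf \<omega> t y) \<Longrightarrow> xs ! 0 = y \<Longrightarrow> xs \<in> A \<Longrightarrow> xs \<in> B"
  shows "emeasure (walk_pmf \<omega> t y) A \<le> emeasure (walk_pmf \<omega> t y) B"
  using assms nth_0_walk_pmf[of _ \<omega> t y] by (intro emeasure_mono_AE AE_pmfI) auto

text \<open>
  The weight satisfies the recursion of the probability on the left, which starts below it at time
  \<open>0\<close>. To the left of \<open>0\<close> the weight is constant, hence trivially harmonic.
\<close>

lemma emeasure_walk_profile_le:
  assumes \<omega>: "\<And>y. 0 \<le> \<omega> y" "\<And>y. \<omega> y \<le> 1" and "y \<le> int n" "l n = 0"
  shows "emeasure (walk_pmf \<omega> t y) {xs. has_profile n l xs} \<le> ennreal (profile_weight \<omega> n l y)"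
  using assms(3,4)
proof (induction t arbitrary: y l)
  case (0 y l)
  show ?case
  proof (cases "y = int n")
    case True
    then show ?thesis using emeasure_walk_profile_at_target_le 0 by blast
  next
    case False
    then have "\<not> has_profile n l [y]" by (auto simp: has_profile_def)
    then show ?thesis by simp
  qed
next
  case (Suc t y l)
  show ?case
  proof (cases "y = int n")
    case True
    then show ?thesis using emeasure_walk_profile_at_target_le Suc.prems by blast
  next
    case False
    then have y: "y < int n" using Suc.prems by simp
    let ?A = "{xs. y # xs \<in> {xs. has_profile n l xs}}"
    let ?P = "\<lambda>l. {xs. has_profile n l xs}"
    have stay: "xs \<in> ?P l" if "xs \<in> ?A" "\<And>x. \<not> (y = int x \<and> xs ! 0 = int x - 1)" for xs
      using has_profile_Cons(1)[of n l y xs] that False by simp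
    have up: "emeasure (walk_pmf \<omega> t (y + 1)) ?A \<le> ennreal (profile_weight \<omega> n l (y + 1))"
      using y Suc.prems by (intro order_trans[OF emeasure_walk_pmf_mono Suc.IH] stay) auto
    \<comment> \<open>The weight after a step to the left; from a site without left steps in the profile there is none.\<close>
    define D where "D = (if y < 0 then profile_weight \<omega> n l 0 else if l (nat y) = 0 then 0
       else profile_weight \<omega> n (l(nat y := l (nat y) - 1)) (y - 1))"
    have down: "emeasure (walk_pmf \<omega> t (y - 1)) ?A \<le> ennreal D"
    proof (cases "y < 0")
      case True
      have "emeasure (walk_pmf \<omega> t (y - 1)) ?A \<le> ennreal (profile_weight \<omega> n l (y - 1))"
        using y Suc.prems True by (intro order_trans[OF emeasure_walk_pmf_mono Suc.IH] stay) auto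
      then show ?thesis using True by (simp add: D_def profile_weight_neg[of "y - 1"])
    next
      case nonneg: False
      define k where "k = nat y"
      have k: "y = int k" "k < n" using nonneg y by (auto simp: k_def)
      show ?thesis
      proof (cases "l k = 0")
        case True
        have "emeasure (walk_pmf \<omega> t (y - 1)) ?A \<le> emeasure (walk_pmf \<omega> t (y - 1)) {}"
        proof (rule emeasure_walk_pmf_mono)
          fix xs assume "xs ! 0 = y - 1" "xs \<in> ?A"
          then show "xs \<in> {}" using has_profile_Cons(2)[of n l y xs k] True False k by auto
        qed
        then show ?thesis by simp
      next
        case lk: False
        have "emeasure (walk_pmf \<omega> t (y - 1)) ?A \<le> emeasure (walk_pmf \<omega> t (y - 1)) (?P (l(k := l k - 1)))"
        proof (rule emeasure_walk_pmf_mono)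
          fix xs assume xs: "xs ! 0 = y - 1" "xs \<in> ?A"
          then have "(\<lambda>x. l x - of_bool (y = int x \<and> xs ! 0 = int x - 1)) = l(k := l k - 1)"
            using k by (auto simp: fun_eq_iff)
          then show "xs \<in> ?P (l(k := l k - 1))" using has_profile_Cons(1)[of n l y xs] xs(2) False by simp
        qed
        also have "\<dots> \<le> ennreal (profile_weight \<omega> n (l(k := l k - 1)) (y - 1))"
          using y Suc.prems k by (intro Suc.IH) auto
        also have "\<dots> = ennreal D" using nonneg lk by (simp add: D_def k_def)
        finally show ?thesis .
      qed
    qed
    have D0: "0 \<le> D" using profile_weight_nonneg[OF \<omega>] by (simp add: D_def)
    have "emeasure (walk_pmf \<omega> (Suc t) y) (?P l) \<le>
       ennreal (\<omega> y) * ennreal (profile_weight \<omega> n l (y + 1)) + ennreal (1 - \<omega> y) * ennreal D"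
      unfolding emeasure_walk_pmf_Suc[of \<omega> y t, OF \<omega>] by (intro add_mono mult_left_mono up down) auto
    also have "\<dots> = ennreal (\<omega> y * profile_weight \<omega> n l (y + 1) + (1 - \<omega> y) * D)"
      using \<omega>[of y] D0 profile_weight_nonneg[OF \<omega>] by (simp add: ennreal_mult' ennreal_plus)
    also have "\<omega> y * profile_weight \<omega> n l (y + 1) + (1 - \<omega> y) * D = profile_weight \<omega> n l y"
    proof (cases "y < 0")
      case True
      then show ?thesis
        using profile_weight_neg[of "y + 1" \<omega> n l] profile_weight_neg[of y \<omega> n l] by (simp add: D_def algebra_simps)
    next
      case False
      then show ?thesis using profile_weight_step[of "nat y" n \<omega> l] y by (simp add: D_def)
    qed
    finally show ?thesis .
  qed
qed

lemma hit_time_eq_Least: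
  assumes "\<exists>t. X t = int n"
  shows "hit_time n X = enat (LEAST t. X t = int n)"
  unfolding hit_time_def
proof (rule antisym)
  show "(INF t\<in>{t. X t = int n}. enat t) \<le> enat (LEAST t. X t = int n)"
    using LeastI_ex[OF assms] by (intro INF_lower) auto
  show "enat (LEAST t. X t = int n) \<le> (INF t\<in>{t. X t = int n}. enat t)"
    by (intro INF_greatest) (auto intro: Least_le)
qed

lemma left_steps_eq_down_steps:
  assumes "X s = int n" "\<And>r. r < s \<Longrightarrow> X r \<noteq> int n"
  shows "left_steps x n X = down_steps X s x"
proof -
  have "(LEAST t. X t = int n) = s"
    using assms by (intro Least_equality) (auto simp: not_less[symmetric])
  then have "hit_time n X = enat s" using hit_time_eq_Least[of X n] assms by auto
  then show ?thesis unfolding left_steps_def down_steps_def by (intro sum.cong) auto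
qed

lemma left_steps_never_hit: "(\<And>t. X t \<noteq> int n) \<Longrightarrow> left_steps x n X = 0"
proof -
  assume "\<And>t. X t \<noteq> int n"
  then have "hit_time n X = \<infinity>" by (simp add: hit_time_def top_enat_def)
  then show ?thesis by (simp add: left_steps_def)
qed

lemma left_steps_target: "left_steps n n X = 0"
proof -
  have "{t. enat t < hit_time n X} \<subseteq> {t. X t \<noteq> int n}"
  proof safe
    fix t assume "enat t < hit_time n X" "X t = int n"
    moreover have "hit_time n X \<le> enat t" unfolding hit_time_def using \<open>X t = int n\<close> by (intro INF_lower) auto
    ultimately show False by simp
  qed
  then show ?thesis unfolding left_steps_def by (intro sum.neutral) auto
qed

lemma sets_prefix_event: "{X. P (map X [0..<Suc t])} \<in> sets path_space"
proof -
  have "(\<lambda>X. map X [0..<Suc t]) -` {xs. P xs} \<inter> space path_space \<in> sets path_space"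
    by (rule measurable_sets[OF measurable_path_prefix]) auto
  then show ?thesis by (simp add: vimage_def space_PiM del: upt_Suc)
qed

lemma first_hit_exists:
  fixes X :: "nat \<Rightarrow> int"
  assumes "\<exists>t. X t = y"
  obtains s where "X s = y" "\<And>r. r < s \<Longrightarrow> X r \<noteq> y"
  using LeastI_ex[OF assms] not_less_Least[of _ "\<lambda>t. X t = y"] by blast

lemma nth_prefix: "r \<le> t \<Longrightarrow> map X [0..<Suc t] ! r = X r"
  by (simp del: upt_Suc)

lemma down_steps_prefix: "s \<le> t \<Longrightarrow> down_steps ((!) (map X [0..<Suc t])) s x = down_steps X s x"
  unfolding down_steps_def by (intro sum.cong refl) (simp add: nth_prefix del: upt_Suc)

lemma measurable_left_steps: "left_steps x n \<in> measurable path_space (count_space UNIV)"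
proof (subst measurable_count_space_eq2_countable, intro conjI ballI)
  fix k :: nat
  let ?P = "\<lambda>T xs. xs ! T = int n \<and> (\<forall>r<T. xs ! r \<noteq> int n) \<and> down_steps ((!) xs) T x = k"
  have *: "left_steps x n X = k \<longleftrightarrow> (\<exists>T. ?P T (map X [0..<Suc T])) \<or> (k = 0 \<and> (\<forall>t. X t \<noteq> int n))" for X
  proof (cases "\<exists>t. X t = int n")
    case True
    then obtain s where s: "X s = int n" "\<And>r. r < s \<Longrightarrow> X r \<noteq> int n" using first_hit_exists by blast
    have "?P T (map X [0..<Suc T]) \<longleftrightarrow> T = s \<and> left_steps x n X = k" for T
    proof -
      have "?P T (map X [0..<Suc T]) \<longleftrightarrow> X T = int n \<and> (\<forall>r<T. X r \<noteq> int n) \<and> down_steps X T x = k"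
        by (simp add: nth_prefix down_steps_prefix del: upt_Suc)
      also have "\<dots> \<longleftrightarrow> T = s \<and> left_steps x n X = k"
        using s left_steps_eq_down_steps[of X s n x] by (metis linorder_neqE_nat)
      finally show ?thesis .
    qed
    then show ?thesis using True by (auto simp del: upt_Suc)
  next
    case False
    then show ?thesis using left_steps_never_hit[of X n x] by (auto simp: nth_prefix simp del: upt_Suc)
  qed
  have "left_steps x n -` {k} \<inter> space path_space = {X. left_steps x n X = k}" by (auto simp: space_PiM)
  also have "\<dots> =
    (\<Union>T. {X. ?P T (map X [0..<Suc T])}) \<union> (if k = 0 then space path_space - {X. \<exists>t. X t = int n} else {})"
    unfolding * by (auto simp: space_PiM simp del: upt_Suc)
  also have "\<dots> \<in> sets path_space"
  proof (rule sets.Un)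
    show "(\<Union>T. {X. ?P T (map X [0..<Suc T])}) \<in> sets path_space"
      by (intro sets.countable_UN image_subsetI sets_prefix_event)
    show "(if k = 0 then space path_space - {X. \<exists>t. X t = int n} else {}) \<in> sets path_space"
      using sets.compl_sets[OF sets_hits_event[of "int n"]] by simp
  qed
  finally show "left_steps x n -` {k} \<inter> space path_space \<in> sets path_space" .
qed auto

text \<open>
  The bound of \<open>emeasure_walk_profile_le\<close> is uniform in the number of steps, and the events increase
  to the event that the walk hits \<open>n\<close> with the given profile.
\<close>

lemma emeasure_quenched_profile_le:
  assumes \<omega>: "\<And>y. 0 \<le> \<omega> y" "\<And>y. \<omega> y \<le> 1" and l: "l n = 0"
  shows "emeasure (quenched \<omega>) {X. (\<exists>t. X t = int n) \<and> (\<forall>x<n. left_steps x n X = l x)}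
    \<le> ennreal (\<Prod>x<n. right_weight (\<omega> (int x)) (l (Suc x)) (l x))"
proof -
  let ?L = "\<lambda>X. \<forall>x<n. left_steps x n X = l x"
  let ?A = "\<lambda>t. {X. has_profile n l (map X [0..<Suc t])}"
  have iff: "has_profile n l (map X [0..<Suc t]) \<longleftrightarrow>
    (\<exists>s\<le>t. X s = int n \<and> (\<forall>r<s. X r \<noteq> int n) \<and> ?L X)" for X t
  proof -
    have "has_profile n l (map X [0..<Suc t]) \<longleftrightarrow>
      (\<exists>s\<le>t. X s = int n \<and> (\<forall>r<s. X r \<noteq> int n) \<and> (\<forall>x<n. down_steps X s x = l x))"
      unfolding has_profile_def
      by (intro ex_cong1) (auto simp: nth_prefix down_steps_prefix less_Suc_eq_le simp del: upt_Suc)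
    also have "\<dots> \<longleftrightarrow> (\<exists>s\<le>t. X s = int n \<and> (\<forall>r<s. X r \<noteq> int n) \<and> ?L X)"
      using left_steps_eq_down_steps[of X _ n] by (intro ex_cong1) auto
    finally show ?thesis .
  qed
  have "{X. (\<exists>t. X t = int n) \<and> ?L X} = (\<Union>t. ?A t)"
    unfolding iff using first_hit_exists[of _ "int n"] by (auto; metis order_refl)
  also have "emeasure (quenched \<omega>) \<dots> = (SUP t. emeasure (quenched \<omega>) (?A t))"
    unfolding iff
  proof (rule SUP_emeasure_incseq[symmetric])
    show "range (\<lambda>t. {X. \<exists>s\<le>t. X s = int n \<and> (\<forall>r<s. X r \<noteq> int n) \<and> ?L X}) \<subseteq> sets (quenched \<omega>)"
      using sets_prefix_event[of "has_profile n l"] unfolding iff by (auto simp: sets_quenched)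
    show "incseq (\<lambda>t. {X. \<exists>s\<le>t. X s = int n \<and> (\<forall>r<s. X r \<noteq> int n) \<and> ?L X})"
      by (auto simp: incseq_def intro: order_trans)
  qed
  also have "\<dots> \<le> ennreal (profile_weight \<omega> n l 0)"
    using emeasure_walk_profile_le[of \<omega> 0 n l, OF \<omega>, simplified, OF l]
    by (intro SUP_least) (simp only: emeasure_quenched_prefix)
  also have "profile_weight \<omega> n l 0 = (\<Prod>x<n. right_weight (\<omega> (int x)) (l (Suc x)) (l x))"
    unfolding profile_weight_def by (intro prod.cong) auto
  finally show ?thesis .
qed

section \<open>Domination by the branching chain\<close>

text \<open>
  The kernel \<open>Q\<close> of the branching process as a probability mass function.
\<close>

definition visit_pmf :: "real \<Rightarrow> real \<Rightarrow> nat \<Rightarrow> nat pmf" where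
  "visit_pmf p a u = bind_pmf (bernoulli_pmf p) (\<lambda>b. neg_binomial_pmf (Suc u) (if b then a else 1 - a))"

text \<open>
  The chain runs through the sites from right to left: started from \<open>L\<^sub>n = u\<close>, it yields the list
  of \<open>L\<^bsub>n-1\<^esub>\<close>, \<open>\<dots>\<close>, \<open>L\<^sub>0\<close>.
\<close>

primrec chain_pmf :: "real \<Rightarrow> real \<Rightarrow> nat \<Rightarrow> nat \<Rightarrow> nat list pmf" where
  "chain_pmf p a 0 u = return_pmf []"
| "chain_pmf p a (Suc n) u = bind_pmf (visit_pmf p a u) (\<lambda>v. map_pmf ((#) v) (chain_pmf p a n v))"

lemma Q_kernel_eq:
  assumes "0 < p" "p < 1" "0 < a" "a < 1"
  shows "Q_kernel p a u v = p * right_weight a u v + (1 - p) * right_weight (1 - a) u v"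
proof -
  have "0 < p * a ^ (u + 1) * (1 - a) ^ v + (1 - p) * (1 - a) ^ (u + 1) * a ^ v"
    using assms by (intro add_pos_pos mult_pos_pos) auto
  then show ?thesis using assms by (simp add: Q_kernel_def phi_eq right_weight_def algebra_simps)
qed

lemma pmf_neg_binomial_Suc:
  "0 < w \<Longrightarrow> w < 1 \<Longrightarrow> pmf (neg_binomial_pmf (Suc u) w) v = right_weight w u v"
  by (simp add: pmf_neg_binomial right_weight_def add.commute)

lemma pmf_visit_pmf:
  assumes "0 < p" "p < 1" "0 < a" "a < 1"
  shows "pmf (visit_pmf p a u) v = Q_kernel p a u v"
  using assms by (simp add: visit_pmf_def pmf_bind Q_kernel_eq pmf_neg_binomial_Suc mult.commute)

lemma nn_integral_visit_pmf:
  assumes "0 \<le> p" "p \<le> 1"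
  shows "(\<integral>\<^sup>+v. f v \<partial>visit_pmf p a u) =
    ennreal p * (\<integral>\<^sup>+v. f v \<partial>neg_binomial_pmf (Suc u) a) + ennreal (1 - p) * (\<integral>\<^sup>+v. f v \<partial>neg_binomial_pmf (Suc u) (1 - a))"
  using assms by (simp add: visit_pmf_def mult.commute)

lemma right_weight_nonneg: "0 \<le> w \<Longrightarrow> w \<le> 1 \<Longrightarrow> 0 \<le> right_weight w u v"
  by (simp add: right_weight_def)

lemma nn_integral_right_weight:
  assumes "0 < p" "p < 1" "0 < a" "a < 1"
  shows "(\<integral>\<^sup>+w. ennreal (right_weight w u v) \<partial>temkin p a) = ennreal (Q_kernel p a u v)"
proof -
  have m: "(\<lambda>w. ennreal (right_weight w u v)) \<in> borel_measurable borel" unfolding right_weight_def by measurable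
  have "(\<integral>\<^sup>+w. ennreal (right_weight w u v) \<partial>temkin p a) = ennreal p * ennreal (right_weight a u v) + ennreal (1 - p) * ennreal (right_weight (1 - a) u v)"
    using assms by (subst nn_integral_temkin[OF _ _ m]) auto
  also have "\<dots> = ennreal (Q_kernel p a u v)"
    using assms by (simp add: Q_kernel_eq ennreal_mult' ennreal_plus right_weight_nonneg)
  finally show ?thesis .
qed

lemma pmf_map_Cons: "pmf (map_pmf ((#) v) M) (w # ls) = (if v = w then pmf M ls else 0)"
proof (cases "v = w")
  case True
  then show ?thesis using pmf_map_inj'[of "(#) v" M ls] by simp
next
  case False
  then show ?thesis by (auto simp: pmf_eq_0_set_pmf)
qed

lemma pmf_chain_pmf_Cons: "pmf (chain_pmf p a (Suc n) u) (v # ls) = pmf (visit_pmf p a u) v * pmf (chain_pmf p a n v) ls"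
proof -
  have "pmf (chain_pmf p a (Suc n) u) (v # ls) = (\<integral>w. pmf (chain_pmf p a n v) ls * indicator {v} w \<partial>visit_pmf p a u)"
    unfolding chain_pmf.simps pmf_bind pmf_map_Cons
    by (intro Bochner_Integration.integral_cong) (auto simp: indicator_def)
  then show ?thesis by (simp add: measure_pmf_single)
qed

lemma pmf_chain_pmf:
  "pmf (chain_pmf p a n (l n)) (map l (rev [0..<n])) = (\<Prod>x<n. pmf (visit_pmf p a (l (Suc x))) (l x))"
  by (induction n) (simp_all add: pmf_chain_pmf_Cons del: chain_pmf.simps(2))

lemma sets_left_steps_profile: "{X. \<forall>x<n. left_steps x n X = l x} \<in> sets path_space"
proof -
  have "{X \<in> space path_space. left_steps x n X = k} \<in> sets path_space" for x k
  proof -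
    have "left_steps x n -` {k} \<inter> space path_space \<in> sets path_space"
      by (rule measurable_sets[OF measurable_left_steps]) auto
    then show ?thesis by (simp add: vimage_def Int_def conj_commute)
  qed
  then have "{X \<in> space path_space. \<forall>x\<in>{..<n}. left_steps x n X = l x} \<in> sets path_space"
    by (intro sets.sets_Collect_finite_All) auto
  then show ?thesis by (simp add: space_PiM Ball_def)
qed

lemma sets_hit_profile:
  "{X. (\<exists>t. X t = int n) \<and> (\<forall>x<n. left_steps x n X = l x)} \<in> sets path_space"
  using sets.Int[OF sets_hits_event[of "int n"] sets_left_steps_profile[of n l]] by (simp add: Int_def)

text \<open>
  Each factor of the quenched bound involves the environment at one site only, so the expectation
  factorises into values of \<open>Q\<close>.
\<close>

lemma emeasure_annealed_profile_le:
  assumes p: "0 < p" "p < 1" and a: "0 < a" "a < 1" and l: "l n = 0"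
  shows "emeasure (annealed p a) {X. (\<exists>t. X t = int n) \<and> (\<forall>x<n. left_steps x n X = l x)}
    \<le> ennreal (pmf (chain_pmf p a n 0) (map l (rev [0..<n])))"
proof -
  let ?w = "\<lambda>\<omega> y. ennreal (right_weight (\<omega> y) (l (Suc (nat y))) (l (nat y)))"
  let ?A = "{X. (\<exists>t. X t = int n) \<and> (\<forall>x<n. left_steps x n X = l x)}"
  have "emeasure (annealed p a) ?A = (\<integral>\<^sup>+\<omega>. emeasure (quenched \<omega>) ?A \<partial>env_law p a)"
    by (rule emeasure_annealed[OF sets_hit_profile])
  also have "\<dots> \<le> (\<integral>\<^sup>+\<omega>. (\<Prod>y\<in>int ` {..<n}. ?w \<omega> y) \<partial>env_law p a)"
  proof (rule nn_integral_mono_AE, rule eventually_mono[OF AE_env_law])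
    fix \<omega> :: "int \<Rightarrow> real" assume \<omega>: "\<forall>x. \<omega> x = a \<or> \<omega> x = 1 - a"
    have w: "0 \<le> \<omega> y" "\<omega> y \<le> 1" for y using spec[OF \<omega>, of y] a by auto
    have "emeasure (quenched \<omega>) ?A \<le> ennreal (\<Prod>x<n. right_weight (\<omega> (int x)) (l (Suc x)) (l x))"
      by (rule emeasure_quenched_profile_le[where l=l and n=n and \<omega>=\<omega>, OF w l])
    also have "\<dots> = (\<Prod>x<n. ennreal (right_weight (\<omega> (int x)) (l (Suc x)) (l x)))"
      by (rule prod_ennreal[symmetric]) (simp add: w right_weight_nonneg)
    also have "\<dots> = (\<Prod>y\<in>int ` {..<n}. ?w \<omega> y)"
      by (subst prod.reindex) auto
    finally show "emeasure (quenched \<omega>) ?A \<le> (\<Prod>y\<in>int ` {..<n}. ?w \<omega> y)" .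
  qed
  also have "\<dots> = (\<Prod>y\<in>int ` {..<n}. \<integral>\<^sup>+w. ennreal (right_weight w (l (Suc (nat y))) (l (nat y))) \<partial>temkin p a)"
    by (rule nn_integral_env_law_prod) (auto simp: right_weight_def)
  also have "\<dots> = (\<Prod>x<n. ennreal (pmf (visit_pmf p a (l (Suc x))) (l x)))"
    by (subst prod.reindex) (auto simp: nn_integral_right_weight[OF p a] pmf_visit_pmf[OF p a])
  also have "\<dots> = ennreal (pmf (chain_pmf p a n 0) (map l (rev [0..<n])))"
    using pmf_chain_pmf[of p a n l] l by (subst prod_ennreal) simp_all
  finally show ?thesis .
qed

definition left_profile :: "nat \<Rightarrow> (nat \<Rightarrow> int) \<Rightarrow> nat list" where
  "left_profile n X = map (\<lambda>x. left_steps x n X) (rev [0..<n])"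

lemma left_profile_eq_iff:
  assumes "length ls = n"
  shows "left_profile n X = ls \<longleftrightarrow> (\<forall>x<n. left_steps x n X = ls ! (n - 1 - x))"
proof -
  have "left_profile n X = ls \<longleftrightarrow> (\<forall>i<n. left_steps (n - 1 - i) n X = ls ! i)"
    using assms by (auto simp: left_profile_def list_eq_iff_nth_eq rev_nth)
  also have "\<dots> \<longleftrightarrow> (\<forall>x<n. left_steps x n X = ls ! (n - 1 - x))"
  proof (intro iffI allI impI)
    fix x assume "\<forall>i<n. left_steps (n - 1 - i) n X = ls ! i" "x < n"
    then show "left_steps x n X = ls ! (n - 1 - x)" by (auto dest: spec[of _ "n - 1 - x"])
  next
    fix x assume "\<forall>x<n. left_steps x n X = ls ! (n - 1 - x)" "x < n"
    then show "left_steps (n - 1 - x) n X = ls ! x" by (auto dest: spec[of _ "n - 1 - x"])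
  qed
  finally show ?thesis .
qed

lemma measurable_left_profile: "left_profile n \<in> measurable path_space (count_space UNIV)"
proof (subst measurable_count_space_eq2_countable, intro conjI ballI)
  fix ls :: "nat list"
  show "left_profile n -` {ls} \<inter> space path_space \<in> sets path_space"
  proof (cases "length ls = n")
    case True
    then have "left_profile n -` {ls} \<inter> space path_space = {X. \<forall>x<n. left_steps x n X = ls ! (n - 1 - x)}"
      using left_profile_eq_iff[OF True] by (auto simp: space_PiM)
    then show ?thesis by (simp only: sets_left_steps_profile)
  next
    case False
    then have "left_profile n -` {ls} = {}" by (auto simp: left_profile_def)
    then show ?thesis by simp
  qed
qed auto

text \<open>
  The pointwise bound for single profiles adds up over the countable set \<open>E\<close>. On the null event that
  \<open>n\<close> is never hit, all left steps are \<open>0\<close> by convention, and this event has to be discarded first.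
\<close>

lemma emeasure_annealed_left_profile_le:
  assumes p: "0 < p" "p < 1 / 2" and a: "0 < a" "a < p"
  shows "emeasure (annealed p a) {X. left_profile n X \<in> E} \<le> emeasure (chain_pmf p a n 0) E"
proof -
  have m: "left_profile n \<in> measurable (annealed p a) (count_space UNIV)"
    using measurable_left_profile by (simp add: measurable_cong_sets[OF sets_annealed refl])
  let ?D = "distr (annealed p a) (count_space UNIV) (left_profile n)"
  have le: "emeasure ?D {ls} \<le> emeasure (chain_pmf p a n 0) {ls}" for ls
  proof -
    have D: "emeasure ?D {ls} = emeasure (annealed p a) {X. left_profile n X = ls}"
      by (subst emeasure_distr[OF m]) (auto simp: space_annealed vimage_def)
    show ?thesis
    proof (cases "length ls = n")
      case True
      define l where "l x = (if x < n then ls ! (n - 1 - x) else 0)" for x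
      have ls: "map l (rev [0..<n]) = ls" using True by (auto simp: l_def list_eq_iff_nth_eq rev_nth)
      have "{X. left_profile n X = ls} = {X. \<forall>x<n. left_steps x n X = l x}"
        using left_profile_eq_iff[OF True] by (auto simp: l_def)
      also have "emeasure (annealed p a) \<dots> = emeasure (annealed p a) {X. (\<exists>t. X t = int n) \<and> (\<forall>x<n. left_steps x n X = l x)}"
      proof (rule emeasure_eq_AE)
        show "AE X in annealed p a. (X \<in> {X. \<forall>x<n. left_steps x n X = l x}) = (X \<in> {X. (\<exists>t. X t = int n) \<and> (\<forall>x<n. left_steps x n X = l x)})"
          using AE_annealed_hits[OF p a, of n] by eventually_elim auto
      qed (simp_all only: sets_annealed sets_left_steps_profile sets_hit_profile)
      also have "\<dots> \<le> ennreal (pmf (chain_pmf p a n 0) (map l (rev [0..<n])))"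
        using p a by (intro emeasure_annealed_profile_le) (auto simp: l_def)
      finally show ?thesis unfolding D ls by (simp add: emeasure_pmf_single)
    next
      case False
      then have "{X. left_profile n X = ls} = {}" by (auto simp: left_profile_def)
      then show ?thesis unfolding D by simp
    qed
  qed
  have "emeasure (annealed p a) {X. left_profile n X \<in> E} = emeasure ?D E"
    by (subst emeasure_distr[OF m]) (auto simp: space_annealed vimage_def)
  also have "\<dots> = (\<integral>\<^sup>+ls. emeasure ?D {ls} \<partial>count_space E)"
    by (rule emeasure_countable_singleton) auto
  also have "\<dots> \<le> (\<integral>\<^sup>+ls. emeasure (chain_pmf p a n 0) {ls} \<partial>count_space E)"
    by (intro nn_integral_mono le)
  also have "\<dots> = emeasure (chain_pmf p a n 0) E"
    by (rule emeasure_countable_singleton[symmetric]) auto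
  finally show ?thesis .
qed

section \<open>Superlinear growth of the branching chain\<close>

definition laplace :: "real \<Rightarrow> real \<Rightarrow> real \<Rightarrow> nat \<Rightarrow> nat \<Rightarrow> ennreal" where
  "laplace p a \<theta> n u = (\<integral>\<^sup>+ls. ennreal (exp (- \<theta> * real (sum_list ls))) \<partial>chain_pmf p a n u)"

lemma laplace_0: "laplace p a \<theta> 0 u = 1"
  by (simp add: laplace_def)

lemma laplace_Suc: "laplace p a \<theta> (Suc n) u = (\<integral>\<^sup>+v. ennreal (exp (- \<theta> * real v)) * laplace p a \<theta> n v \<partial>visit_pmf p a u)"
  by (simp add: laplace_def nn_integral_cmult[symmetric] ennreal_mult'[symmetric] exp_add[symmetric] algebra_simps)

text \<open>
  The kernel is stochastically monotone: an additional individual adds a nonnegative number of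
  offspring.
\<close>

lemma nn_integral_visit_pmf_antimono:
  assumes p: "0 \<le> p" "p \<le> 1" and F: "antimono (F :: nat \<Rightarrow> ennreal)" and "u \<le> u'"
  shows "(\<integral>\<^sup>+v. F v \<partial>visit_pmf p a u') \<le> (\<integral>\<^sup>+v. F v \<partial>visit_pmf p a u)"
proof -
  have "(\<integral>\<^sup>+v. F v \<partial>neg_binomial_pmf (Suc m) w) \<le> (\<integral>\<^sup>+v. F v \<partial>neg_binomial_pmf m w)" for m w
  proof -
    have "(\<integral>\<^sup>+v. F v \<partial>neg_binomial_pmf (Suc m) w) = (\<integral>\<^sup>+x. \<integral>\<^sup>+y. F (x + y) \<partial>neg_binomial_pmf m w \<partial>geometric_pmf w)"
      by (simp add: neg_binomial_pmf_Suc nn_integral_pair_pmf' split: prod.splits)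
    also have "\<dots> \<le> (\<integral>\<^sup>+x. \<integral>\<^sup>+y. F y \<partial>neg_binomial_pmf m w \<partial>geometric_pmf w)"
      by (intro nn_integral_mono antimonoD[OF F]) auto
    finally show ?thesis by (simp add: measure_pmf.emeasure_space_1)
  qed
  then have "(\<integral>\<^sup>+v. F v \<partial>visit_pmf p a (Suc m)) \<le> (\<integral>\<^sup>+v. F v \<partial>visit_pmf p a m)" for m
    unfolding nn_integral_visit_pmf[OF p] by (intro add_mono mult_left_mono) auto
  then show ?thesis using \<open>u \<le> u'\<close> by (rule lift_Suc_antimono_le)
qed

lemma antimono_laplace:
  assumes "0 \<le> p" "p \<le> 1" "0 \<le> \<theta>"
  shows "antimono (laplace p a \<theta> n)"
proof (induction n)
  case 0
  then show ?case by (simp add: laplace_0 antimono_def)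
next
  case (Suc n)
  have "antimono (\<lambda>v. ennreal (exp (- \<theta> * real v)) * laplace p a \<theta> n v)"
    using antimonoD[OF Suc] assms by (intro antimonoI mult_mono) (auto intro!: ennreal_leI mult_left_mono)
  then show ?case using assms by (intro antimonoI) (simp only: laplace_Suc nn_integral_visit_pmf_antimono)
qed

text \<open>
  By monotonicity the chain after \<open>m\<close> generations only gains in Laplace transform when it is reset
  to \<open>0\<close>.
\<close>

lemma laplace_add_le:
  assumes "0 \<le> p" "p \<le> 1" "0 \<le> \<theta>"
  shows "laplace p a \<theta> (m + n) u \<le> laplace p a \<theta> m u * laplace p a \<theta> n 0"
proof (induction m arbitrary: u)
  case 0
  then show ?case using antimonoD[OF antimono_laplace[OF assms], of 0 u] by (simp add: laplace_0)
next
  case (Suc m)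
  have "laplace p a \<theta> (Suc m + n) u \<le> (\<integral>\<^sup>+v. ennreal (exp (- \<theta> * real v)) * (laplace p a \<theta> m v * laplace p a \<theta> n 0) \<partial>visit_pmf p a u)"
    unfolding add_Suc laplace_Suc by (intro nn_integral_mono mult_left_mono Suc.IH) auto
  also have "\<dots> = (\<integral>\<^sup>+v. laplace p a \<theta> n 0 * (ennreal (exp (- \<theta> * real v)) * laplace p a \<theta> m v) \<partial>visit_pmf p a u)"
    by (intro nn_integral_cong) (simp add: mult_ac)
  also have "\<dots> = laplace p a \<theta> (Suc m) u * laplace p a \<theta> n 0"
    unfolding laplace_Suc by (subst nn_integral_cmult) (auto simp: mult.commute)
  finally show ?case .
qed

lemma laplace_le_1: "0 \<le> \<theta> \<Longrightarrow> laplace p a \<theta> n u \<le> 1"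
proof -
  assume "0 \<le> \<theta>"
  then have "laplace p a \<theta> n u \<le> (\<integral>\<^sup>+ls. 1 \<partial>chain_pmf p a n u)"
    unfolding laplace_def by (intro nn_integral_mono) auto
  then show ?thesis by (simp add: measure_pmf.emeasure_space_1)
qed

lemma laplace_less_top: "0 \<le> \<theta> \<Longrightarrow> laplace p a \<theta> n u < top"
  using laplace_le_1 by (rule le_less_trans) simp_all

lemma laplace_block_le:
  assumes "0 \<le> p" "p \<le> 1" "0 \<le> \<theta>"
  shows "laplace p a \<theta> (m * B + r) 0 \<le> laplace p a \<theta> B 0 ^ m"
proof (induction m)
  case 0
  then show ?case using laplace_le_1 assms by simp
next
  case (Suc m)
  have "laplace p a \<theta> (Suc m * B + r) 0 \<le> laplace p a \<theta> B 0 * laplace p a \<theta> (m * B + r) 0"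
    using laplace_add_le[OF assms, of a B "m * B + r" 0] by (simp add: add_ac)
  also have "\<dots> \<le> laplace p a \<theta> B 0 * laplace p a \<theta> B 0 ^ m" by (intro mult_left_mono Suc) auto
  finally show ?case by simp
qed

text \<open>
  The difference of the two sides is \<open>(p - a) (1 - 2 a)\<close> up to a positive factor.
\<close>

lemma mean_rho_ge_1:
  fixes p a :: real
  assumes "0 < a" "a \<le> p" "p \<le> 1 / 2"
  shows "1 \<le> p * ((1 - a) / a) + (1 - p) * (a / (1 - a))"
proof -
  have "0 \<le> (p - a) * (1 - 2 * a)" using assms by simp
  also have "(p - a) * (1 - 2 * a) = p * (1 - a)\<^sup>2 + (1 - p) * a\<^sup>2 - a * (1 - a)"
    by (simp add: power2_eq_square algebra_simps)
  finally have "a * (1 - a) \<le> p * (1 - a)\<^sup>2 + (1 - p) * a\<^sup>2" by simp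
  then have "1 \<le> (p * (1 - a)\<^sup>2 + (1 - p) * a\<^sup>2) / (a * (1 - a))" using assms by (simp add: field_simps)
  also have "\<dots> = p * ((1 - a) / a) + (1 - p) * (a / (1 - a))" using assms by (simp add: field_simps power2_eq_square)
  finally show ?thesis .
qed

lemma nn_integral_neg_binomial_real:
  assumes "0 < w" "w < 1"
  shows "(\<integral>\<^sup>+v. ennreal (real v) \<partial>neg_binomial_pmf n w) = ennreal (real n * (1 - w) / w)"
proof -
  have "(\<lambda>v. ennreal (real v)) = of_nat" by (simp add: fun_eq_iff ennreal_of_nat_eq_real_of_nat)
  then show ?thesis using nn_integral_neg_binomial_pmf_real[of w n] assms by simp
qed

lemma mean_visit_pmf_ge:
  assumes p: "0 < p" "p < 1 / 2" and a: "0 < a" "a < p"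
  shows "ennreal (real (Suc u)) \<le> (\<integral>\<^sup>+v. ennreal (real v) \<partial>visit_pmf p a u)"
proof -
  have "ennreal (real (Suc u)) \<le> ennreal (real (Suc u) * (p * ((1 - a) / a) + (1 - p) * (a / (1 - a))))"
    using mult_left_mono[OF mean_rho_ge_1[of a p], of "real (Suc u)"] p a by (intro ennreal_leI) simp
  also have "\<dots> = ennreal p * ennreal (real (Suc u) * (1 - a) / a) + ennreal (1 - p) * ennreal (real (Suc u) * (1 - (1 - a)) / (1 - a))"
  proof -
    have "real (Suc u) * (p * ((1 - a) / a) + (1 - p) * (a / (1 - a))) =
        p * (real (Suc u) * (1 - a) / a) + (1 - p) * (real (Suc u) * (1 - (1 - a)) / (1 - a))"
      by (simp add: algebra_simps)
    then show ?thesis using p a by (simp only: ennreal_plus ennreal_mult' mult_nonneg_nonneg divide_nonneg_nonneg of_nat_0_le_iff)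
  qed
  also have "\<dots> = (\<integral>\<^sup>+v. ennreal (real v) \<partial>visit_pmf p a u)"
  proof -
    have "0 \<le> p" "p \<le> 1" "a < 1" "0 < 1 - a" "1 - a < 1" using p a by auto
    then show ?thesis using a by (simp only: nn_integral_visit_pmf nn_integral_neg_binomial_real)
  qed
  finally show ?thesis .
qed

text \<open>
  One immigrant per generation and a mean offspring of at least \<open>1\<close>: the generation number \<open>k\<close> has
  mean at least \<open>u + k\<close>.
\<close>

lemma mean_chain_ge:
  assumes p: "0 < p" "p < 1 / 2" and a: "0 < a" "a < p"
  shows "ennreal (real n * real u + real n * (real n + 1) / 2) \<le> (\<integral>\<^sup>+ls. ennreal (real (sum_list ls)) \<partial>chain_pmf p a n u)"
proof (induction n arbitrary: u)
  let ?q = "\<lambda>n. ennreal (real n * (real n + 1) / 2)"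
  let ?M = "\<lambda>n u. \<integral>\<^sup>+ls. ennreal (real (sum_list ls)) \<partial>chain_pmf p a n u"
  case (Suc n)
  have "ennreal (real (Suc n) * real u + real (Suc n) * (real (Suc n) + 1) / 2) =
     ennreal (real (Suc n)) * ennreal (real (Suc u)) + ?q n"
    by (simp add: ennreal_mult'[symmetric] ennreal_plus[symmetric] field_simps del: ennreal_plus)
  also have "\<dots> \<le> ennreal (real (Suc n)) * (\<integral>\<^sup>+v. ennreal (real v) \<partial>visit_pmf p a u) + ?q n"
    by (intro add_mono mult_left_mono mean_visit_pmf_ge[OF p a]) auto
  also have "\<dots> = (\<integral>\<^sup>+v. ennreal (real (Suc n)) * ennreal (real v) + ?q n \<partial>visit_pmf p a u)"
    by (simp add: nn_integral_add nn_integral_cmult measure_pmf.emeasure_space_1 del: of_nat_Suc)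
  also have "\<dots> = (\<integral>\<^sup>+v. ennreal (real v) + ennreal (real n * real v + real n * (real n + 1) / 2) \<partial>visit_pmf p a u)"
    by (intro nn_integral_cong) (simp add: ennreal_mult'[symmetric] ennreal_plus[symmetric] algebra_simps del: ennreal_plus)
  also have "\<dots> \<le> (\<integral>\<^sup>+v. ennreal (real v) + ?M n v \<partial>visit_pmf p a u)"
    by (intro nn_integral_mono add_mono Suc.IH) auto
  also have "\<dots> = (\<integral>\<^sup>+v. (\<integral>\<^sup>+ls. ennreal (real v) + ennreal (real (sum_list ls)) \<partial>chain_pmf p a n v) \<partial>visit_pmf p a u)"
    by (intro nn_integral_cong) (simp add: nn_integral_add measure_pmf.emeasure_space_1)
  also have "\<dots> = ?M (Suc n) u"
    by simp
  finally show ?case .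
qed simp

lemma exp_difference_quotient_tendsto:
  fixes s :: real
  shows "(\<lambda>k. real (Suc k) * (1 - exp (- (1 / real (Suc k)) * s))) \<longlonglongrightarrow> s"
proof -
  have "((\<lambda>h. (exp (- s * h) - 1) / h) \<longlongrightarrow> - s) (at 0)"
  proof -
    have "((\<lambda>h. exp (- s * h)) has_field_derivative - s) (at 0)" by (auto intro!: derivative_eq_intros)
    then show ?thesis by (simp add: has_field_derivative_iff)
  qed
  then have "((\<lambda>h. - ((exp (- s * h) - 1) / h)) \<longlongrightarrow> - (- s)) (at 0)" by (rule tendsto_minus)
  moreover have "filterlim (\<lambda>k. 1 / real (Suc k)) (at 0) sequentially"
    using LIMSEQ_inverse_real_of_nat by (auto simp: filterlim_at inverse_eq_divide)
  ultimately have "(\<lambda>k. - ((exp (- s * (1 / real (Suc k))) - 1) / (1 / real (Suc k)))) \<longlonglongrightarrow> - (- s)"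
    by (rule filterlim_compose)
  moreover have "- ((exp (- s * (1 / real (Suc k))) - 1) / (1 / real (Suc k))) = real (Suc k) * (1 - exp (- (1 / real (Suc k)) * s))" for k
    by (simp add: algebra_simps del: of_nat_Suc)
  ultimately show ?thesis by simp
qed

text \<open>
  As \<open>\<theta> \<rightarrow> 0\<close>, \<open>(1 - e\<^bsup>-\<theta>S\<^esup>) / \<theta>\<close> tends to the block sum \<open>S\<close>, so by Fatou its mean eventually exceeds
  \<open>K B\<close> if that of \<open>S\<close> does. It only remains to compare \<open>1 - \<theta> K B\<close> with the exponential.
\<close>

lemma laplace_block_small:
  assumes p: "0 < p" "p < 1 / 2" and a: "0 < a" "a < p" and K: "0 \<le> K"
  obtains B \<theta> where "0 < B" "0 < \<theta>" "laplace p a \<theta> B 0 < ennreal (exp (- \<theta> * K * real B))"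
proof -
  let ?f = "\<lambda>k ls. real (Suc k) * (1 - exp (- (1 / real (Suc k)) * real (sum_list ls)))"
  \<comment> \<open>The mean block sum is at least \<open>B (B + 1) / 2\<close>, which exceeds \<open>K B\<close> for this choice.\<close>
  obtain B :: nat where B: "2 * K + 2 < real B" using reals_Archimedean2 by blast
  have B0: "0 < B" using B K by (cases B) auto
  let ?M = "measure_pmf (chain_pmf p a B 0)"
  have "ennreal (K * real B) < ennreal (real B * (real B + 1) / 2)"
  proof (rule ennreal_lessI)
    show "0 < real B * (real B + 1) / 2" using B0 by simp
    have "K * real B < (real B + 1) / 2 * real B" using B B0 by (intro mult_strict_right_mono) auto
    then show "K * real B < real B * (real B + 1) / 2" by (simp add: algebra_simps)
  qed
  also have "\<dots> \<le> (\<integral>\<^sup>+ls. ennreal (real (sum_list ls)) \<partial>?M)"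
    using mean_chain_ge[OF p a, of B 0] by simp
  also have "\<dots> = (\<integral>\<^sup>+ls. liminf (\<lambda>k. ennreal (?f k ls)) \<partial>?M)"
    by (intro nn_integral_cong lim_imp_Liminf[symmetric] tendsto_ennrealI exp_difference_quotient_tendsto trivial_limit_sequentially)
  also have "\<dots> \<le> liminf (\<lambda>k. \<integral>\<^sup>+ls. ennreal (?f k ls) \<partial>?M)"
    by (rule nn_integral_liminf) simp
  finally have "\<forall>\<^sub>F k in sequentially. ennreal (K * real B) < (\<integral>\<^sup>+ls. ennreal (?f k ls) \<partial>?M)"
    by (rule less_LiminfD)
  then obtain k where k: "ennreal (K * real B) < (\<integral>\<^sup>+ls. ennreal (?f k ls) \<partial>?M)"
    by (auto simp: eventually_sequentially)
  define \<theta> where "\<theta> = 1 / real (Suc k)"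
  have \<theta>: "0 < \<theta>" by (simp add: \<theta>_def)
  define \<zeta> where "\<zeta> = enn2real (laplace p a \<theta> B 0)"
  have \<zeta>: "laplace p a \<theta> B 0 = ennreal \<zeta>" "0 \<le> \<zeta>"
    using laplace_less_top[of \<theta> p a B 0] \<theta> by (simp_all add: \<zeta>_def)
  have one_minus: "ennreal (1 - exp x) = 1 - ennreal (exp x)" for x :: real
    by (metis ennreal_1 ennreal_minus exp_ge_zero)
  have "(\<integral>\<^sup>+ls. ennreal (real (Suc k) * (1 - exp (- \<theta> * real (sum_list ls)))) \<partial>?M) =
     ennreal (real (Suc k)) * (\<integral>\<^sup>+ls. 1 - ennreal (exp (- \<theta> * real (sum_list ls))) \<partial>?M)"
    using \<theta> by (subst nn_integral_cmult[symmetric]) (auto simp: ennreal_mult' one_minus simp del: of_nat_Suc intro!: nn_integral_cong)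
  also have "(\<integral>\<^sup>+ls. 1 - ennreal (exp (- \<theta> * real (sum_list ls))) \<partial>?M) = 1 - laplace p a \<theta> B 0"
    unfolding laplace_def
    by (subst nn_integral_diff)
      (use laplace_less_top[of \<theta> p a B 0] \<theta> in \<open>auto simp: laplace_def measure_pmf.emeasure_space_1\<close>)
  also have "ennreal (real (Suc k)) * (1 - laplace p a \<theta> B 0) = ennreal (real (Suc k) * (1 - \<zeta>))"
    unfolding \<zeta>(1) using \<zeta>(2) by (simp add: ennreal_minus ennreal_mult' flip: ennreal_1 del: of_nat_Suc)
  finally have "ennreal (K * real B) < ennreal (real (Suc k) * (1 - \<zeta>))" using k unfolding \<theta>_def by simp
  then have "K * real B < real (Suc k) * (1 - \<zeta>)" using K by (subst (asm) ennreal_less_iff) auto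
  then have "\<zeta> < 1 - \<theta> * K * real B" by (simp add: \<theta>_def field_simps)
  also have "\<dots> \<le> exp (- \<theta> * K * real B)" using exp_ge_add_one_self[of "- \<theta> * K * real B"] by simp
  finally have "laplace p a \<theta> B 0 < ennreal (exp (- \<theta> * K * real B))"
    unfolding \<zeta>(1) using \<zeta>(2) by (simp add: ennreal_less_iff)
  then show ?thesis using that B0 \<theta> by blast
qed

text \<open>
  An exponential Markov inequality, with the Laplace transform bounded blockwise.
\<close>

lemma chain_sum_superlinear:
  assumes p: "0 < p" "p < 1 / 2" and a: "0 < a" "a < p" and K: "0 \<le> K"
  shows "(\<lambda>n. measure_pmf.prob (chain_pmf p a n 0) {ls. real (sum_list ls) \<le> K * real n}) \<longlonglongrightarrow> 0"
proof -
  let ?A = "\<lambda>n. {ls. real (sum_list ls) \<le> K * real n}"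
  obtain B \<theta> where B: "0 < B" and \<theta>: "0 < \<theta>" and small: "laplace p a \<theta> B 0 < ennreal (exp (- \<theta> * K * real B))"
    using laplace_block_small[OF p a K] by blast
  define \<zeta> where "\<zeta> = enn2real (laplace p a \<theta> B 0)"
  have \<zeta>: "laplace p a \<theta> B 0 = ennreal \<zeta>" "0 \<le> \<zeta>"
    using laplace_less_top[of \<theta> p a B 0] \<theta> by (simp_all add: \<zeta>_def)
  define q where "q = exp (\<theta> * K * real B) * \<zeta>"
  have q: "0 \<le> q" "q < 1"
  proof -
    have "\<zeta> < exp (- \<theta> * K * real B)" using small \<zeta> by (simp add: ennreal_less_iff)
    then have "exp (\<theta> * K * real B) * \<zeta> < exp (\<theta> * K * real B) * exp (- \<theta> * K * real B)" by simp
    then show "q < 1" by (simp add: q_def exp_add[symmetric])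
  qed (simp add: q_def \<zeta>)
  have bound: "measure_pmf.prob (chain_pmf p a n 0) (?A n) \<le> exp (\<theta> * K * real B) * q ^ (n div B)" for n
  proof -
    let ?M = "measure_pmf (chain_pmf p a n 0)"
    have "emeasure ?M (?A n) = (\<integral>\<^sup>+ls. indicator (?A n) ls \<partial>?M)"
      by simp
    also have "\<dots> \<le> (\<integral>\<^sup>+ls. ennreal (exp (\<theta> * K * real n)) * ennreal (exp (- \<theta> * real (sum_list ls))) \<partial>?M)"
    proof (intro nn_integral_mono)
      fix ls
      have "\<theta> * real (sum_list ls) \<le> \<theta> * (K * real n)" if "real (sum_list ls) \<le> K * real n"
        using \<theta> that by (intro mult_left_mono) auto
      then show "indicator (?A n) ls \<le> ennreal (exp (\<theta> * K * real n)) * ennreal (exp (- \<theta> * real (sum_list ls)))"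
        by (auto simp: indicator_def ennreal_mult'[symmetric] exp_add[symmetric] algebra_simps)
    qed
    also have "\<dots> = ennreal (exp (\<theta> * K * real n)) * laplace p a \<theta> n 0"
      unfolding laplace_def by (rule nn_integral_cmult) simp
    also have "\<dots> \<le> ennreal (exp (\<theta> * K * real n)) * ennreal \<zeta> ^ (n div B)"
      using laplace_block_le[of p \<theta> a "n div B" B "n mod B"] p \<theta> \<zeta> by (intro mult_left_mono) auto
    also have "\<dots> = ennreal (exp (\<theta> * K * real n) * \<zeta> ^ (n div B))"
      using \<zeta> by (simp add: ennreal_power ennreal_mult')
    also have "\<dots> \<le> ennreal (exp (\<theta> * K * real B) * q ^ (n div B))"
    proof (rule ennreal_leI)
      \<comment> \<open>The factor \<open>exp (\<theta> K B)\<close> of the bound pays for the incomplete last block.\<close>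
      have "real n \<le> real B + real (n div B) * real B"
      proof -
        have "n \<le> B + (n div B) * B" using B mod_less_divisor[OF B, of n] div_mult_mod_eq[of n B] by linarith
        then show ?thesis by (metis of_nat_le_iff of_nat_add of_nat_mult)
      qed
      then have "\<theta> * K * real n \<le> \<theta> * K * real B + real (n div B) * (\<theta> * K * real B)"
        using mult_left_mono[of "real n" "real B + real (n div B) * real B" "\<theta> * K"] \<theta> K by (simp add: algebra_simps)
      then have "exp (\<theta> * K * real n) \<le> exp (\<theta> * K * real B) * exp (\<theta> * K * real B) ^ (n div B)"
        by (simp add: exp_of_nat_mult[symmetric] exp_add[symmetric])
      then show "exp (\<theta> * K * real n) * \<zeta> ^ (n div B) \<le> exp (\<theta> * K * real B) * q ^ (n div B)"
        using mult_right_mono[of "exp (\<theta> * K * real n)" "exp (\<theta> * K * real B) * exp (\<theta> * K * real B) ^ (n div B)" "\<zeta> ^ (n div B)"] \<zeta>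
        by (simp add: q_def power_mult_distrib mult_ac)
    qed
    finally show ?thesis using q by (simp add: measure_pmf.emeasure_eq_measure)
  qed
  have "filterlim (\<lambda>n. n div B) at_top sequentially"
    unfolding filterlim_at_top
  proof
    fix Z show "\<forall>\<^sub>F n in sequentially. Z \<le> n div B"
      using eventually_ge_at_top[of "Z * B"] by eventually_elim (use B in \<open>simp add: less_eq_div_iff_mult_less_eq\<close>)
  qed
  then have "(\<lambda>n. exp (\<theta> * K * real B) * q ^ (n div B)) \<longlonglongrightarrow> exp (\<theta> * K * real B) * 0"
    using q by (intro tendsto_mult tendsto_const filterlim_compose[OF LIMSEQ_realpow_zero]) auto
  then have lim: "(\<lambda>n. exp (\<theta> * K * real B) * q ^ (n div B)) \<longlonglongrightarrow> 0" by simp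
  show ?thesis
    by (rule tendsto_sandwich[OF _ _ tendsto_const lim]) (use bound in auto)
qed

fun pair_sum :: "(nat \<Rightarrow> nat \<Rightarrow> ennreal) \<Rightarrow> nat \<Rightarrow> nat list \<Rightarrow> ennreal" where
  "pair_sum g u [] = 0"
| "pair_sum g u (v # ls) = g u v + pair_sum g v ls"

lemma nn_integral_pair_sum_le:
  assumes "\<And>u. (\<integral>\<^sup>+v. g u v \<partial>visit_pmf p a u) \<le> C"
  shows "(\<integral>\<^sup>+ls. pair_sum g u ls \<partial>chain_pmf p a n u) \<le> of_nat n * C"
proof (induction n arbitrary: u)
  case (Suc n)
  have "(\<integral>\<^sup>+ls. pair_sum g u ls \<partial>chain_pmf p a (Suc n) u) = (\<integral>\<^sup>+v. g u v + (\<integral>\<^sup>+ls. pair_sum g v ls \<partial>chain_pmf p a n v) \<partial>visit_pmf p a u)"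
    by (simp add: nn_integral_add measure_pmf.emeasure_space_1)
  also have "\<dots> \<le> (\<integral>\<^sup>+v. g u v + of_nat n * C \<partial>visit_pmf p a u)"
    by (intro nn_integral_mono add_mono Suc.IH) auto
  also have "\<dots> = (\<integral>\<^sup>+v. g u v \<partial>visit_pmf p a u) + of_nat n * C"
    by (simp add: nn_integral_add measure_pmf.emeasure_space_1)
  also have "\<dots> \<le> C + of_nat n * C" by (intro add_mono assms) auto
  finally show ?case by (simp add: algebra_simps)
qed simp

lemma pair_sum_profile:
  "pair_sum g (l n) (map l (rev [0..<n])) = (\<Sum>x<n. g (l (Suc x)) (l x))"
  by (induction n) (simp_all add: add.commute)

section \<open>Deviations and moments of the negative binomial law\<close>

lemma nn_integral_exp_geometric_pmf:
  assumes w: "0 < w" "w < 1" and c: "(1 - w) * exp c < 1"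
  shows "(\<integral>\<^sup>+v. ennreal (exp (c * real v + d)) \<partial>geometric_pmf w) = ennreal (exp d * w / (1 - (1 - w) * exp c))"
proof -
  have "(\<integral>\<^sup>+v. ennreal (exp (c * real v + d)) \<partial>geometric_pmf w) = (\<Sum>v. ennreal (exp d * w * ((1 - w) * exp c) ^ v))"
    using w by (simp add: nn_integral_measure_pmf nn_integral_count_space_nat ennreal_mult'[symmetric] exp_add
      exp_of_nat2_mult power_mult_distrib mult_ac)
  also have "\<dots> = ennreal (exp d * w * (1 / (1 - (1 - w) * exp c)))"
    using w c by (intro suminf_ennreal_eq sums_mult geometric_sums) auto
  finally show ?thesis by simp
qed

lemma nn_integral_exp_neg_binomial_pmf:
  "(\<integral>\<^sup>+v. ennreal (exp (c * real v + real n * d)) \<partial>neg_binomial_pmf n w) = (\<integral>\<^sup>+v. ennreal (exp (c * real v + d)) \<partial>geometric_pmf w) ^ n"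
proof (induction n)
  case (Suc n)
  have "(\<integral>\<^sup>+v. ennreal (exp (c * real v + real (Suc n) * d)) \<partial>neg_binomial_pmf (Suc n) w) =
    (\<integral>\<^sup>+x. \<integral>\<^sup>+y. ennreal (exp (c * real x + d)) * ennreal (exp (c * real y + real n * d)) \<partial>neg_binomial_pmf n w \<partial>geometric_pmf w)"
    by (simp add: neg_binomial_pmf_Suc nn_integral_pair_pmf' ennreal_mult'[symmetric] exp_add[symmetric] algebra_simps split: prod.splits)
  also have "\<dots> = (\<integral>\<^sup>+x. ennreal (exp (c * real x + d)) \<partial>geometric_pmf w) * (\<integral>\<^sup>+y. ennreal (exp (c * real y + real n * d)) \<partial>neg_binomial_pmf n w)"
    by (simp add: nn_integral_cmult nn_integral_multc)
  finally show ?case by (simp add: Suc.IH)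
qed simp

text \<open>
  At \<open>h = 0\<close> the integral is \<open>1\<close>, and its derivative there is the mean \<open>- \<epsilon>\<close> of the exponent. The
  sign \<open>c\<close> selects the upper or the lower tail.
\<close>

lemma geometric_pmf_tilt:
  assumes w: "0 < w" "w < 1" and \<epsilon>: "0 < \<epsilon>"
  shows "\<forall>\<^sub>F h in at_right 0. (\<integral>\<^sup>+v. ennreal (exp (h * c * real v + h * (- c * ((1 - w) / w) - \<epsilon>))) \<partial>geometric_pmf w) \<le> 1"
proof -
  let ?d = "- c * ((1 - w) / w) - \<epsilon>"
  let ?D = "\<lambda>h. exp (h * ?d) * w / (1 - (1 - w) * exp (h * c))"
  have D: "(?D has_field_derivative - \<epsilon>) (at 0)"
    using w by (auto intro!: derivative_eq_intros simp: field_simps power2_eq_square)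
  obtain \<delta> where \<delta>: "\<delta> > 0" "\<And>h. h > 0 \<Longrightarrow> h < \<delta> \<Longrightarrow> ?D (0 + h) < ?D 0"
    using DERIV_neg_dec_right[OF D] \<epsilon> by auto
  have "((\<lambda>h. (1 - w) * exp (h * c)) \<longlongrightarrow> (1 - w) * exp (0 * c)) (at_right 0)"
    by (intro tendsto_intros)
  then have ev: "\<forall>\<^sub>F h in at_right 0. (1 - w) * exp (h * c) < 1"
    by (rule order_tendstoD(2)) (use w in simp)
  have "\<forall>\<^sub>F h in at_right 0. h \<in> {0<..<\<delta>}"
    using \<delta>(1) by (rule eventually_at_right_real)
  with ev show ?thesis
  proof eventually_elim
    fix h assume h: "(1 - w) * exp (h * c) < 1" "h \<in> {0<..<\<delta>}"
    have "?D h \<le> 1" using \<delta>(2)[of h] h w by simp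
    then show "(\<integral>\<^sup>+v. ennreal (exp (h * c * real v + h * ?d)) \<partial>geometric_pmf w) \<le> 1"
      by (subst nn_integral_exp_geometric_pmf[OF w h(1)]) (simp add: ennreal_le_1)
  qed
qed

text \<open>
  A sum of \<open>n\<close> independent geometric variables, each of which has tilted exponential moment at most
  \<open>1\<close> for both signs; \<open>e\<^bsup>\<bar>x\<bar>\<^esup>\<close> is at most the sum of the two. The point is that \<open>h\<close> does
  not depend on \<open>n\<close>.
\<close>

lemma neg_binomial_exponential_deviation:
  assumes w: "0 < w" "w < 1" and \<epsilon>: "0 < \<epsilon>"
  obtains h where "0 < h"
    "\<And>n. (\<integral>\<^sup>+v. ennreal (exp (h * (\<bar>real v - (1 - w) / w * real n\<bar> - \<epsilon> * real n))) \<partial>neg_binomial_pmf n w) \<le> 2"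
proof -
  let ?d = "\<lambda>n v. \<bar>real v - (1 - w) / w * real n\<bar> - \<epsilon> * real n"
  let ?e = "\<lambda>h c n v. exp (h * c * real v + real n * (h * (- c * ((1 - w) / w) - \<epsilon>)))"
  let ?g = "\<lambda>h c. \<integral>\<^sup>+v. ennreal (exp (h * c * real v + h * (- c * ((1 - w) / w) - \<epsilon>))) \<partial>geometric_pmf w"
  have "\<forall>\<^sub>F h in at_right (0::real). 0 < h"
    by (simp add: eventually_at_right_less)
  moreover have "\<forall>\<^sub>F h in at_right (0::real). \<forall>c\<in>{1, -1}.
      ?g h c \<le> 1"
    by (intro eventually_ball_finite ballI geometric_pmf_tilt[OF w \<epsilon>]) simp
  ultimately have "\<forall>\<^sub>F h in at_right (0::real). 0 < h \<and>
    (\<forall>c\<in>{1, -1}. ?g h c \<le> 1)"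
    by (rule eventually_conj)
  then obtain h where h: "0 < h"
    and c: "\<And>c. c \<in> {1, -1} \<Longrightarrow> ?g h c \<le> 1"
    using eventually_happens'[OF trivial_limit_at_right_real] by blast
  have nb: "(\<integral>\<^sup>+v. ennreal (?e h c n v) \<partial>neg_binomial_pmf n w) \<le> 1" if "c \<in> {1, -1}" for c n
    unfolding nn_integral_exp_neg_binomial_pmf using c[OF that] by (rule power_le_one[rotated]) simp
  have "(\<integral>\<^sup>+v. ennreal (exp (h * ?d n v)) \<partial>neg_binomial_pmf n w) \<le> 2" for n
  proof -
    have "(\<integral>\<^sup>+v. ennreal (exp (h * ?d n v)) \<partial>neg_binomial_pmf n w) \<le>
      (\<integral>\<^sup>+v. ennreal (?e h 1 n v) +
        ennreal (?e h (-1) n v) \<partial>neg_binomial_pmf n w)"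
    proof (intro nn_integral_mono)
      fix v
      define x where "x = (1 - w) / w * real n"
      have "exp (h * (\<bar>real v - x\<bar> - \<epsilon> * real n)) \<le> exp (h * (real v - x - \<epsilon> * real n)) + exp (h * (x - real v - \<epsilon> * real n))"
        by (cases "x \<le> real v") (simp_all add: abs_if)
      also have "h * (real v - x - \<epsilon> * real n) = h * 1 * real v + real n * (h * (- 1 * ((1 - w) / w) - \<epsilon>))"
        unfolding x_def using w by (simp add: field_simps)
      also have "h * (x - real v - \<epsilon> * real n) = h * -1 * real v + real n * (h * (- (-1) * ((1 - w) / w) - \<epsilon>))"
        unfolding x_def using w by (simp add: field_simps)
      finally have le: "exp (h * ?d n v) \<le>
        ?e h 1 n v + ?e h (-1) n v"
        unfolding x_def .
      show "ennreal (exp (h * ?d n v)) \<le>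
        ennreal (?e h 1 n v) +
        ennreal (?e h (-1) n v)"
        by (rule ord_le_eq_trans[OF ennreal_leI[OF le] ennreal_plus]) simp_all
    qed
    also have "\<dots> \<le> 1 + 1"
      by (rule ord_eq_le_trans[OF nn_integral_add add_mono[OF nb nb]]) simp_all
    finally show ?thesis by simp
  qed
  then show ?thesis using that h by blast
qed

lemma nn_integral_neg_binomial_excess_le:
  assumes w: "0 < w" "w < 1" and \<epsilon>: "0 < \<epsilon>"
  obtains C where "0 \<le> C"
    "\<And>n. (\<integral>\<^sup>+v. ennreal (\<bar>real v - (1 - w) / w * real n\<bar> - \<epsilon> * real n) \<partial>neg_binomial_pmf n w) \<le> ennreal C"
proof -
  let ?d = "\<lambda>n v. \<bar>real v - (1 - w) / w * real n\<bar> - \<epsilon> * real n"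
  obtain h where h: "0 < h"
    and le: "\<And>n. (\<integral>\<^sup>+v. ennreal (exp (h * (?d n v))) \<partial>neg_binomial_pmf n w) \<le> 2"
    using neg_binomial_exponential_deviation[OF w \<epsilon>] by blast
  have "(\<integral>\<^sup>+v. ennreal (?d n v) \<partial>neg_binomial_pmf n w) \<le> ennreal (1 / h * 2)" for n
  proof -
    have *: "y \<le> 1 / h * exp (h * y)" for y
    proof -
      have "h * y \<le> exp (h * y)" using exp_ge_add_one_self[of "h * y"] by linarith
      then show ?thesis using h by (simp add: field_simps)
    qed
    have "(\<integral>\<^sup>+v. ennreal (?d n v) \<partial>neg_binomial_pmf n w) \<le>
      (\<integral>\<^sup>+v. ennreal (1 / h) * ennreal (exp (h * (?d n v))) \<partial>neg_binomial_pmf n w)"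
      using h by (intro nn_integral_mono) (auto simp: ennreal_mult'[symmetric] intro!: ennreal_leI * simp del: times_divide_eq_left)
    also have "\<dots> \<le> ennreal (1 / h) * 2"
      by (subst nn_integral_cmult, simp, intro mult_left_mono le) simp
    also have "\<dots> = ennreal (1 / h * 2)" using h by (simp add: ennreal_mult' del: times_divide_eq_left)
    finally show ?thesis .
  qed
  then show ?thesis using that[of "1 / h * 2"] h by simp
qed

text \<open>
  For \<open>w < 1/2\<close> the mean \<open>n (1 - w) / w\<close> exceeds \<open>n\<close> by a multiple of \<open>n\<close>, so \<open>v < n\<close> has
  exponentially small probability.
\<close>

lemma prob_neg_binomial_lower_tail:
  assumes w: "0 < w" "w < 1 / 2"
  obtains C where "0 \<le> C" "\<And>n. (real n)\<^sup>2 * measure_pmf.prob (neg_binomial_pmf n w) {v. v < n} \<le> C"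
proof -
  let ?d = "\<lambda>\<epsilon> n v. \<bar>real v - (1 - w) / w * real n\<bar> - \<epsilon> * real n"
  define \<epsilon> where "\<epsilon> = ((1 - w) / w - 1) / 2"
  have \<epsilon>: "0 < \<epsilon>" using w by (simp add: \<epsilon>_def field_simps)
  obtain h where h: "0 < h"
    and le: "\<And>n. (\<integral>\<^sup>+v. ennreal (exp (h * ?d \<epsilon> n v)) \<partial>neg_binomial_pmf n w) \<le> 2"
    using neg_binomial_exponential_deviation[of w \<epsilon>] w \<epsilon> by auto
  \<comment> \<open>Chosen such that \<open>n\<^sup>2 = k (h \<epsilon> n)\<^sup>2 / 2 \<le> k exp (h \<epsilon> n)\<close>.\<close>
  define k where "k = 2 / (h * \<epsilon>)\<^sup>2"
  have k: "0 \<le> k" by (simp add: k_def)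
  have bound: "(real n)\<^sup>2 * measure_pmf.prob (neg_binomial_pmf n w) {v. v < n} \<le> k * 2" for n
  proof -
    have pt: "(real n)\<^sup>2 * indicator {v. v < n} v \<le> k * exp (h * ?d \<epsilon> n v)" for v
    proof (cases "v < n")
      case True
      have "(1 - w) / w = 1 + 2 * \<epsilon>" proof -
        have "m = 1 + 2 * ((m - 1) / 2)" for m :: real by (simp add: field_simps)
        then show ?thesis unfolding \<epsilon>_def .
      qed
      then have "(1 - w) / w * real n = real n + 2 * (\<epsilon> * real n)" by (simp add: algebra_simps)
      then have "\<epsilon> * real n \<le> \<bar>real v - (1 - w) / w * real n\<bar> - \<epsilon> * real n" using True \<epsilon> by simp
      then have "exp (h * (\<epsilon> * real n)) \<le> exp (h * ?d \<epsilon> n v)"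
        using h by simp
      moreover have "(h * (\<epsilon> * real n))\<^sup>2 / 2 \<le> exp (h * (\<epsilon> * real n))"
      proof -
        have "0 \<le> h * (\<epsilon> * real n)" using h \<epsilon> by simp
        then show ?thesis using exp_lower_Taylor_quadratic[of "h * (\<epsilon> * real n)"] by linarith
      qed
      ultimately have "(h * (\<epsilon> * real n))\<^sup>2 / 2 \<le> exp (h * ?d \<epsilon> n v)"
        by linarith
      then have "k * ((h * (\<epsilon> * real n))\<^sup>2 / 2) \<le> k * exp (h * ?d \<epsilon> n v)"
        using k by (rule mult_left_mono)
      moreover have "k * ((h * (\<epsilon> * real n))\<^sup>2 / 2) = (real n)\<^sup>2" using h \<epsilon> by (simp add: k_def power_mult_distrib)
      ultimately show ?thesis using True by simp
    qed (simp add: k)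
    have "ennreal ((real n)\<^sup>2 * measure_pmf.prob (neg_binomial_pmf n w) {v. v < n}) =
      (\<integral>\<^sup>+v. ennreal ((real n)\<^sup>2) * indicator {v. v < n} v \<partial>neg_binomial_pmf n w)"
      by (simp add: nn_integral_cmult ennreal_mult' measure_pmf.emeasure_eq_measure)
    also have "\<dots> \<le> (\<integral>\<^sup>+v. ennreal k * ennreal (exp (h * ?d \<epsilon> n v)) \<partial>neg_binomial_pmf n w)"
    proof (intro nn_integral_mono)
      fix v show "ennreal ((real n)\<^sup>2) * indicator {v. v < n} v \<le> ennreal k * ennreal (exp (h * ?d \<epsilon> n v))"
        using pt[of v] k by (cases "v < n") (simp_all add: ennreal_mult'[symmetric] ennreal_leI)
    qed
    also have "\<dots> \<le> ennreal k * 2"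
      by (subst nn_integral_cmult, simp, intro mult_left_mono le) simp
    also have "\<dots> = ennreal (k * 2)" using k by (simp add: ennreal_mult')
    finally show ?thesis using k by (subst (asm) ennreal_le_iff) auto
  qed
  then show ?thesis using that[of "k * 2"] k by simp
qed

text \<open>
  The absorption identity for binomial coefficients, which reduces higher moments to the mean.
\<close>

lemma nn_integral_neg_binomial_size_bias:
  assumes w: "0 < w" "w < 1"
  shows "(\<integral>\<^sup>+v. ennreal (real v) * f v \<partial>neg_binomial_pmf (Suc u) w) =
    ennreal (real (Suc u) * (1 - w) / w) * (\<integral>\<^sup>+v. f (Suc v) \<partial>neg_binomial_pmf (Suc (Suc u)) w)"
proof -
  let ?q = "\<lambda>n. pmf (neg_binomial_pmf n w)"
  let ?c = "real (Suc u) * (1 - w) / w"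
  have pmf: "real (Suc v) * ?q (Suc u) (Suc v) =
    ?c * ?q (Suc (Suc u)) v" for v
  proof -
    have "Suc v * ((u + Suc v) choose Suc v) = Suc u * ((Suc u + v) choose v)"
      using Suc_times_binomial_add[of v u] binomial_symmetric[of v "Suc u + v"] binomial_symmetric[of "Suc v" "u + Suc v"]
      by (simp add: add.commute)
    then have "real (Suc v) * real ((u + Suc v) choose Suc v) = real (Suc u) * real ((Suc u + v) choose v)"
      by (metis of_nat_mult)
    moreover have "b * c = d * e \<Longrightarrow> b * (c * w ^ (u + 1) * (1 - w) ^ Suc v) = d * (1 - w) / w * (e * w ^ (Suc u + 1) * (1 - w) ^ v)"
      for b c d e :: real
    proof -
      assume eq: "b * c = d * e"
      have "b * (c * w ^ (u + 1) * (1 - w) ^ Suc v) = (b * c) * (w ^ (u + 1) * (1 - w) ^ Suc v)" by (simp only: mult_ac)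
      also have "\<dots> = d * (1 - w) / w * (e * w ^ (Suc u + 1) * (1 - w) ^ v)"
        unfolding eq using w by (simp add: field_simps)
      finally show ?thesis .
    qed
    ultimately show ?thesis
      unfolding pmf_neg_binomial_Suc[OF w] right_weight_def by blast
  qed
  have "(\<integral>\<^sup>+v. ennreal (real v) * f v \<partial>neg_binomial_pmf (Suc u) w) =
    (\<integral>\<^sup>+v. ennreal (?q (Suc u) v) * (ennreal (real v) * f v) \<partial>count_space UNIV)"
    by (rule nn_integral_measure_pmf)
  also have "\<dots> = (\<integral>\<^sup>+v. ennreal (?q (Suc u) v) * (ennreal (real v) * f v) \<partial>count_space (range Suc))"
    by (rule nn_integral_count_space_eq) (auto simp: image_iff, metis not0_implies_Suc)
  also have "\<dots> = (\<integral>\<^sup>+v. ennreal (?q (Suc u) (Suc v)) * (ennreal (real (Suc v)) * f (Suc v)) \<partial>count_space UNIV)"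
    by (subst nn_integral_bij_count_space[symmetric, of Suc UNIV]) (auto simp: bij_betw_def)
  also have "\<dots> = (\<integral>\<^sup>+v. ennreal (?c) * (ennreal (?q (Suc (Suc u)) v) * f (Suc v)) \<partial>count_space UNIV)"
  proof (intro nn_integral_cong)
    fix v
    have "ennreal (?q (Suc u) (Suc v)) * ennreal (real (Suc v)) =
      ennreal (?c) * ennreal (?q (Suc (Suc u)) v)"
      using pmf[of v] w by (simp add: ennreal_mult''[symmetric] ennreal_mult'[symmetric] mult.commute del: of_nat_Suc)
    then show "ennreal (?q (Suc u) (Suc v)) * (ennreal (real (Suc v)) * f (Suc v)) =
      ennreal (?c) * (ennreal (?q (Suc (Suc u)) v) * f (Suc v))"
      by (simp only: mult.assoc[symmetric])
  qed
  also have "\<dots> = ennreal (?c) * (\<integral>\<^sup>+v. f (Suc v) \<partial>neg_binomial_pmf (Suc (Suc u)) w)"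
    by (simp add: nn_integral_cmult nn_integral_measure_pmf)
  finally show ?thesis .
qed

text \<open>
  The cross term of the square is moved to the other side, because integrals with values in
  \<open>[0, \<infinity>]\<close> do not admit subtraction.
\<close>

lemma neg_binomial_variance:
  assumes w: "0 < w" "w < 1"
  shows "(\<integral>\<^sup>+v. ennreal ((real v - (1 - w) / w * real (Suc u))\<^sup>2) \<partial>neg_binomial_pmf (Suc u) w) = ennreal (real (Suc u) * (1 - w) / w\<^sup>2)"
proof -
  define m where "m = (1 - w) / w * real (Suc u)"
  let ?N = "neg_binomial_pmf (Suc u) w"
  have m0: "0 \<le> m" using w by (simp add: m_def)
  have sq: "(\<integral>\<^sup>+v. ennreal ((real v)\<^sup>2) \<partial>?N) = ennreal (m * ((1 - w) / w * real (Suc (Suc u)) + 1))"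
  proof -
    have "(\<integral>\<^sup>+v. ennreal ((real v)\<^sup>2) \<partial>?N) = (\<integral>\<^sup>+v. ennreal (real v) * ennreal (real v) \<partial>?N)"
      by (simp add: ennreal_mult'[symmetric] power2_eq_square)
    also have "\<dots> = ennreal m * (\<integral>\<^sup>+v. ennreal (real v) + 1 \<partial>neg_binomial_pmf (Suc (Suc u)) w)"
      unfolding nn_integral_neg_binomial_size_bias[OF w] by (simp add: m_def mult.commute add.commute)
    also have "\<dots> = ennreal m * (ennreal (real (Suc (Suc u)) * (1 - w) / w) + 1)"
      by (simp add: nn_integral_add nn_integral_neg_binomial_real[OF w] measure_pmf.emeasure_space_1 del: of_nat_Suc)
    also have "\<dots> = ennreal (m * ((1 - w) / w * real (Suc (Suc u)) + 1))"
      using w m0 by (simp add: ennreal_mult' mult.commute del: of_nat_Suc)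
    finally show ?thesis .
  qed
  have "(\<integral>\<^sup>+v. ennreal ((real v - m)\<^sup>2) \<partial>?N) + ennreal (2 * m * m) =
     (\<integral>\<^sup>+v. ennreal ((real v - m)\<^sup>2) + ennreal (2 * m) * ennreal (real v) \<partial>?N)"
  proof -
    have "(\<integral>\<^sup>+v. ennreal (2 * m) * ennreal (real v) \<partial>?N) = ennreal (2 * m) * ennreal (real (Suc u) * (1 - w) / w)"
      by (subst nn_integral_cmult) (simp_all only: nn_integral_neg_binomial_real[OF w], simp_all)
    also have "real (Suc u) * (1 - w) / w = m" by (simp add: m_def)
    also have "ennreal (2 * m) * ennreal m = ennreal (2 * m * m)" using m0 by (simp add: ennreal_mult'[symmetric])
    finally show ?thesis by (subst nn_integral_add) simp_all
  qed
  also have "\<dots> = (\<integral>\<^sup>+v. ennreal ((real v)\<^sup>2) + ennreal (m\<^sup>2) \<partial>?N)"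
  proof (intro nn_integral_cong)
    fix v
    have "ennreal ((real v - m)\<^sup>2) + ennreal (2 * m) * ennreal (real v) = ennreal ((real v - m)\<^sup>2 + 2 * m * real v)"
      using m0 by (simp add: ennreal_mult')
    also have "(real v - m)\<^sup>2 + 2 * m * real v = (real v)\<^sup>2 + m\<^sup>2" by (simp add: power2_eq_square algebra_simps)
    finally show "ennreal ((real v - m)\<^sup>2) + ennreal (2 * m) * ennreal (real v) = ennreal ((real v)\<^sup>2) + ennreal (m\<^sup>2)"
      by simp
  qed
  also have "\<dots> = ennreal (m * ((1 - w) / w * real (Suc (Suc u)) + 1)) + ennreal (m\<^sup>2)"
    by (simp add: nn_integral_add sq measure_pmf.emeasure_space_1)
  also have "\<dots> = ennreal (m * ((1 - w) / w * real (Suc (Suc u)) + 1) + m\<^sup>2)"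
    using w m0 by (simp add: ennreal_plus)
  also have "m * ((1 - w) / w * real (Suc (Suc u)) + 1) + m\<^sup>2 = real (Suc u) * (1 - w) / w\<^sup>2 + 2 * m * m"
    using w by (simp add: m_def field_simps power2_eq_square)
  also have "ennreal \<dots> = ennreal (real (Suc u) * (1 - w) / w\<^sup>2) + ennreal (2 * m * m)"
    using w m0 by (simp add: ennreal_plus)
  finally show ?thesis unfolding m_def[symmetric] by (simp add: add.commute[of _ "ennreal (2 * m * m)"] ennreal_add_left_cancel)
qed

section \<open>The derivative of the log-likelihood\<close>

text \<open>
  The logarithmic derivative of \<open>a\<^sup>m (1 - a)\<^sup>v\<close> with respect to \<open>a\<close>.
\<close>

definition score :: "real \<Rightarrow> nat \<Rightarrow> nat \<Rightarrow> real" where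
  "score a m v = real m / a - real v / (1 - a)"

lemma power_times_power_deriv:
  assumes "0 < a" "a < (1::real)"
  shows "((\<lambda>b. b ^ m * (1 - b) ^ v) has_field_derivative a ^ m * (1 - a) ^ v * score a m v) (at a)"
proof -
  have "((\<lambda>b. b ^ m) has_field_derivative a ^ m * (real m / a)) (at a)"
  proof -
    have "real m * a ^ (m - Suc 0) = a ^ m * (real m / a)" using assms by (cases m) simp_all
    then show ?thesis using DERIV_pow[of m a UNIV] by simp
  qed
  moreover have "((\<lambda>b. (1 - b) ^ v) has_field_derivative - ((1 - a) ^ v * (real v / (1 - a)))) (at a)"
  proof -
    have "((\<lambda>b. 1 - b) has_field_derivative - 1) (at a)" by (auto intro!: derivative_eq_intros)
    moreover have "real v * (- 1 * (1 - a) ^ (v - Suc 0)) = - ((1 - a) ^ v * (real v / (1 - a)))"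
      using assms by (cases v) simp_all
    ultimately show ?thesis using DERIV_power[of "\<lambda>b. 1 - b" "- 1" a UNIV v] by simp
  qed
  ultimately show ?thesis
    using DERIV_mult[of "\<lambda>b. b ^ m" "a ^ m * (real m / a)" a UNIV "\<lambda>b. (1 - b) ^ v" "- ((1 - a) ^ v * (real v / (1 - a)))"]
    unfolding score_def by (simp add: algebra_simps)
qed

lemma phi'_eq:
  fixes p a :: real and u v :: nat
  assumes p: "0 < p" "p < 1" and a: "0 < a" "a < 1"
  defines "A \<equiv> a ^ (u + 1) * (1 - a) ^ v" and "B \<equiv> (1 - a) ^ (u + 1) * a ^ v"
  shows "phi' p a u v = (p * A * score a (u + 1) v + (1 - p) * B * score a v (u + 1)) / (p * A + (1 - p) * B)"
proof -
  have pos: "0 < p * A + (1 - p) * B"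
    using p a unfolding A_def B_def by (intro add_pos_pos mult_pos_pos) auto
  have D: "((\<lambda>b. p * (b ^ (u + 1) * (1 - b) ^ v) + (1 - p) * (b ^ v * (1 - b) ^ (u + 1))) has_field_derivative
     p * (A * score a (u + 1) v) + (1 - p) * (B * score a v (u + 1))) (at a)"
    unfolding A_def B_def mult.commute[of "(1 - a) ^ (u + 1)"]
    by (intro DERIV_add DERIV_cmult power_times_power_deriv a)
  moreover have "0 < p * (a ^ (u + 1) * (1 - a) ^ v) + (1 - p) * (a ^ v * (1 - a) ^ (u + 1))"
    using pos unfolding A_def B_def by (simp only: mult.commute[of "(1 - a) ^ (u + 1)"])
  ultimately have "((\<lambda>b. ln (p * (b ^ (u + 1) * (1 - b) ^ v) + (1 - p) * (b ^ v * (1 - b) ^ (u + 1)))) has_field_derivative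
     inverse (p * (a ^ (u + 1) * (1 - a) ^ v) + (1 - p) * (a ^ v * (1 - a) ^ (u + 1))) * (p * (A * score a (u + 1) v) + (1 - p) * (B * score a v (u + 1)))) (at a)"
    by (intro DERIV_chain2[OF DERIV_ln])
  moreover have "(\<lambda>b. phi p b u v) = (\<lambda>b. ln (p * (b ^ (u + 1) * (1 - b) ^ v) + (1 - p) * (b ^ v * (1 - b) ^ (u + 1))))"
    using p by (simp add: phi_eq fun_eq_iff mult_ac)
  ultimately show ?thesis
    unfolding phi'_def by (simp add: DERIV_imp_deriv A_def B_def mult_ac divide_inverse)
qed

text \<open>
  The derivative is the average of the scores of the two monomials, weighted by their shares in
  the mixture. For \<open>v = u + 1 + k\<close> the share of the second one is of order \<open>\<kappa>\<^sup>k\<close> with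
  \<open>\<kappa> = a / (1 - a) < 1\<close>, whereas the two scores differ by a multiple of \<open>k\<close>.
\<close>

lemma phi'_near_score:
  assumes p: "0 < p" "p < 1" and a: "0 < a" "a < 1 / 2"
  obtains C where "0 \<le> C" "\<And>u v. u + 1 \<le> v \<Longrightarrow> \<bar>phi' p a u v - score a (u + 1) v\<bar> \<le> C"
proof -
  define \<kappa> where "\<kappa> = a / (1 - a)"
  have \<kappa>: "0 < \<kappa>" "\<kappa> < 1" using a by (simp_all add: \<kappa>_def field_simps)
  have "(\<lambda>k. of_nat k * \<kappa> ^ k) \<longlonglongrightarrow> 0" using \<kappa> by (intro powser_times_n_limit_0) simp
  then have "Bseq (\<lambda>k. real k * \<kappa> ^ k)" by (intro convergent_imp_Bseq convergentI)
  then obtain K where K: "0 < K" "\<And>k. \<bar>real k * \<kappa> ^ k\<bar> \<le> K" by (auto simp: Bseq_def)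
  define C where "C = (1 - p) / p * (K / (a * (1 - a)))"
  have "\<bar>phi' p a u v - score a (u + 1) v\<bar> \<le> C" if uv: "u + 1 \<le> v" for u v
  proof -
    obtain k where k: "v = u + 1 + k" using uv le_Suc_ex by blast
    define A where "A = a ^ (u + 1) * (1 - a) ^ v"
    define B where "B = (1 - a) ^ (u + 1) * a ^ v"
    have A: "0 < A" and B: "0 < B" using a by (auto simp: A_def B_def)
    have BA: "B = A * \<kappa> ^ k"
      using a by (simp add: A_def B_def k \<kappa>_def power_add power_divide field_simps)
    have diff: "score a v (u + 1) - score a (u + 1) v = real k / (a * (1 - a))"
    proof -
      have "score a v (u + 1) - score a (u + 1) v = real k / a + real k / (1 - a)"
        by (simp add: score_def k add_divide_distrib)
      also have "\<dots> = (real k * (1 - a) + real k * a) / (a * (1 - a))" using a by (simp add: add_frac_eq)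
      also have "real k * (1 - a) + real k * a = real k" by (simp add: algebra_simps)
      finally show ?thesis .
    qed
    have pos: "0 < p * A + (1 - p) * B" using p A B by (intro add_pos_pos mult_pos_pos) auto
    have "phi' p a u v = (p * A * score a (u + 1) v + (1 - p) * B * score a v (u + 1)) / (p * A + (1 - p) * B)"
      using a unfolding A_def B_def by (intro phi'_eq p) auto
    then have "phi' p a u v - score a (u + 1) v = (1 - p) * B * (score a v (u + 1) - score a (u + 1) v) / (p * A + (1 - p) * B)"
      using pos by (simp add: divide_simps) (simp add: algebra_simps)
    also have "\<dots> = (1 - p) * B * (real k / (a * (1 - a))) / (p * A + (1 - p) * B)" by (simp only: diff)
    finally have eq: "phi' p a u v - score a (u + 1) v = (1 - p) * B * (real k / (a * (1 - a))) / (p * A + (1 - p) * B)" .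
    have num: "0 \<le> (1 - p) * B * (real k / (a * (1 - a)))" using p a B by simp
    have "\<bar>phi' p a u v - score a (u + 1) v\<bar> = (1 - p) * B * (real k / (a * (1 - a))) / (p * A + (1 - p) * B)"
      unfolding eq using num pos by (intro abs_of_nonneg divide_nonneg_pos)
    also have "\<dots> \<le> (1 - p) * B * (real k / (a * (1 - a))) / (p * A)"
      using num p A B by (intro divide_left_mono) (auto intro!: mult_pos_pos add_pos_pos)
    also have "\<dots> = (1 - p) / p * (real k * \<kappa> ^ k / (a * (1 - a)))" using A p by (simp add: BA mult_ac)
    also have "\<dots> \<le> C" unfolding C_def
      using K(2)[of k] p a by (intro mult_left_mono divide_right_mono) auto
    finally show ?thesis .
  qed
  moreover have "0 \<le> C" using K p a by (simp add: C_def)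
  ultimately show ?thesis using that by blast
qed

lemma nn_integral_visit_pmf_ge:
  assumes "0 \<le> p" "p \<le> 1"
  shows "ennreal p * (\<integral>\<^sup>+v. f v \<partial>neg_binomial_pmf (Suc u) a) \<le> (\<integral>\<^sup>+v. f v \<partial>visit_pmf p a u)"
  unfolding nn_integral_visit_pmf[OF assms] by simp

text \<open>
  Here \<open>a\<close> is the parameter of the environment. Only the component of the mixture with success
  probability \<open>a\<close> is kept; under it \<open>v < u + 1\<close> is so unlikely that even an error of order
  \<open>(u + 1)\<^sup>2\<close> on this event is harmless.
\<close>

lemma visit_pmf_growth_transfer:
  assumes p: "0 < p" "p < 1" and a: "0 < a" "a < 1 / 2" and c: "0 < c" and C: "0 \<le> C" "0 \<le> k"
    and low: "\<And>u. ennreal (c * real (Suc u)) \<le> (\<integral>\<^sup>+v. ennreal (D u v) \<partial>neg_binomial_pmf (Suc u) a)"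
    and pt: "\<And>u v. D u v \<le> k * f u v + C + C * ((real (Suc u))\<^sup>2 * indicator {v. v < Suc u} v)"
    and f: "\<And>u v. 0 \<le> f u v"
  obtains c' C' where "0 < c'" "0 \<le> C'"
    "\<And>u. ennreal (c' * real (Suc u)) \<le> (\<integral>\<^sup>+v. ennreal (f u v) \<partial>visit_pmf p a u) + ennreal C'"
proof -
  let ?R = "\<lambda>u v. ennreal C + ennreal C * (ennreal ((real (Suc u))\<^sup>2) * indicator {v. v < Suc u} v)"
  let ?V = "\<lambda>u. \<integral>\<^sup>+v. ennreal (f u v) \<partial>visit_pmf p a u"
  obtain T where T: "0 \<le> T" "\<And>n. (real n)\<^sup>2 * measure_pmf.prob (neg_binomial_pmf n a) {v. v < n} \<le> T"
    using prob_neg_binomial_lower_tail[OF a] by blast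
  \<comment> \<open>Strictly positive, so that the inequality can be divided by it.\<close>
  define k' where "k' = k + 1"
  have k': "0 < k'" using C by (simp add: k'_def)
  define c' where "c' = p * c / k'"
  define C' where "C' = p * (C + C * T) / k'"
  have "ennreal (c' * real (Suc u)) \<le> ?V u + ennreal C'" for u
  proof -
    let ?N = "neg_binomial_pmf (Suc u) a"
    let ?I = "\<integral>\<^sup>+v. ennreal (f u v) \<partial>?N"
    have "ennreal (c * real (Suc u)) \<le> (\<integral>\<^sup>+v. ennreal (D u v) \<partial>?N)" by (rule low)
    also have "\<dots> \<le> (\<integral>\<^sup>+v. ennreal k' * ennreal (f u v) + ?R u v \<partial>?N)"
    proof (intro nn_integral_mono)
      fix v
      have "k * f u v \<le> k' * f u v" using f[of u v] by (simp add: k'_def mult_right_mono)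
      then have "D u v \<le> k' * f u v + (C + C * ((real (Suc u))\<^sup>2 * indicator {v. v < Suc u} v))" using pt[of u v] by linarith
      then have "ennreal (D u v) \<le> ennreal (k' * f u v + (C + C * ((real (Suc u))\<^sup>2 * indicator {v. v < Suc u} v)))" by (rule ennreal_leI)
      also have "\<dots> = ennreal k' * ennreal (f u v) + ?R u v"
        using k' C f[of u v] by (cases "v < Suc u") (simp_all add: ennreal_mult'[symmetric] ennreal_plus[symmetric] del: ennreal_plus of_nat_Suc)
      finally show "ennreal (D u v) \<le> ennreal k' * ennreal (f u v) + ?R u v" .
    qed
    also have "\<dots> = ennreal k' * ?I + (ennreal C + ennreal C * (ennreal ((real (Suc u))\<^sup>2) * emeasure ?N {v. v < Suc u}))"
      by (simp add: nn_integral_add nn_integral_cmult measure_pmf.emeasure_space_1 del: of_nat_Suc)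
    also have "ennreal ((real (Suc u))\<^sup>2) * emeasure ?N {v. v < Suc u} \<le> ennreal T"
      using T(2)[of "Suc u"] by (simp add: measure_pmf.emeasure_eq_measure ennreal_mult'[symmetric] ennreal_leI del: of_nat_Suc)
    finally have "ennreal (c * real (Suc u)) \<le> ennreal k' * ?I + (ennreal C + ennreal C * ennreal T)"
      by (meson add_left_mono mult_left_mono order_trans zero_le)
    then have "ennreal (p / k') * ennreal (c * real (Suc u)) \<le> ennreal (p / k') * (ennreal k' * ?I + (ennreal C + ennreal C * ennreal T))"
      by (rule mult_left_mono) simp
    also have "\<dots> = ennreal p * ?I + ennreal C'"
    proof -
      have "ennreal (p / k') * (ennreal k' * ?I) = ennreal p * ?I"
        using p k' by (simp add: mult.assoc[symmetric] ennreal_mult'[symmetric])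
      moreover have "ennreal (p / k') * (ennreal C + ennreal C * ennreal T) = ennreal C'"
        using p k' C T by (simp add: C'_def ennreal_mult'[symmetric] ennreal_plus[symmetric] del: ennreal_plus)
      ultimately show ?thesis by (simp add: distrib_left)
    qed
    also have "\<dots> \<le> ?V u + ennreal C'"
      using p by (intro add_mono nn_integral_visit_pmf_ge) auto
    finally have "ennreal (p / k') * ennreal (c * real (Suc u)) \<le> ?V u + ennreal C'" .
    moreover have "ennreal (p / k') * ennreal (c * real (Suc u)) = ennreal (c' * real (Suc u))"
      using p k' by (subst ennreal_mult'[symmetric]) (simp_all add: c'_def mult_ac)
    ultimately show ?thesis by simp
  qed
  moreover have "0 < c'" "0 \<le> C'" using p k' c C T by (simp_all add: c'_def C'_def)
  ultimately show ?thesis using that by blast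
qed

lemma abs_score_le:
  assumes a: "0 < a" "a < 1 / 2" and v: "v < m"
  shows "\<bar>score a m v\<bar> \<le> real m / a"
proof -
  have "real v / (1 - a) \<le> real m / a" using v a by (intro frac_le) auto
  moreover have "0 \<le> real v / (1 - a)" using a by simp
  ultimately show ?thesis by (simp add: score_def)
qed

text \<open>
  Under the parameter \<open>a\<close> itself the score is centred with variance of order \<open>u + 1\<close>.
\<close>

lemma phi'_square_growth:
  assumes p: "0 < p" "p < 1" and a: "0 < a" "a < 1 / 2"
  obtains c C where "0 < c" "0 \<le> C"
    "\<And>u. ennreal (c * real (Suc u)) \<le> (\<integral>\<^sup>+v. ennreal ((phi' p a u v)\<^sup>2) \<partial>visit_pmf p a u) + ennreal C"
proof -
  obtain K where K: "0 \<le> K" "\<And>u v. u + 1 \<le> v \<Longrightarrow> \<bar>phi' p a u v - score a (u + 1) v\<bar> \<le> K"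
    using phi'_near_score[OF p a] by blast
  define C where "C = 2 * K\<^sup>2 + 1 / a\<^sup>2"
  have C: "0 \<le> C" by (simp add: C_def)
  have low: "ennreal (1 / (a\<^sup>2 * (1 - a)) * real (Suc u)) \<le> (\<integral>\<^sup>+v. ennreal ((score a (Suc u) v)\<^sup>2) \<partial>neg_binomial_pmf (Suc u) a)" for u
  proof -
    have sq: "(score a (Suc u) v)\<^sup>2 = 1 / (1 - a)\<^sup>2 * (real v - (1 - a) / a * real (Suc u))\<^sup>2" for v
    proof -
      have "score a (Suc u) v = - (1 / (1 - a)) * (real v - (1 - a) / a * real (Suc u))"
        using a by (simp add: score_def field_simps)
      then show ?thesis by (simp only: power_mult_distrib power2_minus power_one_over)
    qed
    have "(\<integral>\<^sup>+v. ennreal ((score a (Suc u) v)\<^sup>2) \<partial>neg_binomial_pmf (Suc u) a) = ennreal (1 / (1 - a)\<^sup>2) * ennreal (real (Suc u) * (1 - a) / a\<^sup>2)"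
      unfolding sq using a neg_binomial_variance[of a u]
      by (simp add: ennreal_mult' nn_integral_cmult del: of_nat_Suc times_divide_eq_left times_divide_eq_right)
    also have "\<dots> = ennreal (1 / (1 - a)\<^sup>2 * (real (Suc u) * (1 - a) / a\<^sup>2))" using a by (intro ennreal_mult'[symmetric]) simp
    also have "1 / (1 - a)\<^sup>2 * (real (Suc u) * (1 - a) / a\<^sup>2) = 1 / (a\<^sup>2 * (1 - a)) * real (Suc u)"
    proof -
      have "1 / d\<^sup>2 * (x * d / a\<^sup>2) = 1 / (a\<^sup>2 * d) * x" if "d \<noteq> 0" for d x
        using that a by (simp add: field_simps power2_eq_square)
      then show ?thesis using a by simp
    qed
    finally show ?thesis by simp
  qed
  have pt: "(score a (Suc u) v)\<^sup>2 \<le> 2 * (phi' p a u v)\<^sup>2 + C + C * ((real (Suc u))\<^sup>2 * indicator {v. v < Suc u} v)" for u v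
  proof (cases "v < Suc u")
    case True
    have "(score a (Suc u) v)\<^sup>2 \<le> (real (Suc u) / a)\<^sup>2"
      using abs_score_le[OF a True] a by (subst abs_le_square_iff[symmetric]) simp
    also have "\<dots> = 1 / a\<^sup>2 * (real (Suc u))\<^sup>2" by (simp add: power_divide)
    also have "\<dots> \<le> C * (real (Suc u))\<^sup>2" by (intro mult_right_mono) (auto simp: C_def)
    also have "\<dots> \<le> 2 * (phi' p a u v)\<^sup>2 + C + C * (real (Suc u))\<^sup>2" using C by simp
    finally show ?thesis using True by simp
  next
    case False
    have "(phi' p a u v - score a (Suc u) v)\<^sup>2 \<le> K\<^sup>2"
      using K(2)[of u v] K(1) False by (subst abs_le_square_iff[symmetric]) simp
    moreover have "(score a (Suc u) v)\<^sup>2 \<le> 2 * (phi' p a u v)\<^sup>2 + 2 * (phi' p a u v - score a (Suc u) v)\<^sup>2"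
    proof -
      have "0 \<le> (2 * phi' p a u v - score a (Suc u) v)\<^sup>2" by simp
      then show ?thesis by (simp add: power2_eq_square algebra_simps)
    qed
    moreover have "0 \<le> 1 / a\<^sup>2" by simp
    ultimately have "(score a (Suc u) v)\<^sup>2 \<le> 2 * (phi' p a u v)\<^sup>2 + C" unfolding C_def by linarith
    then show ?thesis using False by simp
  qed
  show ?thesis
    by (rule visit_pmf_growth_transfer[OF p a _ C _ low pt]) (use a that in auto)
qed

text \<open>
  Under a different parameter \<open>b\<close> the mean of the score is \<open>d (u + 1)\<close> with \<open>d \<noteq> 0\<close>.
\<close>

lemma abs_phi'_growth:
  assumes p: "0 < p" "p < 1" and a: "0 < a" "a < 1 / 2" and b: "0 < b" "b < 1 / 2" "a \<noteq> b"
  obtains c C where "0 < c" "0 \<le> C"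
    "\<And>u. ennreal (c * real (Suc u)) \<le> (\<integral>\<^sup>+v. ennreal \<bar>phi' p a u v\<bar> \<partial>visit_pmf p b u) + ennreal C"
proof -
  obtain K where K: "0 \<le> K" "\<And>u v. u + 1 \<le> v \<Longrightarrow> \<bar>phi' p a u v - score a (u + 1) v\<bar> \<le> K"
    using phi'_near_score[OF p a] by blast
  define C where "C = K + 1 / a"
  have C: "0 \<le> C" using K a by (simp add: C_def)
  define d where "d = 1 / a - (1 - b) / b / (1 - a)"
  have "d = (b - a) / (a * b * (1 - a))" using a b by (simp add: d_def field_simps)
  then have d: "0 < \<bar>d\<bar>" using a b by simp
  have low: "ennreal (\<bar>d\<bar> * real (Suc u)) \<le> (\<integral>\<^sup>+v. ennreal \<bar>score a (Suc u) v\<bar> \<partial>neg_binomial_pmf (Suc u) b)" for u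
  proof -
    let ?N = "neg_binomial_pmf (Suc u) b"
    have int: "integrable ?N real" using b by (intro integrable_neg_binomial_pmf_real) auto
    then have int': "integrable ?N (\<lambda>v. score a (Suc u) v)" unfolding score_def by simp
    have "(\<integral>v. score a (Suc u) v \<partial>?N) = real (Suc u) / a - (real (Suc u) * (1 - b) / b) / (1 - a)"
      unfolding score_def using int b expectation_neg_binomial_pmf[of b "Suc u"] by (simp del: of_nat_Suc)
    also have "\<dots> = d * real (Suc u)" by (simp add: d_def algebra_simps del: of_nat_Suc)
    finally have "\<bar>d\<bar> * real (Suc u) = \<bar>\<integral>v. score a (Suc u) v \<partial>?N\<bar>" by (simp add: abs_mult)
    also have "\<dots> \<le> (\<integral>v. \<bar>score a (Suc u) v\<bar> \<partial>?N)" by (rule integral_abs_bound)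
    finally have "ennreal (\<bar>d\<bar> * real (Suc u)) \<le> ennreal (\<integral>v. \<bar>score a (Suc u) v\<bar> \<partial>?N)" by (rule ennreal_leI)
    also have "\<dots> = (\<integral>\<^sup>+v. ennreal \<bar>score a (Suc u) v\<bar> \<partial>?N)"
      using int' by (intro nn_integral_eq_integral[symmetric]) auto
    finally show ?thesis .
  qed
  have pt: "\<bar>score a (Suc u) v\<bar> \<le> 1 * \<bar>phi' p a u v\<bar> + C + C * ((real (Suc u))\<^sup>2 * indicator {v. v < Suc u} v)" for u v
  proof (cases "v < Suc u")
    case True
    have "\<bar>score a (Suc u) v\<bar> \<le> 1 / a * real (Suc u)" using abs_score_le[OF a True] by (simp only: times_divide_eq_left mult_1_left)
    also have "\<dots> \<le> C * (real (Suc u))\<^sup>2"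
      using K a C by (intro mult_mono) (auto simp: C_def power2_eq_square)
    finally show ?thesis using True C by simp
  next
    case False
    have "0 \<le> 1 / a" using a by simp
    moreover have "\<bar>phi' p a u v - score a (Suc u) v\<bar> \<le> K" using K(2)[of u v] False by simp
    ultimately have "\<bar>score a (Suc u) v\<bar> \<le> \<bar>phi' p a u v\<bar> + C" unfolding C_def by linarith
    then show ?thesis using False by simp
  qed
  show ?thesis
    by (rule visit_pmf_growth_transfer[OF p b(1,2) d C _ low pt]) (use that in auto)
qed

section \<open>Infinite information\<close>

definition rho_series :: "(int \<Rightarrow> real) \<Rightarrow> ennreal" where
  "rho_series \<omega> = (\<Sum>k. ennreal (\<Prod>j\<in>{1..k}. rho \<omega> (int j)))"

lemma S_var_eq: "S_var \<omega> = enn2real (inverse (rho_series \<omega>))"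
  by (simp add: S_var_def rho_series_def)

lemma measurable_rho_series: "rho_series \<in> borel_measurable (PiM UNIV (\<lambda>_. borel))"
  unfolding rho_series_def rho_def by measurable

lemma measurable_S_var: "S_var \<in> borel_measurable (PiM UNIV (\<lambda>_. borel))"
  unfolding S_var_eq[abs_def] using measurable_rho_series by measurable

lemma one_le_rho_series: "1 \<le> rho_series \<omega>"
proof -
  have "(\<Sum>k<1. ennreal (\<Prod>j\<in>{1..k}. rho \<omega> (int j))) \<le> rho_series \<omega>"
    unfolding rho_series_def by (intro sum_le_suminf) auto
  then show ?thesis by simp
qed

lemma S_var_cases:
  "rho_series \<omega> = top \<and> S_var \<omega> = 0 \<or>
   rho_series \<omega> = ennreal (1 / S_var \<omega>) \<and> 0 < S_var \<omega> \<and> S_var \<omega> \<le> 1"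
proof (cases "rho_series \<omega>")
  case (real r)
  have "1 \<le> r" using one_le_rho_series[of \<omega>] real by (simp add: ennreal_le_1 flip: ennreal_1)
  then show ?thesis using real by (simp add: S_var_eq inverse_ennreal field_simps)
qed (simp add: S_var_eq)

lemma S_var_bounds: "0 \<le> S_var \<omega>" "S_var \<omega> \<le> 1"
  using S_var_cases[of \<omega>] by auto

lemma ennreal_pi_law:
  "ennreal (pi_law p a u) = (\<integral>\<^sup>+\<omega>. ennreal (S_var \<omega> * (1 - S_var \<omega>) ^ u) \<partial>env_law p a)"
proof -
  interpret prob_space "env_law p a" by (rule prob_space_env_law)
  have m: "(\<lambda>\<omega>. S_var \<omega> * (1 - S_var \<omega>) ^ u) \<in> borel_measurable (env_law p a)"
    using measurable_S_var by (simp add: measurable_cong_sets[OF sets_env_law refl])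
  have "integrable (env_law p a) (\<lambda>\<omega>. S_var \<omega> * (1 - S_var \<omega>) ^ u)"
    using m S_var_bounds
    by (intro integrable_const_bound[of _ 1]) (auto simp: abs_mult power_abs intro!: mult_le_one power_le_one)
  then show ?thesis
    unfolding pi_law_def using S_var_bounds by (intro nn_integral_eq_integral[symmetric]) auto
qed

text \<open>
  The series of the powers of order \<open>s\<close> has finite mean. Its terms eventually drop below \<open>1\<close>, and
  from then on they dominate the terms of the original series.
\<close>

lemma AE_rho_series_finite:
  assumes p: "0 < p" "p < 1 / 2" and a: "0 < a" "a < p"
  shows "AE \<omega> in env_law p a. rho_series \<omega> < top"
proof -
  let ?E = "env_law p a"
  obtain s \<kappa> where s: "0 < s" "s < 1" and \<kappa>: "0 \<le> \<kappa>" "\<kappa> < 1"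
    and mom: "\<And>J. finite J \<Longrightarrow> (\<integral>\<^sup>+\<omega>. (\<Prod>x\<in>J. ennreal (rho \<omega> x powr s)) \<partial>?E) = ennreal (\<kappa> ^ card J)"
    using rho_moment_less_1[OF p a] by blast
  let ?T = "\<lambda>\<omega> k. ennreal (\<Prod>j\<in>{1..k}. rho \<omega> (int j) powr s)"
  have inj: "inj_on int A" for A by (simp add: inj_on_def)
  have mom_k: "(\<integral>\<^sup>+\<omega>. ?T \<omega> k \<partial>?E) = ennreal (\<kappa> ^ k)" for k
  proof -
    have "(\<integral>\<^sup>+\<omega>. ?T \<omega> k \<partial>?E) = (\<integral>\<^sup>+\<omega>. (\<Prod>x\<in>int ` {1..k}. ennreal (rho \<omega> x powr s)) \<partial>?E)"
      by (simp add: prod_ennreal prod.reindex[OF inj])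
    then show ?thesis by (simp add: mom card_image[OF inj])
  qed
  have m: "(\<lambda>\<omega>. ?T \<omega> k) \<in> borel_measurable (?E)" for k
    unfolding rho_def measurable_cong_sets[OF sets_env_law refl] by measurable
  have "(\<integral>\<^sup>+\<omega>. (\<Sum>k. ?T \<omega> k) \<partial>?E) = (\<Sum>k. ennreal (\<kappa> ^ k))"
    by (subst nn_integral_suminf[OF m]) (simp only: mom_k)
  also have "\<dots> = ennreal (1 / (1 - \<kappa>))" using \<kappa> by (intro suminf_ennreal_eq geometric_sums) auto
  finally have "(\<integral>\<^sup>+\<omega>. (\<Sum>k. ?T \<omega> k) \<partial>?E) \<noteq> \<infinity>" by simp
  then have "AE \<omega> in ?E. (\<Sum>k. ?T \<omega> k) \<noteq> \<infinity>"
    by (intro nn_integral_PInf_AE borel_measurable_suminf_order m) auto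
  with AE_env_law[of a p] show ?thesis
  proof eventually_elim
    fix \<omega> :: "int \<Rightarrow> real"
    assume \<omega>: "\<forall>x. \<omega> x = a \<or> \<omega> x = 1 - a" and fin: "(\<Sum>k. ?T \<omega> k) \<noteq> \<infinity>"
    have \<rho>: "0 < rho \<omega> x" for x using spec[OF \<omega>, of x] a p by (auto simp: rho_def)
    let ?P = "\<lambda>k. \<Prod>j\<in>{1..k}. rho \<omega> (int j)"
    have P0: "0 \<le> ?P k" for k using \<rho> by (intro prod_nonneg) (auto simp: less_imp_le)
    have Ps: "(\<Prod>j\<in>{1..k}. rho \<omega> (int j) powr s) = ?P k powr s" for k
      by (rule prod_powr_distrib[symmetric])
    have sm: "summable (\<lambda>k. ?P k powr s)"
      using fin unfolding Ps by (intro summable_suminf_not_top) auto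
    then have "(\<lambda>k. ?P k powr s) \<longlonglongrightarrow> 0" by (rule summable_LIMSEQ_zero)
    then have ev: "\<forall>\<^sub>F k in sequentially. ?P k powr s < 1" by (rule order_tendstoD) simp
    have "summable ?P"
    proof (rule summable_comparison_test_ev[OF _ sm])
      show "\<forall>\<^sub>F k in sequentially. norm (?P k) \<le> ?P k powr s"
        using ev
      proof eventually_elim
        fix k assume k: "?P k powr s < 1"
        have "?P k \<le> 1"
        proof (rule ccontr)
          assume "\<not> ?P k \<le> 1"
          then have "1 \<le> ?P k powr s" using s by (intro ge_one_powr_ge_zero) auto
          then show False using k by simp
        qed
        then show "norm (?P k) \<le> ?P k powr s" using P0[of k] s by (simp add: le_powr_of_le_1)
      qed
    qed
    then have "rho_series \<omega> = ennreal (suminf ?P)"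
      unfolding rho_series_def using P0 by (intro suminf_ennreal2) auto
    then show "rho_series \<omega> < top" by simp
  qed
qed

lemma nn_integral_rho_series:
  assumes p: "0 < p" "p < 1 / 2" and a: "0 < a" "a < p"
  shows "(\<integral>\<^sup>+\<omega>. rho_series \<omega> \<partial>env_law p a) = \<infinity>"
proof -
  let ?P = "\<lambda>\<omega> k. ennreal (\<Prod>j\<in>{1..k}. rho \<omega> (int j))"
  let ?m = "\<integral>\<^sup>+w. ennreal ((1 - w) / w) \<partial>temkin p a"
  let ?E = "env_law p a"
  have inj: "inj_on int A" for A by (simp add: inj_on_def)
  have m: "(\<lambda>\<omega>. ?P \<omega> k) \<in> borel_measurable (?E)" for k
    unfolding rho_def measurable_cong_sets[OF sets_env_law refl] by measurable
  have "1 \<le> (\<integral>\<^sup>+\<omega>. ?P \<omega> k \<partial>?E)" for k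
  proof -
    have one: "?m \<ge> 1"
    proof -
      have "?m = ennreal p * ennreal ((1 - a) / a) + ennreal (1 - p) * ennreal ((1 - (1 - a)) / (1 - a))"
        using p by (subst nn_integral_temkin) auto
      also have "\<dots> = ennreal (p * ((1 - a) / a) + (1 - p) * (a / (1 - a)))"
        using p a by (simp add: ennreal_mult'[symmetric])
      also have "\<dots> \<ge> ennreal 1" using p a by (intro ennreal_leI mean_rho_ge_1) auto
      finally show ?thesis by simp
    qed
    have "1 \<le> (\<Prod>x\<in>int ` {1..k}. ?m)"
      using one by (intro prod_ge_1) simp
    also have "\<dots> = (\<integral>\<^sup>+\<omega>. (\<Prod>x\<in>int ` {1..k}. ennreal (rho \<omega> x)) \<partial>?E)"
      unfolding rho_def by (rule nn_integral_env_law_prod[symmetric]) auto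
    also have "\<dots> = (\<integral>\<^sup>+\<omega>. ?P \<omega> k \<partial>?E)"
    proof (rule nn_integral_cong_AE, rule eventually_mono[OF AE_env_law])
      fix \<omega> :: "int \<Rightarrow> real" assume \<omega>: "\<forall>x. \<omega> x = a \<or> \<omega> x = 1 - a"
      have "0 \<le> rho \<omega> x" for x using spec[OF \<omega>, of x] a p by (auto simp: rho_def)
      then show "(\<Prod>x\<in>int ` {1..k}. ennreal (rho \<omega> x)) = ?P \<omega> k"
        by (simp add: prod_ennreal prod.reindex[OF inj])
    qed
    finally show ?thesis .
  qed
  then have "(\<Sum>k. (1::ennreal)) \<le> (\<Sum>k. \<integral>\<^sup>+\<omega>. ?P \<omega> k \<partial>?E)"
    by (intro suminf_le) auto
  also have "\<dots> = (\<integral>\<^sup>+\<omega>. rho_series \<omega> \<partial>?E)"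
    unfolding rho_series_def by (rule nn_integral_suminf[symmetric, OF m])
  also have "(\<Sum>k. (1::ennreal)) = \<infinity>"
    using nn_integral_count_space_nat[of "\<lambda>_. 1"] by (simp add: emeasure_count_space)
  finally show ?thesis by (simp add: top_unique)
qed

text \<open>
  For fixed environment \<open>\<Sum>\<^sub>u (u + 1) S (1 - S)\<^sup>u = 1 / S\<close>, the mean of a geometric law. Finiteness of the
  series is needed here, because a divergent one would contribute \<open>0\<close> instead of \<open>\<infinity>\<close>.
\<close>

lemma sum_pi_law_linear:
  assumes p: "0 < p" "p < 1 / 2" and a: "0 < a" "a < p"
  shows "(\<Sum>u. ennreal (pi_law p a u) * ennreal (real (Suc u))) = \<infinity>"
proof -
  let ?G = "\<lambda>\<omega> u. S_var \<omega> * (1 - S_var \<omega>) ^ u"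
  let ?E = "env_law p a"
  have m: "(\<lambda>\<omega>. ennreal (real (Suc u) * (?G \<omega> u))) \<in> borel_measurable (?E)" for u
    using measurable_S_var by (simp add: measurable_cong_sets[OF sets_env_law refl])
  have m': "(\<lambda>\<omega>. ennreal (?G \<omega> u)) \<in> borel_measurable (?E)" for u
    using measurable_S_var by (simp add: measurable_cong_sets[OF sets_env_law refl])
  have "(\<integral>\<^sup>+\<omega>. rho_series \<omega> \<partial>?E) = (\<integral>\<^sup>+\<omega>. (\<Sum>u. ennreal (real (Suc u) * (?G \<omega> u))) \<partial>?E)"
  proof (rule nn_integral_cong_AE, rule eventually_mono[OF AE_rho_series_finite[OF p a]])
    fix \<omega> assume "rho_series \<omega> < top"
    then have S: "rho_series \<omega> = ennreal (1 / S_var \<omega>)" "0 < S_var \<omega>" "S_var \<omega> \<le> 1"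
      using S_var_cases[of \<omega>] by auto
    have "(\<lambda>u. S_var \<omega> * (of_nat (Suc u) * (1 - S_var \<omega>) ^ u)) sums (S_var \<omega> * (1 / (1 - (1 - S_var \<omega>))\<^sup>2))"
      using S by (intro sums_mult geometric_deriv_sums) simp
    then have "(\<lambda>u. real (Suc u) * (?G \<omega> u)) sums (1 / S_var \<omega>)"
      using S by (simp add: mult_ac power2_eq_square del: of_nat_Suc)
    then show "rho_series \<omega> = (\<Sum>u. ennreal (real (Suc u) * (?G \<omega> u)))"
      unfolding S(1) using S by (intro suminf_ennreal_eq[symmetric]) auto
  qed
  also have "\<dots> = (\<Sum>u. \<integral>\<^sup>+\<omega>. ennreal (real (Suc u) * (?G \<omega> u)) \<partial>?E)"
    by (rule nn_integral_suminf[OF m])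
  also have "\<dots> = (\<Sum>u. ennreal (pi_law p a u) * ennreal (real (Suc u)))"
    unfolding ennreal_pi_law
    by (intro suminf_cong) (simp add: ennreal_mult' nn_integral_cmult m' mult.commute del: of_nat_Suc)
  finally show ?thesis using nn_integral_rho_series[OF p a] by simp
qed

lemma sum_pi_law_le_1: "(\<Sum>u. ennreal (pi_law p a u)) \<le> 1"
proof -
  let ?G = "\<lambda>\<omega> u. S_var \<omega> * (1 - S_var \<omega>) ^ u"
  interpret prob_space "env_law p a" by (rule prob_space_env_law)
  have m: "(\<lambda>\<omega>. ennreal (?G \<omega> u)) \<in> borel_measurable (env_law p a)" for u
    using measurable_S_var by (simp add: measurable_cong_sets[OF sets_env_law refl])
  have "(\<Sum>u. ennreal (pi_law p a u)) = (\<integral>\<^sup>+\<omega>. (\<Sum>u. ennreal (?G \<omega> u)) \<partial>env_law p a)"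
    unfolding ennreal_pi_law by (rule nn_integral_suminf[symmetric, OF m])
  also have "\<dots> \<le> (\<integral>\<^sup>+\<omega>. 1 \<partial>env_law p a)"
  proof (intro nn_integral_mono)
    fix \<omega>
    show "(\<Sum>u. ennreal (?G \<omega> u)) \<le> 1"
    proof (cases "S_var \<omega> = 0")
      case False
      then have S: "0 < S_var \<omega>" "S_var \<omega> \<le> 1" using S_var_bounds[of \<omega>] by auto
      then have "(\<lambda>u. S_var \<omega> * (1 - S_var \<omega>) ^ u) sums (S_var \<omega> * (1 / (1 - (1 - S_var \<omega>))))"
        by (intro sums_mult geometric_sums) simp
      then have "(\<Sum>u. ennreal (?G \<omega> u)) = ennreal 1"
        using S by (intro suminf_ennreal_eq) auto
      then show ?thesis by simp
    qed simp
  qed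
  also have "\<dots> = 1" by (simp add: emeasure_space_1)
  finally show ?thesis .
qed

lemma suminf_suminf_le_infsum:
  fixes f :: "nat \<times> nat \<Rightarrow> ennreal"
  shows "(\<Sum>u. \<Sum>v. f (u, v)) \<le> infsum f UNIV"
proof (rule suminf_le_const)
  fix N
  have "(\<Sum>u<N. \<Sum>v. f (u, v)) = (\<Sum>v. \<Sum>u<N. f (u, v))" by (rule suminf_sum[symmetric]) auto
  also have "\<dots> \<le> infsum f UNIV"
  proof (rule suminf_le_const)
    fix M
    have "(\<Sum>v<M. \<Sum>u<N. f (u, v)) = sum f ({..<N} \<times> {..<M})"
      by (subst sum.swap) (simp add: sum.cartesian_product)
    also have "\<dots> \<le> infsum f UNIV" by (subst nonneg_infsum_complete) (auto intro!: SUP_upper)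
    finally show "(\<Sum>v<M. \<Sum>u<N. f (u, v)) \<le> infsum f UNIV" .
  qed simp
  finally show "(\<Sum>u<N. \<Sum>v. f (u, v)) \<le> infsum f UNIV" .
qed simp

text \<open>
  The error \<open>C\<close> contributes at most \<open>C\<close> in total, as \<open>\<pi>\<close> has mass at most \<open>1\<close>.
\<close>

lemma pi_tilde_sum_infinite:
  assumes p: "0 < p" "p < 1 / 2" and a: "0 < a" "a < p" and c: "0 < c" "0 \<le> C"
    and f: "\<And>u v. 0 \<le> f u v"
    and growth: "\<And>u. ennreal (c * real (Suc u)) \<le> (\<integral>\<^sup>+v. ennreal (f u v) \<partial>visit_pmf p a u) + ennreal C"
  shows "(\<Sum>\<^sub>\<infinity>(u, v)\<in>UNIV. ennreal (pi_tilde p a u v * f u v)) = \<infinity>"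
proof -
  have pi0: "0 \<le> pi_law p a u" for u
    unfolding pi_law_def using S_var_bounds by (intro Bochner_Integration.integral_nonneg) simp
  define F where "F u = (\<integral>\<^sup>+v. ennreal (f u v) \<partial>visit_pmf p a u)" for u
  have inner: "(\<Sum>v. ennreal (pi_tilde p a u v * f u v)) = ennreal (pi_law p a u) * F u" for u
  proof -
    have "F u = (\<Sum>v. ennreal (pmf (visit_pmf p a u) v) * ennreal (f u v))"
      unfolding F_def by (simp add: nn_integral_measure_pmf nn_integral_count_space_nat)
    also have "\<dots> = (\<Sum>v. ennreal (Q_kernel p a u v) * ennreal (f u v))"
      using p a by (simp add: pmf_visit_pmf)
    finally have "ennreal (pi_law p a u) * F u = (\<Sum>v. ennreal (pi_law p a u) * (ennreal (Q_kernel p a u v) * ennreal (f u v)))"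
      by simp
    also have "\<dots> = (\<Sum>v. ennreal (pi_tilde p a u v * f u v))"
      by (intro suminf_cong) (simp add: pi_tilde_def ennreal_mult'' f ennreal_mult' pi0 Q_kernel_def mult.assoc)
    finally show ?thesis ..
  qed
  have "ennreal c * \<infinity> = ennreal c * (\<Sum>u. ennreal (pi_law p a u) * ennreal (real (Suc u)))"
    by (simp only: sum_pi_law_linear[OF p a])
  also have "\<dots> = (\<Sum>u. ennreal (pi_law p a u) * ennreal (c * real (Suc u)))"
    using c by (simp add: ennreal_mult' mult_ac flip: ennreal_suminf_cmult del: of_nat_Suc)
  also have "\<dots> \<le> (\<Sum>u. ennreal (pi_law p a u) * (F u + ennreal C))"
    using growth unfolding F_def[symmetric] by (intro suminf_le mult_left_mono) auto
  also have "\<dots> = (\<Sum>u. ennreal (pi_law p a u) * F u) + ennreal C * (\<Sum>u. ennreal (pi_law p a u))"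
    by (simp add: distrib_left suminf_add[symmetric] ennreal_suminf_cmult[symmetric] mult.commute del: ennreal_suminf_cmult)
  also have "\<dots> \<le> (\<Sum>u. ennreal (pi_law p a u) * F u) + ennreal C * 1"
    by (intro add_mono mult_left_mono sum_pi_law_le_1) auto
  finally have "(\<Sum>u. ennreal (pi_law p a u) * F u) = \<infinity>"
    using c by (auto simp: ennreal_mult_top top_unique)
  then have "(\<Sum>u. \<Sum>v. ennreal (pi_tilde p a u v * f u v)) = \<infinity>" by (simp only: inner)
  then show ?thesis
    using suminf_suminf_le_infsum[of "\<lambda>(u, v). ennreal (pi_tilde p a u v * f u v)"] by (simp add: top_unique)
qed

section \<open>Upper bounds for the log-likelihood ratio\<close>

lemma d_KL_pos:
  assumes "0 < s" "s < 1" "0 < a" "a < 1" "a \<noteq> s"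
  shows "0 < d_KL s a"
proof -
  have ln_less: "ln x < x - 1" if "0 < x" "x \<noteq> 1" for x :: real
    using ln_le_minus_one[OF that(1)] ln_eq_minus_one[OF that(1)] that(2) by fastforce
  have "s * ln (a / s) < s * (a / s - 1)"
    using assms by (intro mult_strict_left_mono ln_less) (auto simp: field_simps)
  moreover have "(1 - s) * ln ((1 - a) / (1 - s)) < (1 - s) * ((1 - a) / (1 - s) - 1)"
    using assms by (intro mult_strict_left_mono ln_less) (auto simp: field_simps)
  moreover have "s * (a / s - 1) = a - s" "(1 - s) * ((1 - a) / (1 - s) - 1) = s - a"
  proof -
    have "(1 - s) * ((1 - a) / (1 - s)) = 1 - a" "s * (a / s) = a" using assms by simp_all
    then show "s * (a / s - 1) = a - s" "(1 - s) * ((1 - a) / (1 - s) - 1) = s - a"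
      by (simp_all only: right_diff_distrib mult_1_right)
  qed
  moreover have "d_KL s a = - (s * ln (a / s) + (1 - s) * ln ((1 - a) / (1 - s)))"
    using assms by (simp add: d_KL_def ln_div algebra_simps)
  ultimately show ?thesis by linarith
qed

text \<open>
  Compactness turns the positivity of the divergence into a quantitative bound.
\<close>

lemma d_KL_separates:
  assumes T: "compact \<Theta>" "\<Theta> \<subseteq> {0<..<1}" and s: "0 < s" "s < 1" and \<epsilon>: "0 < \<epsilon>"
  obtains \<alpha> where "0 < \<alpha>" "\<And>a. a \<in> \<Theta> \<Longrightarrow> d_KL s a \<le> \<alpha> \<Longrightarrow> \<bar>a - s\<bar> \<le> \<epsilon>"
proof (cases "\<Theta> \<inter> {a. \<epsilon> \<le> \<bar>a - s\<bar>} = {}")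
  case True
  then show ?thesis using that[of 1] by force
next
  case False
  have "closed {a. \<epsilon> \<le> \<bar>a - s\<bar>}" by (intro closed_Collect_le continuous_intros)
  then have "compact (\<Theta> \<inter> {a. \<epsilon> \<le> \<bar>a - s\<bar>})" using T(1) by (intro compact_Int_closed)
  moreover have "continuous_on (\<Theta> \<inter> {a. \<epsilon> \<le> \<bar>a - s\<bar>}) (d_KL s)"
    unfolding d_KL_def using T(2) s by (intro continuous_intros) fastforce+
  ultimately obtain a1 where a1: "a1 \<in> \<Theta> \<inter> {a. \<epsilon> \<le> \<bar>a - s\<bar>}"
    and min: "\<And>a. a \<in> \<Theta> \<inter> {a. \<epsilon> \<le> \<bar>a - s\<bar>} \<Longrightarrow> d_KL s a1 \<le> d_KL s a"
    using continuous_attains_inf[of "\<Theta> \<inter> {a. \<epsilon> \<le> \<bar>a - s\<bar>}" "d_KL s"] False by metis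
  have pos: "0 < d_KL s a1" using a1 T(2) s \<epsilon> by (intro d_KL_pos) auto
  show ?thesis
  proof (rule that[of "d_KL s a1 / 2"])
    fix a assume "a \<in> \<Theta>" "d_KL s a \<le> d_KL s a1 / 2"
    then show "\<bar>a - s\<bar> \<le> \<epsilon>" using min[of a] pos by force
  qed (use pos in simp)
qed

text \<open>
  For \<open>s < 1/2\<close>, the deviation of the smaller of \<open>m\<close> and \<open>n\<close> from the fraction \<open>s\<close> of their sum. The
  minimum over both candidates keeps the definition symmetric.
\<close>

definition freq_dev :: "real \<Rightarrow> nat \<Rightarrow> nat \<Rightarrow> real" where
  "freq_dev s m n = min \<bar>real m - s * (real m + real n)\<bar> \<bar>real n - s * (real m + real n)\<bar>"

lemma freq_dev_commute: "freq_dev s m n = freq_dev s n m"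
  by (simp add: freq_dev_def add.commute min.commute)

text \<open>
  With \<open>x\<close> and \<open>y\<close> the two logarithms and \<open>N = m + n\<close>, the left side equals
  \<open>N (s x + (1 - s) y) + (m - s N) (x - y)\<close>.
\<close>

lemma log_ratio_le:
  assumes s: "0 < s" "s < 1 / 2" and a: "0 < a" "a < 1 / 2" and mn: "m \<le> n"
  shows "real m * ln (a / s) + real n * ln ((1 - a) / (1 - s)) \<le>
    - (real m + real n) * d_KL s a + \<bar>ln (a / s) - ln ((1 - a) / (1 - s))\<bar> * freq_dev s m n"
proof -
  define x y N where "x = ln (a / s)" and "y = ln ((1 - a) / (1 - s))" and "N = real m + real n"
  have d: "d_KL s a = - (s * x + (1 - s) * y)"
    using s a by (simp add: d_KL_def x_def y_def ln_div algebra_simps)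
  have "2 * (s * N) \<le> N" "0 \<le> s * N" using s mult_right_mono[of "2 * s" 1 N] by (simp_all add: N_def)
  then have dev: "\<bar>real m - s * N\<bar> = freq_dev s m n"
    using mn unfolding freq_dev_def N_def[symmetric] by (simp add: N_def min_def abs_if)
  have "real m * x + real n * y = - N * d_KL s a + (real m - s * N) * (x - y)"
    by (simp add: d N_def algebra_simps)
  also have "(real m - s * N) * (x - y) \<le> \<bar>(real m - s * N) * (x - y)\<bar>" by simp
  also have "\<dots> = \<bar>real m - s * N\<bar> * \<bar>x - y\<bar>" by (rule abs_mult)
  also have "\<dots> = \<bar>x - y\<bar> * freq_dev s m n" by (subst dev) (rule mult.commute)
  finally show ?thesis unfolding x_def y_def N_def by simp
qed

lemma power_mix_le:
  fixes a :: real
  assumes a: "0 < a" "a < 1 / 2" and mn: "m \<le> n"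
  shows "(1 - a) ^ m * a ^ n \<le> a ^ m * (1 - a) ^ n"
proof -
  obtain k where k: "n = m + k" using mn le_Suc_ex by blast
  have "a ^ k \<le> (1 - a) ^ k" using a by (intro power_mono) auto
  then have "(1 - a) ^ m * a ^ m * a ^ k \<le> (1 - a) ^ m * a ^ m * (1 - a) ^ k"
    using a by (intro mult_left_mono) auto
  then show ?thesis by (simp add: k power_add mult_ac)
qed

text \<open>
  The numerator is bounded by its larger monomial, the denominator from below by keeping only the
  corresponding monomial, with coefficient at least \<open>p\<close>.
\<close>

lemma ln_mix_diff_le:
  assumes q: "0 < q" "q < 1" "p \<le> q" and p: "0 < p" and s: "0 < s" "s < 1 / 2" and a: "0 < a" "a < 1 / 2" and mn: "m \<le> n"
  shows "ln (q * (a ^ m * (1 - a) ^ n) + (1 - q) * ((1 - a) ^ m * a ^ n)) - ln (q * (s ^ m * (1 - s) ^ n) + (1 - q) * ((1 - s) ^ m * s ^ n))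
    \<le> ln (1 / p) + (real m * ln (a / s) + real n * ln ((1 - a) / (1 - s)))"
proof -
  have pos: "0 < b ^ m * (1 - b) ^ n" "0 < (1 - b) ^ m * b ^ n" if "0 < b" "b < 1 / 2" for b :: real
    using that by simp_all
  have "q * (a ^ m * (1 - a) ^ n) + (1 - q) * ((1 - a) ^ m * a ^ n) \<le> q * (a ^ m * (1 - a) ^ n) + (1 - q) * (a ^ m * (1 - a) ^ n)"
    using q by (intro add_mono mult_left_mono power_mix_le a mn) (use a in auto)
  also have "\<dots> = a ^ m * (1 - a) ^ n" by (simp add: algebra_simps)
  finally have "ln (q * (a ^ m * (1 - a) ^ n) + (1 - q) * ((1 - a) ^ m * a ^ n)) \<le> ln (a ^ m * (1 - a) ^ n)"
    using q pos[OF a] by (subst ln_le_cancel_iff) (auto intro!: add_pos_pos mult_pos_pos)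
  moreover have "ln (p * (s ^ m * (1 - s) ^ n)) \<le> ln (q * (s ^ m * (1 - s) ^ n) + (1 - q) * ((1 - s) ^ m * s ^ n))"
  proof (subst ln_le_cancel_iff)
    have "p * (s ^ m * (1 - s) ^ n) \<le> q * (s ^ m * (1 - s) ^ n)" using q pos[OF s] by (intro mult_right_mono) auto
    also have "\<dots> \<le> q * (s ^ m * (1 - s) ^ n) + (1 - q) * ((1 - s) ^ m * s ^ n)"
      using mult_pos_pos[of "1 - q" "(1 - s) ^ m * s ^ n"] q pos[OF s] by simp
    finally show "p * (s ^ m * (1 - s) ^ n) \<le> q * (s ^ m * (1 - s) ^ n) + (1 - q) * ((1 - s) ^ m * s ^ n)" .
  qed (use p q pos[OF s] in \<open>auto intro!: add_pos_pos mult_pos_pos\<close>)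
  moreover have "ln (b ^ m * (1 - b) ^ n) = real m * ln b + real n * ln (1 - b)" if "0 < b" "b < 1 / 2" for b :: real
    using that by (simp add: ln_mult ln_realpow)
  moreover have "ln (p * (s ^ m * (1 - s) ^ n)) = ln p + ln (s ^ m * (1 - s) ^ n)"
    using p pos[OF s] by (intro ln_mult_pos)
  moreover have "real m * ln (a / s) + real n * ln ((1 - a) / (1 - s)) =
    (real m * ln a + real n * ln (1 - a)) - (real m * ln s + real n * ln (1 - s))"
    using s a by (simp add: ln_div algebra_simps)
  moreover have "ln (1 / p) = - ln p" using p by (simp add: ln_div)
  ultimately show ?thesis using s a by simp
qed

text \<open>
  Which of the two monomials dominates depends on the order of \<open>u + 1\<close> and \<open>v\<close>; the second case is
  the first with the two exponents and the weights \<open>p\<close>, \<open>1 - p\<close> exchanged.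
\<close>

lemma phi_diff_le:
  assumes p: "0 < p" "p < 1 / 2" and s: "0 < s" "s < 1 / 2" and a: "0 < a" "a < 1 / 2"
  shows "phi p a u v - phi p s u v \<le> ln (1 / p) - (real (Suc u) + real v) * d_KL s a
    + \<bar>ln (a / s) - ln ((1 - a) / (1 - s))\<bar> * freq_dev s (Suc u) v"
proof (cases "Suc u \<le> v")
  case True
  have "phi p a u v - phi p s u v \<le> ln (1 / p) + (real (Suc u) * ln (a / s) + real v * ln ((1 - a) / (1 - s)))"
    using ln_mix_diff_le[of p p s a "Suc u" v] True p s a by (simp add: phi_eq mult_ac)
  with log_ratio_le[OF s a True] show ?thesis by (simp add: algebra_simps)
next
  case False
  have "phi p a u v - phi p s u v \<le> ln (1 / p) + (real v * ln (a / s) + real (Suc u) * ln ((1 - a) / (1 - s)))"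
    using ln_mix_diff_le[of "1 - p" p s a v "Suc u"] False p s a by (simp add: phi_eq mult_ac add.commute)
  with log_ratio_le[OF s a, of v "Suc u"] False show ?thesis by (simp add: freq_dev_commute[of s v] algebra_simps)
qed

text \<open>
  What remains of the fluctuation term \<open>C \<bar>m - s N\<bar>\<close> after subtraction of \<open>\<beta> N\<close>. Wherever it is
  integrated below, \<open>ennreal\<close> replaces it by its positive part.
\<close>

definition dev_excess :: "real \<Rightarrow> real \<Rightarrow> real \<Rightarrow> nat \<Rightarrow> nat \<Rightarrow> real" where
  "dev_excess C \<beta> s u v = C * freq_dev s (Suc u) v - \<beta> * (real (Suc u) + real v)"

text \<open>
  In an environment with \<open>w = s\<close> the fraction of right steps should be \<open>s\<close>, and with \<open>w = 1 - s\<close>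
  that of left steps. Either way one of the two terms in \<open>freq_dev\<close> is \<open>w\<close> times the deviation of
  the negative binomial variable from its mean.
\<close>

lemma freq_dev_le_deviation:
  assumes w: "0 < w" "w < 1" and ws: "w = s \<or> w = 1 - s"
  shows "freq_dev s n v \<le> \<bar>real v - (1 - w) / w * real n\<bar>"
proof -
  have "freq_dev s n v \<le> \<bar>w * real v - (1 - w) * real n\<bar>"
    using ws
  proof
    assume "w = s"
    then have "\<bar>w * real v - (1 - w) * real n\<bar> = \<bar>real n - s * (real n + real v)\<bar>"
      by (subst abs_minus_commute) (simp add: algebra_simps)
    then show ?thesis by (simp add: freq_dev_def)
  next
    assume w1: "w = 1 - s"
    have "\<bar>w * real v - (1 - w) * real n\<bar> = \<bar>real v - s * (real n + real v)\<bar>"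
      unfolding w1 by (simp add: algebra_simps)
    then show ?thesis by (simp add: freq_dev_def)
  qed
  also have "w * real v - (1 - w) * real n = w * (real v - (1 - w) / w * real n)"
    using w by (simp add: right_diff_distrib)
  also have "\<bar>\<dots>\<bar> = w * \<bar>real v - (1 - w) / w * real n\<bar>" using w by (simp only: abs_mult abs_of_pos)
  also have "\<dots> \<le> 1 * \<bar>real v - (1 - w) / w * real n\<bar>" using w by (intro mult_right_mono) auto
  finally show ?thesis by simp
qed

lemma dev_excess_neg_binomial_le:
  assumes w: "0 < w" "w < 1" and ws: "w = s \<or> w = 1 - s" and C: "0 < C" and \<beta>: "0 < \<beta>"
  obtains T where "0 \<le> T"
    "\<And>u. (\<integral>\<^sup>+v. ennreal (dev_excess C \<beta> s u v) \<partial>neg_binomial_pmf (Suc u) w) \<le> ennreal T"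
proof -
  let ?e = "\<lambda>n v. \<bar>real v - (1 - w) / w * real n\<bar> - \<beta> / C * real n"
  obtain T where T: "0 \<le> T" "\<And>n. (\<integral>\<^sup>+v. ennreal (?e n v) \<partial>neg_binomial_pmf n w) \<le> ennreal T"
    using nn_integral_neg_binomial_excess_le[OF w, of "\<beta> / C"] C \<beta> by auto
  have "(\<integral>\<^sup>+v. ennreal (dev_excess C \<beta> s u v) \<partial>neg_binomial_pmf (Suc u) w) \<le> ennreal (C * T)" for u
  proof -
    have "(\<integral>\<^sup>+v. ennreal (dev_excess C \<beta> s u v) \<partial>neg_binomial_pmf (Suc u) w) \<le>
      (\<integral>\<^sup>+v. ennreal C * ennreal (?e (Suc u) v) \<partial>neg_binomial_pmf (Suc u) w)"
    proof (intro nn_integral_mono)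
      fix v
      have "dev_excess C \<beta> s u v \<le> C * \<bar>real v - (1 - w) / w * real (Suc u)\<bar> - \<beta> * real (Suc u)"
        unfolding dev_excess_def using C \<beta> by (intro diff_mono mult_left_mono freq_dev_le_deviation[OF w ws]) auto
      also have "\<dots> = C * ?e (Suc u) v" using C by (simp add: right_diff_distrib)
      finally have "ennreal (dev_excess C \<beta> s u v) \<le> ennreal (C * ?e (Suc u) v)" by (rule ennreal_leI)
      also have "\<dots> = ennreal C * ennreal (?e (Suc u) v)" using C by (intro ennreal_mult') simp
      finally show "ennreal (dev_excess C \<beta> s u v) \<le> ennreal C * ennreal (?e (Suc u) v)" .
    qed
    also have "\<dots> = ennreal C * (\<integral>\<^sup>+v. ennreal (?e (Suc u) v) \<partial>neg_binomial_pmf (Suc u) w)"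
      by (rule nn_integral_cmult) simp
    also have "\<dots> \<le> ennreal C * ennreal T" by (intro mult_left_mono T(2)) simp
    also have "\<dots> = ennreal (C * T)" using C by (simp add: ennreal_mult')
    finally show ?thesis .
  qed
  then show ?thesis using that[of "C * T"] C T(1) by simp
qed

lemma dev_excess_visit_pmf_le:
  assumes p: "0 < p" "p < 1" and s: "0 < s" "s < 1" and C: "0 < C" and \<beta>: "0 < \<beta>"
  obtains T where "0 \<le> T" "\<And>u. (\<integral>\<^sup>+v. ennreal (dev_excess C \<beta> s u v) \<partial>visit_pmf p s u) \<le> ennreal T"
proof -
  obtain T1 where T1: "0 \<le> T1"
    "\<And>u. (\<integral>\<^sup>+v. ennreal (dev_excess C \<beta> s u v) \<partial>neg_binomial_pmf (Suc u) s) \<le> ennreal T1"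
    using dev_excess_neg_binomial_le[of s s C \<beta>] s C \<beta> by auto
  obtain T2 where T2: "0 \<le> T2"
    "\<And>u. (\<integral>\<^sup>+v. ennreal (dev_excess C \<beta> s u v) \<partial>neg_binomial_pmf (Suc u) (1 - s)) \<le> ennreal T2"
    using dev_excess_neg_binomial_le[of "1 - s" s C \<beta>] s C \<beta> by auto
  have "(\<integral>\<^sup>+v. ennreal (dev_excess C \<beta> s u v) \<partial>visit_pmf p s u) \<le> ennreal (p * T1 + (1 - p) * T2)" for u
  proof -
    have "(\<integral>\<^sup>+v. ennreal (dev_excess C \<beta> s u v) \<partial>visit_pmf p s u) \<le> ennreal p * ennreal T1 + ennreal (1 - p) * ennreal T2"
      using p by (subst nn_integral_visit_pmf) (auto intro!: add_mono mult_left_mono T1(2) T2(2))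
    also have "\<dots> = ennreal (p * T1 + (1 - p) * T2)"
      using p T1(1) T2(1) by (simp add: ennreal_mult')
    finally show ?thesis .
  qed
  then show ?thesis using that[of "p * T1 + (1 - p) * T2"] p T1(1) T2(1) by simp
qed

section \<open>Consistency\<close>

text \<open>
  The lists of \<open>left_profile\<close> run from right to left; the default \<open>0\<close> is the value at \<open>n\<close> itself.
\<close>

definition profile_at :: "nat list \<Rightarrow> nat \<Rightarrow> nat" where
  "profile_at ls x = (if x < length ls then ls ! (length ls - 1 - x) else 0)"

lemma length_left_profile: "length (left_profile n X) = n"
  by (simp add: left_profile_def)

lemma left_steps_eq_profile_at: "x \<le> n \<Longrightarrow> left_steps x n X = profile_at (left_profile n X) x"
  by (cases "x = n") (simp_all add: profile_at_def left_steps_target left_profile_def rev_nth)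

lemma map_profile_at: "length ls = n \<Longrightarrow> map (profile_at ls) (rev [0..<n]) = ls"
  by (auto simp: profile_at_def list_eq_iff_nth_eq rev_nth)

lemma sum_profile_at: "length ls = n \<Longrightarrow> (\<Sum>x<n. profile_at ls x) = sum_list ls"
proof -
  assume n: "length ls = n"
  have "(\<Sum>x<n. profile_at ls x) = sum_list (map (profile_at ls) (rev [0..<n]))"
    by (simp add: sum_list_distinct_conv_sum_set atLeast0LessThan)
  then show ?thesis by (simp add: map_profile_at n)
qed

lemma pair_sum_profile_at: "length ls = n \<Longrightarrow> pair_sum g 0 ls = (\<Sum>x<n. g (profile_at ls (Suc x)) (profile_at ls x))"
  using pair_sum_profile[of g "profile_at ls" n] by (simp add: map_profile_at) (simp add: profile_at_def)

lemma sets_left_profile_event: "{X. left_profile n X \<in> E} \<in> sets (annealed p a)"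
proof -
  have "left_profile n -` E \<inter> space path_space \<in> sets path_space"
    by (rule measurable_sets[OF measurable_left_profile]) simp
  then show ?thesis by (simp add: sets_annealed vimage_def space_PiM)
qed

lemma measure_annealed_left_profile_le:
  assumes "0 < p" "p < 1 / 2" "0 < a" "a < p"
  shows "measure (annealed p a) {X. left_profile n X \<in> E} \<le> measure_pmf.prob (chain_pmf p a n 0) E"
proof -
  interpret A: prob_space "annealed p a" by (rule prob_space_annealed)
  show ?thesis
    using emeasure_annealed_left_profile_le[OF assms, of n E]
    by (simp add: A.emeasure_eq_measure measure_pmf.emeasure_eq_measure)
qed

definition sup_ratio :: "real set \<Rightarrow> real \<Rightarrow> real \<Rightarrow> nat \<Rightarrow> nat \<Rightarrow> ereal" where
  "sup_ratio V p s u v = (SUP a\<in>V. ereal (phi p a u v - phi p s u v))"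

text \<open>
  Half of the drift \<open>- 2 \<beta> N\<close> absorbs the fluctuations, the other half is kept as \<open>- \<beta> v\<close>.
\<close>

lemma sup_ratio_le:
  assumes p: "0 < p" "p < 1 / 2" and T: "compact \<Theta>" "\<Theta> \<subseteq> {0<..<p}" and s: "s \<in> \<Theta>" and \<beta>: "0 < \<beta>"
  obtains C where "0 < C"
    "\<And>u v. sup_ratio (\<Theta> - KL_nbhd \<Theta> s (2 * \<beta>)) p s u v \<le> ereal (ln (1 / p) - \<beta> * real v + max 0 (dev_excess C \<beta> s u v))"
proof -
  have s01: "0 < s" "s < 1 / 2" using s T(2) p by auto
  let ?c = "\<lambda>a. \<bar>ln (a / s) - ln ((1 - a) / (1 - s))\<bar>"
  have "continuous_on \<Theta> ?c"
    using T(2) s01 p by (intro continuous_intros) fastforce+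
  then have "bdd_above (?c ` \<Theta>)"
    using T(1) by (intro bounded_imp_bdd_above compact_imp_bounded compact_continuous_image)
  then obtain C0 where C0: "\<And>a. a \<in> \<Theta> \<Longrightarrow> ?c a \<le> C0"
    unfolding bdd_above_def by blast
  define C where "C = max C0 1"
  have C: "0 < C" "\<And>a. a \<in> \<Theta> \<Longrightarrow> ?c a \<le> C"
    using C0 by (auto simp: C_def intro: le_max_iff_disj[THEN iffD2])
  have "sup_ratio (\<Theta> - KL_nbhd \<Theta> s (2 * \<beta>)) p s u v \<le> ereal (ln (1 / p) - \<beta> * real v + max 0 (dev_excess C \<beta> s u v))" for u v
    unfolding sup_ratio_def
  proof (rule SUP_least)
    fix a assume "a \<in> \<Theta> - KL_nbhd \<Theta> s (2 * \<beta>)"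
    then have a: "a \<in> \<Theta>" "2 * \<beta> < d_KL s a" by (auto simp: KL_nbhd_def)
    have a01: "0 < a" "a < 1 / 2" using a T(2) p by auto
    define N where "N = real (Suc u) + real v"
    have N: "real v \<le> N" by (simp add: N_def)
    have "phi p a u v - phi p s u v \<le> ln (1 / p) - N * d_KL s a + ?c a * freq_dev s (Suc u) v"
      unfolding N_def by (rule phi_diff_le[OF p s01 a01])
    also have "\<dots> \<le> ln (1 / p) - N * (2 * \<beta>) + C * freq_dev s (Suc u) v"
      using a C(2)[OF a(1)] N by (intro add_mono diff_mono mult_left_mono mult_right_mono) (auto simp: freq_dev_def)
    also have "\<dots> = ln (1 / p) - \<beta> * N + dev_excess C \<beta> s u v"
      by (simp add: dev_excess_def N_def algebra_simps)
    also have "\<dots> \<le> ln (1 / p) - \<beta> * real v + max 0 (dev_excess C \<beta> s u v)"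
      using N \<beta> by (intro add_mono diff_mono mult_left_mono) auto
    finally show "ereal (phi p a u v - phi p s u v) \<le> ereal (ln (1 / p) - \<beta> * real v + max 0 (dev_excess C \<beta> s u v))"
      by simp
  qed
  then show ?thesis using that C(1) by blast
qed

text \<open>
  If the average does not fall below \<open>K\<close>, then either the excess terms have a sum of at least
  \<open>D n\<close>, which the Markov inequality makes unlikely for large \<open>D\<close>, or the entries have a sum of at most
  a constant times \<open>n\<close>, which contradicts superlinear growth.
\<close>

lemma sup_ratio_chain:
  assumes p: "0 < p" "p < 1 / 2" and T: "compact \<Theta>" "\<Theta> \<subseteq> {0<..<p}" and s: "s \<in> \<Theta>" and \<alpha>: "0 < \<alpha>"
  defines "V \<equiv> \<Theta> - KL_nbhd \<Theta> s \<alpha>"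
  shows "(\<lambda>n. measure_pmf.prob (chain_pmf p s n 0) {ls. length ls = n \<and>
     ereal K \<le> ereal (1 / real n) * (\<Sum>x<n. sup_ratio V p s (profile_at ls (Suc x)) (profile_at ls x))}) \<longlonglongrightarrow> 0"
proof -
  have s01: "0 < s" "s < p" "s < 1" using s T(2) p by auto
  define \<beta> where "\<beta> = \<alpha> / 2"
  have \<beta>: "0 < \<beta>" "V = \<Theta> - KL_nbhd \<Theta> s (2 * \<beta>)" using \<alpha> by (simp_all add: \<beta>_def V_def)
  define E where "E = ln (1 / p)"
  obtain C where C: "0 < C" and sup: "\<And>u v. sup_ratio V p s u v \<le> ereal (E - \<beta> * real v + max 0 (dev_excess C \<beta> s u v))"
    unfolding \<beta>(2) E_def using sup_ratio_le[OF p T s \<beta>(1)] by blast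
  define g where "g u v = max 0 (dev_excess C \<beta> s u v)" for u v
  obtain G where G: "0 \<le> G" "\<And>u. (\<integral>\<^sup>+v. ennreal (g u v) \<partial>visit_pmf p s u) \<le> ennreal G"
  proof -
    obtain G where "0 \<le> G" "\<And>u. (\<integral>\<^sup>+v. ennreal (dev_excess C \<beta> s u v) \<partial>visit_pmf p s u) \<le> ennreal G"
      using dev_excess_visit_pmf_le[of p s C \<beta>] p s01 C \<beta>(1) by auto
    moreover have "ennreal (max 0 y) = ennreal y" for y by (cases "0 \<le> y") (auto simp: max_def ennreal_neg)
    ultimately show ?thesis using that[of G] by (simp only: g_def)
  qed
  let ?P = "\<lambda>n. measure_pmf.prob (chain_pmf p s n 0)"
  let ?S = "pair_sum (\<lambda>u v. ennreal (g u v)) 0"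
  let ?B = "\<lambda>n. {ls. length ls = n \<and> ereal K \<le> ereal (1 / real n) * (\<Sum>x<n. sup_ratio V p s (profile_at ls (Suc x)) (profile_at ls x))}"
  show ?thesis
  proof (rule LIMSEQ_I)
    fix \<eta> :: real assume \<eta>: "0 < \<eta>"
    \<comment> \<open>By the Markov inequality the excess terms sum to more than \<open>D n\<close> with probability at most \<open>G / D \<le> \<eta> / 2\<close>.\<close>
    define D where "D = 2 * (G + 1) / \<eta>"
    have D: "0 < D" using G \<eta> by (simp add: D_def)
    \<comment> \<open>If the excess terms stay below \<open>D n\<close>, the entries must sum to at most \<open>K' n\<close>.\<close>
    define K' where "K' = max 0 ((E - K + D) / \<beta>)"
    let ?E2 = "\<lambda>n. {ls. real (sum_list ls) \<le> K' * real n}"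
    let ?E1 = "\<lambda>n. {ls. 1 \<le> ennreal (1 / (D * real n)) * ?S ls}"
    have "\<forall>\<^sub>F n in sequentially. ?P n (?E2 n) < \<eta> / 2"
      using chain_sum_superlinear[OF p s01(1,2), of K'] \<eta> by (intro order_tendstoD) (auto simp: K'_def)
    then obtain n0 where n0: "\<And>n. n0 \<le> n \<Longrightarrow> ?P n (?E2 n) < \<eta> / 2"
      by (auto simp: eventually_sequentially)
    show "\<exists>no. \<forall>n\<ge>no. norm (?P n (?B n) - 0) < \<eta>"
    proof (intro exI[of _ "max n0 1"] allI impI)
      fix n assume "max n0 1 \<le> n"
      then have n: "n0 \<le> n" "0 < n" by auto
      have sub: "?B n \<subseteq> ?E1 n \<union> ?E2 n"
      proof
        fix ls assume ls: "ls \<in> ?B n"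
        then have len: "length ls = n" by simp
        define S where "S = (\<Sum>x<n. g (profile_at ls (Suc x)) (profile_at ls x))"
        have S0: "0 \<le> S" unfolding S_def g_def by (intro sum_nonneg) simp
        have "ereal K \<le> ereal (1 / real n) * (\<Sum>x<n. sup_ratio V p s (profile_at ls (Suc x)) (profile_at ls x))" using ls by simp
        also have "\<dots> \<le> ereal (1 / real n) * (\<Sum>x<n. ereal (E - \<beta> * real (profile_at ls x) + g (profile_at ls (Suc x)) (profile_at ls x)))"
          unfolding g_def by (intro ereal_mult_left_mono sum_mono sup) simp
        also have "\<dots> = ereal (1 / real n * (\<Sum>x<n. E - \<beta> * real (profile_at ls x) + g (profile_at ls (Suc x)) (profile_at ls x)))"
          by simp
        also have "(\<Sum>x<n. E - \<beta> * real (profile_at ls x) + g (profile_at ls (Suc x)) (profile_at ls x)) = real n * E - \<beta> * real (sum_list ls) + S"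
          unfolding sum_profile_at[OF len, symmetric] S_def by (simp add: sum.distrib sum_subtractf sum_distrib_left)
        finally have "K \<le> 1 / real n * (real n * E - \<beta> * real (sum_list ls) + S)" by simp
        then have main: "\<beta> * real (sum_list ls) \<le> real n * (E - K) + S" using n by (simp add: field_simps)
        show "ls \<in> ?E1 n \<union> ?E2 n"
        proof (cases "D * real n \<le> S")
          case True
          have "?S ls = ennreal S"
            unfolding pair_sum_profile_at[OF len] S_def by (rule sum_ennreal) (simp add: g_def)
          moreover have "1 \<le> ennreal (1 / (D * real n)) * ennreal S"
          proof -
            have "1 \<le> 1 / (D * real n) * S" using True D n by (simp add: field_simps)
            then have "ennreal 1 \<le> ennreal (1 / (D * real n) * S)" by (rule ennreal_leI)
            then show ?thesis using D S0 by (subst ennreal_mult'[symmetric]) simp_all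
          qed
          ultimately show ?thesis by simp
        next
          case False
          then have "\<beta> * real (sum_list ls) \<le> (E - K + D) * real n" using main by (simp add: algebra_simps)
          then have "real (sum_list ls) \<le> (E - K + D) / \<beta> * real n" using \<beta>(1) by (simp add: field_simps)
          also have "\<dots> \<le> K' * real n" by (intro mult_right_mono) (auto simp: K'_def)
          finally show ?thesis by simp
        qed
      qed
      have E1: "?P n (?E1 n) \<le> \<eta> / 2"
      proof -
        have "emeasure (chain_pmf p s n 0) (?E1 n) \<le> ennreal (1 / (D * real n)) * (\<integral>\<^sup>+ls. ?S ls \<partial>chain_pmf p s n 0)"
          using nn_integral_Markov_inequality[where u="?S" and M="measure_pmf (chain_pmf p s n 0)" and A=UNIV and c="ennreal (1 / (D * real n))"] by simp
        also have "\<dots> \<le> ennreal (1 / (D * real n)) * (of_nat n * ennreal G)"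
          by (intro mult_left_mono nn_integral_pair_sum_le G(2)) simp
        also have "\<dots> = ennreal (1 / (D * real n) * (real n * G))"
          using G(1) D by (simp add: ennreal_of_nat_eq_real_of_nat ennreal_mult' del: times_divide_eq_left)
        also have "1 / (D * real n) * (real n * G) = G / D" using n D by simp
        also have "G / D \<le> \<eta> / 2" using G(1) \<eta> by (simp add: D_def field_simps)
        finally show ?thesis using \<eta> by (simp add: measure_pmf.emeasure_eq_measure ennreal_leI)
      qed
      have "?P n (?B n) \<le> ?P n (?E1 n \<union> ?E2 n)"
        by (rule measure_pmf.finite_measure_mono[OF sub]) simp
      also have "\<dots> \<le> ?P n (?E1 n) + ?P n (?E2 n)" by (rule measure_Un_le) simp_all
      also have "\<dots> < \<eta>" using E1 n0[OF n(1)] by simp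
      finally show "norm (?P n (?B n) - 0) < \<eta>" by simp
    qed
  qed
qed

lemma sup_ratio_left_steps:
  "ereal (1 / real n) * (\<Sum>x<n. SUP a\<in>V. ereal (phi p a (left_steps (x + 1) n X) (left_steps x n X) - phi p s (left_steps (x + 1) n X) (left_steps x n X)))
    = ereal (1 / real n) * (\<Sum>x<n. sup_ratio V p s (profile_at (left_profile n X) (Suc x)) (profile_at (left_profile n X) x))"
  unfolding sup_ratio_def by (intro arg_cong2[where f="(*)"] sum.cong refl) (simp add: left_steps_eq_profile_at)

lemma sup_ratio_annealed:
  assumes p: "0 < p" "p < 1 / 2" and T: "compact \<Theta>" "\<Theta> \<subseteq> {0<..<p}" and s: "s \<in> \<Theta>" and \<alpha>: "0 < \<alpha>"
  defines "V \<equiv> \<Theta> - KL_nbhd \<Theta> s \<alpha>"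
  shows "tendsto_minfty_in_prob (annealed p s)
    (\<lambda>n X. ereal (1 / real n) * (\<Sum>x<n. SUP a\<in>V. ereal (phi p a (left_steps (x + 1) n X) (left_steps x n X)
                  - phi p s (left_steps (x + 1) n X) (left_steps x n X))))"
  unfolding tendsto_minfty_in_prob_def sup_ratio_left_steps
proof
  fix K :: real
  interpret A: prob_space "annealed p s" by (rule prob_space_annealed)
  let ?H = "\<lambda>n ls. ereal (1 / real n) * (\<Sum>x<n. sup_ratio V p s (profile_at ls (Suc x)) (profile_at ls x))"
  let ?B = "\<lambda>n. {ls. length ls = n \<and> ereal K \<le> ?H n ls}"
  have eq: "measure (annealed p s) {X \<in> space (annealed p s). ?H n (left_profile n X) < ereal K} =
    1 - measure (annealed p s) {X. left_profile n X \<in> ?B n}" for n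
  proof -
    have set_eq: "{X \<in> space (annealed p s). ?H n (left_profile n X) < ereal K} = space (annealed p s) - {X. left_profile n X \<in> ?B n}"
      by (auto simp: space_annealed length_left_profile not_le)
    show ?thesis unfolding set_eq by (rule A.prob_compl[OF sets_left_profile_event])
  qed
  have "(\<lambda>n. measure (annealed p s) {X. left_profile n X \<in> ?B n}) \<longlonglongrightarrow> 0"
  proof (rule tendsto_sandwich[OF _ _ tendsto_const])
    show "(\<lambda>n. measure_pmf.prob (chain_pmf p s n 0) (?B n)) \<longlonglongrightarrow> 0"
      unfolding V_def by (rule sup_ratio_chain[OF p T s \<alpha>])
    show "\<forall>\<^sub>F n in sequentially. measure (annealed p s) {X. left_profile n X \<in> ?B n} \<le> measure_pmf.prob (chain_pmf p s n 0) (?B n)"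
      using p T s by (intro always_eventually allI measure_annealed_left_profile_le) auto
  qed simp
  from tendsto_diff[OF tendsto_const this, of 1]
  show "(\<lambda>n. measure (annealed p s) {X \<in> space (annealed p s). ?H n (left_profile n X) < ereal K}) \<longlonglongrightarrow> 1"
    unfolding eq by simp
qed

text \<open>
  Outside the neighbourhood the criterion is smaller than at \<open>s\<close>, which belongs to \<open>\<Theta>\<close>; the
  reference parameter of the criterion cancels in the comparison.
\<close>

lemma argmax_in_KL_nbhd:
  assumes n: "0 < n" and s: "s \<in> \<Theta>" and am: "is_arg_max (crit p a0 n X) (\<lambda>a. a \<in> \<Theta>) b"
    and neg: "ereal (1 / real n) * (\<Sum>x<n. SUP a\<in>\<Theta> - KL_nbhd \<Theta> s \<alpha>. ereal (phi p a (left_steps (x + 1) n X) (left_steps x n X)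
                  - phi p s (left_steps (x + 1) n X) (left_steps x n X))) < 0"
  shows "b \<in> KL_nbhd \<Theta> s \<alpha>"
proof (rule ccontr)
  let ?d = "\<lambda>a x. phi p a (left_steps (x + 1) n X) (left_steps x n X) - phi p s (left_steps (x + 1) n X) (left_steps x n X)"
  let ?S = "\<Sum>x<n. SUP a\<in>\<Theta> - KL_nbhd \<Theta> s \<alpha>. ereal (?d a x)"
  assume "b \<notin> KL_nbhd \<Theta> s \<alpha>"
  then have b: "b \<in> \<Theta> - KL_nbhd \<Theta> s \<alpha>" using am by (simp add: is_arg_max_def)
  have "?S < 0"
  proof (rule ccontr)
    assume "\<not> ?S < 0"
    then have "0 \<le> ereal (1 / real n) * ?S" by (intro ereal_0_le_mult) auto
    then show False using neg by simp
  qed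
  moreover have "ereal (\<Sum>x<n. ?d b x) \<le> ?S"
    unfolding sum_ereal[symmetric] using b by (intro sum_mono SUP_upper)
  ultimately have "ereal (\<Sum>x<n. ?d b x) < 0" by (rule le_less_trans[rotated])
  moreover have "crit p a0 n X b - crit p a0 n X s = (\<Sum>x<n. ?d b x)"
    by (simp add: crit_def sum_subtractf[symmetric])
  ultimately have "crit p a0 n X b < crit p a0 n X s" by (simp add: zero_ereal_def)
  then show False using am s by (auto simp: is_arg_max_def)
qed

lemma mle_consistent:
  assumes p: "0 < p" "p < 1 / 2" and T: "compact \<Theta>" "\<Theta> \<subseteq> {0<..<p}" and s: "s \<in> \<Theta>"
    and \<theta>: "\<And>n. 1 \<le> n \<Longrightarrow> \<theta>hat n \<in> borel_measurable (annealed p s)"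
      "\<And>n. 1 \<le> n \<Longrightarrow> AE X in annealed p s. is_arg_max (crit p a0 n X) (\<lambda>a. a \<in> \<Theta>) (\<theta>hat n X)"
  shows "tendsto_in_prob (annealed p s) \<theta>hat s"
  unfolding tendsto_in_prob_def
proof (intro allI impI)
  fix \<epsilon> :: real assume \<epsilon>: "0 < \<epsilon>"
  interpret A: prob_space "annealed p s" by (rule prob_space_annealed)
  have "\<Theta> \<subseteq> {0<..<1}" "0 < s" "s < 1" using T s p by auto
  then obtain \<alpha> where \<alpha>: "0 < \<alpha>" "\<And>a. a \<in> \<Theta> \<Longrightarrow> d_KL s a \<le> \<alpha> \<Longrightarrow> \<bar>a - s\<bar> \<le> \<epsilon>"
    using d_KL_separates[OF T(1) _ _ _ \<epsilon>] by blast
  define V where "V = \<Theta> - KL_nbhd \<Theta> s \<alpha>"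
  define Y where "Y n X = ereal (1 / real n) * (\<Sum>x<n. SUP a\<in>V. ereal (phi p a (left_steps (x + 1) n X) (left_steps x n X)
                  - phi p s (left_steps (x + 1) n X) (left_steps x n X)))" for n X
  let ?G = "\<lambda>n. {X \<in> space (annealed p s). Y n X < ereal 0}"
  have lim: "(\<lambda>n. A.prob (?G n)) \<longlonglongrightarrow> 1"
    using sup_ratio_annealed[OF p T s \<alpha>(1)] unfolding tendsto_minfty_in_prob_def Y_def V_def by blast
  have G: "?G n \<in> A.events" for n
  proof -
    have "?G n = {X. left_profile n X \<in> {ls. ereal (1 / real n) * (\<Sum>x<n. sup_ratio V p s (profile_at ls (Suc x)) (profile_at ls x)) < ereal 0}}"
      unfolding Y_def sup_ratio_left_steps by (auto simp: space_annealed)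
    then show ?thesis by (simp only: sets_left_profile_event)
  qed
  have le: "A.prob {X \<in> space (annealed p s). \<bar>\<theta>hat n X - s\<bar> > \<epsilon>} \<le> 1 - A.prob (?G n)" if n: "1 \<le> n" for n
  proof -
    have "A.prob {X \<in> space (annealed p s). \<bar>\<theta>hat n X - s\<bar> > \<epsilon>} \<le> A.prob (space (annealed p s) - ?G n)"
    proof (rule A.finite_measure_mono_AE)
      show "AE X in annealed p s. X \<in> {X \<in> space (annealed p s). \<bar>\<theta>hat n X - s\<bar> > \<epsilon>} \<longrightarrow> X \<in> space (annealed p s) - ?G n"
        using \<theta>(2)[OF n]
      proof eventually_elim
        fix X assume am: "is_arg_max (crit p a0 n X) (\<lambda>a. a \<in> \<Theta>) (\<theta>hat n X)"
        have "\<theta>hat n X \<in> KL_nbhd \<Theta> s \<alpha>" if "Y n X < ereal 0"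
          using that n argmax_in_KL_nbhd[OF _ s am, of \<alpha>] unfolding Y_def V_def by (simp add: zero_ereal_def)
        then show "X \<in> {X \<in> space (annealed p s). \<bar>\<theta>hat n X - s\<bar> > \<epsilon>} \<longrightarrow> X \<in> space (annealed p s) - ?G n"
          using \<alpha>(2) by (force simp: KL_nbhd_def)
      qed
      show "space (annealed p s) - ?G n \<in> A.events" using G by (rule sets.compl_sets)
    qed
    then show ?thesis using A.prob_compl[OF G] by simp
  qed
  have "(\<lambda>n. 1 - A.prob (?G n)) \<longlonglongrightarrow> 1 - 1" by (intro tendsto_diff tendsto_const lim)
  then have lim0: "(\<lambda>n. 1 - A.prob (?G n)) \<longlonglongrightarrow> 0" by simp
  show "(\<lambda>n. A.prob {X \<in> space (annealed p s). \<bar>\<theta>hat n X - s\<bar> > \<epsilon>}) \<longlonglongrightarrow> 0"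
  proof (rule tendsto_sandwich[OF _ _ tendsto_const lim0])
    show "\<forall>\<^sub>F n in sequentially. A.prob {X \<in> space (annealed p s). \<bar>\<theta>hat n X - s\<bar> > \<epsilon>} \<le> 1 - A.prob (?G n)"
      using eventually_ge_at_top[of 1] by eventually_elim (rule le)
  qed simp
qed

theorem proposition2p9:
  fixes p astar a0 :: real and \<Theta> :: "real set"
  assumes "0 < p" "p < 1 / 2"
    and "compact \<Theta>" "\<Theta> \<subseteq> {0<..<p}"
    and "astar \<in> interior \<Theta>"
    and "a0 \<in> \<Theta>"
  shows
    "(\<forall>\<alpha>>0. tendsto_minfty_in_prob (annealed p astar)
        (\<lambda>n X. ereal (1 / real n) * (\<Sum>x<n. SUP a\<in>\<Theta> - KL_nbhd \<Theta> astar \<alpha>.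
           ereal (phi p a (left_steps (x + 1) n X) (left_steps x n X)
                  - phi p astar (left_steps (x + 1) n X) (left_steps x n X))))) \<and>
     (\<forall>\<theta>hat. (\<forall>n\<ge>1. \<theta>hat n \<in> borel_measurable (annealed p astar) \<and>
                     (AE X in annealed p astar. is_arg_max (crit p a0 n X) (\<lambda>a. a \<in> \<Theta>) (\<theta>hat n X)))
        \<longrightarrow> tendsto_in_prob (annealed p astar) \<theta>hat astar) \<and>
     (\<forall>a\<in>\<Theta>. (\<Sum>\<^sub>\<infinity>(u, v)\<in>UNIV. ennreal (pi_tilde p a u v * (phi' p a u v)\<^sup>2)) = \<infinity>) \<and>
     (\<forall>a\<in>\<Theta>. a \<noteq> astar \<longrightarrow>
        (\<Sum>\<^sub>\<infinity>(u, v)\<in>UNIV. ennreal (pi_tilde p astar u v * \<bar>phi' p a u v\<bar>)) = \<infinity>)"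
proof (intro conjI allI impI ballI)
  note p = assms(1,2) and T = assms(3,4)
  have s: "astar \<in> \<Theta>" using assms(5) interior_subset by blast
  have range: "0 < a" "a < p" "a < 1 / 2" if "a \<in> \<Theta>" for a using that T(2) p by auto
  show "tendsto_minfty_in_prob (annealed p astar)
        (\<lambda>n X. ereal (1 / real n) * (\<Sum>x<n. SUP a\<in>\<Theta> - KL_nbhd \<Theta> astar \<alpha>.
           ereal (phi p a (left_steps (x + 1) n X) (left_steps x n X)
                  - phi p astar (left_steps (x + 1) n X) (left_steps x n X))))" if "0 < \<alpha>" for \<alpha>
    by (rule sup_ratio_annealed[OF p T s that])
  show "tendsto_in_prob (annealed p astar) \<theta>hat astar"
    if "\<forall>n\<ge>1. \<theta>hat n \<in> borel_measurable (annealed p astar) \<and>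
          (AE X in annealed p astar. is_arg_max (crit p a0 n X) (\<lambda>a. a \<in> \<Theta>) (\<theta>hat n X))" for \<theta>hat
    using that by (intro mle_consistent[OF p T s]) auto
  have p1: "p < 1" using p by simp
  show "(\<Sum>\<^sub>\<infinity>(u, v)\<in>UNIV. ennreal (pi_tilde p a u v * (phi' p a u v)\<^sup>2)) = \<infinity>" if a: "a \<in> \<Theta>" for a
  proof -
    obtain c C where "0 < c" "0 \<le> C"
      "\<And>u. ennreal (c * real (Suc u)) \<le> (\<integral>\<^sup>+v. ennreal ((phi' p a u v)\<^sup>2) \<partial>visit_pmf p a u) + ennreal C"
      using phi'_square_growth[OF p(1) p1 range(1,3)[OF a]] by blast
    then show ?thesis by (intro pi_tilde_sum_infinite[OF p range(1,2)[OF a], where c=c and C=C]) auto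
  qed
  show "(\<Sum>\<^sub>\<infinity>(u, v)\<in>UNIV. ennreal (pi_tilde p astar u v * \<bar>phi' p a u v\<bar>)) = \<infinity>" if a: "a \<in> \<Theta>" "a \<noteq> astar" for a
  proof -
    obtain c C where "0 < c" "0 \<le> C"
      "\<And>u. ennreal (c * real (Suc u)) \<le> (\<integral>\<^sup>+v. ennreal \<bar>phi' p a u v\<bar> \<partial>visit_pmf p astar u) + ennreal C"
      using abs_phi'_growth[OF p(1) p1 range(1,3)[OF a(1)] range(1,3)[OF s] a(2)] by blast
    then show ?thesis by (intro pi_tilde_sum_infinite[OF p range(1,2)[OF s], where c=c and C=C]) auto
  qed
qed

end
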